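(* Let $m>0$. For real-valued $A=(A_1,A_2,A_3)\in[L^3(\mathbb{R}^3)]^3$ let $H_A$ be the magnetic Dirac operator. Then: (i) $\mathrm{Ker}(H_A-m)$ is non-trivial if and only if $\mathrm{Ker}(H_A+m)$ is non-trivial; in other words, $$\{A\in[L^3(\mathbb{R}^3)]^3 \mid \mathrm{Ker}(H_A-m)\neq\{0\}\}=\{A\in[L^3(\mathbb{R}^3)]^3\mid \mathrm{Ker}(H_A+m)\neq\{0\}\}.$$ (ii) There exists a constant $c$ (independent of $A$) such that $$\dim(\mathrm{Ker}(H_A-m))=\dim(\mathrm{Ker}(H_A+m))\le c\int_{\mathbb{R}^3}|A(x)|^3\,dx .$$ Moreover, the dimension of $\mathrm{Ker}(H_A\mp m)$ is independent of $m$. (iii) The set $\{A\in[L^3(\mathbb{R}^3)]^3\mid \mathrm{Ker}(H_A\mp m)=\{0\}\}$ contains an open dense subset of $[L^3(\mathbb{R}^3)]^3$.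
   Context: $D=\frac1i\nabla_x$; $\sigma_1=\begin{pmatrix}0&1\\1&0\end{pmatrix}$, $\sigma_2=\begin{pmatrix}0&-i\\i&0\end{pmatrix}$, $\sigma_3=\begin{pmatrix}1&0\\0&-1\end{pmatrix}$ are the Pauli matrices; $\alpha_j=\begin{pmatrix}\mathbf 0&\sigma_j\\\sigma_j&\mathbf 0\end{pmatrix}$ $(j=1,2,3)$ and $\beta=\begin{pmatrix}I_2&\mathbf 0\\\mathbf 0&-I_2\end{pmatrix}$ are the Dirac matrices. Vector potentials are real-valued, so $[L^3(\mathbb{R}^3)]^3$ denotes the space of real vector potentials with components in $L^3$. For such $A$ the operator $-\alpha\cdot A$ is infinitesimally small with respect to $H_0=\alpha\cdot D+m\beta$, and the magnetic Dirac operator $H_A=\alpha\cdot(D-A(x))+m\beta$ is the self-adjoint operator in $[L^2(\mathbb{R}^3)]^4$ with domain $[H^1(\mathbb{R}^3)]^4$ defined as the operator sum of $H_0$ and $-\alpha\cdot A$. In the sentence about independence of $m$, $A$ is fixed and $m$ varies over the positive reals. The symbol $\mp$ in (iii) means the assertion holds for each choice of sign. *)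

theory Defs
  imports "HOL-Analysis.Analysis"
begin

section \<open>Measurable functions on three-space modulo null sets\<close>

definition ae_eq :: "(real^3 \<Rightarrow> 'b::euclidean_space) \<Rightarrow> (real^3 \<Rightarrow> 'b) \<Rightarrow> bool" where
  "ae_eq f g \<longleftrightarrow> f \<in> borel_measurable lborel \<and> g \<in> borel_measurable lborel
     \<and> (AE x in lborel. f x = g x)"

text \<open>Every Lebesgue measurable function agrees almost everywhere with a Borel function, so
  Borel representatives suffice.\<close>

quotient_type (overloaded) 'b mfun = "real^3 \<Rightarrow> 'b::euclidean_space" / partial: ae_eq
proof (rule part_equivpI)
  have "ae_eq (\<lambda>_. 0) (\<lambda>_. 0 :: 'b)"
    by (simp add: ae_eq_def)
  then show "\<exists>f::real^3 \<Rightarrow> 'b. ae_eq f f" by blast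
  show "symp (ae_eq :: (real^3 \<Rightarrow> 'b) \<Rightarrow> _)"
    by (auto simp: symp_def ae_eq_def elim: eventually_mono)
  show "transp (ae_eq :: (real^3 \<Rightarrow> 'b) \<Rightarrow> _)"
    unfolding transp_def ae_eq_def by (auto elim!: AE_mp)
qed

instantiation mfun :: (euclidean_space) real_vector
begin

lift_definition zero_mfun :: "'a mfun" is "\<lambda>_. 0"
  by (simp add: ae_eq_def)

lift_definition plus_mfun :: "'a mfun \<Rightarrow> 'a mfun \<Rightarrow> 'a mfun" is "\<lambda>f g x. f x + g x"
  by (auto simp: ae_eq_def elim!: AE_mp)

lift_definition minus_mfun :: "'a mfun \<Rightarrow> 'a mfun \<Rightarrow> 'a mfun" is "\<lambda>f g x. f x - g x"
  by (auto simp: ae_eq_def elim!: AE_mp)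

lift_definition uminus_mfun :: "'a mfun \<Rightarrow> 'a mfun" is "\<lambda>f x. - f x"
  by (auto simp: ae_eq_def elim!: AE_mp)

lift_definition scaleR_mfun :: "real \<Rightarrow> 'a mfun \<Rightarrow> 'a mfun" is "\<lambda>c f x. c *\<^sub>R f x"
  by (auto simp: ae_eq_def elim!: AE_mp)

instance
  by standard (transfer; auto simp: ae_eq_def algebra_simps)+

end

lift_definition Lp :: "nat \<Rightarrow> 'b::euclidean_space mfun \<Rightarrow> bool"
  is "\<lambda>p f. integrable lborel (\<lambda>x. norm (f x) ^ p)"
  apply (rule integrable_cong_AE)
  by (auto simp: ae_eq_def elim!: AE_mp)

lift_definition integral_norm_pow :: "nat \<Rightarrow> 'b::euclidean_space mfun \<Rightarrow> real"
  is "\<lambda>p f. LINT x|lborel. norm (f x) ^ p"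
  apply (rule integral_cong_AE)
  by (auto simp: ae_eq_def elim!: AE_mp)


section \<open>The space of vector potentials\<close>

lemma Lp_zero: "p > 0 \<Longrightarrow> Lp p 0"
  by transfer (simp add: zero_power)

lemma Lp_scaleR: "Lp p f \<Longrightarrow> Lp p (c *\<^sub>R f)"
  by transfer (auto simp: power_mult_distrib)

lemma integral_norm_pow_scaleR: "integral_norm_pow p (c *\<^sub>R f) = \<bar>c\<bar> ^ p * integral_norm_pow p f"
  by transfer (auto simp: power_mult_distrib)

lemma integral_norm_pow_nonneg: "integral_norm_pow p f \<ge> 0"
  by transfer simp

lemma integral_norm_pow_eq_0_iff:
  assumes "Lp p f" "p > 0" shows "integral_norm_pow p f = 0 \<longleftrightarrow> f = 0"
  using assms
proof (transfer, goal_cases)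
  case (1 p f)
  have "(LINT x|lborel. norm (f x) ^ p) = 0 \<longleftrightarrow> (AE x in lborel. norm (f x) ^ p = 0)"
    by (rule integral_nonneg_eq_0_iff_AE) (use 1 in auto)
  then show ?case using 1 by (auto simp: ae_eq_def elim!: AE_mp)
qed

text \<open>Pointwise convexity of the power function, in the form used for Minkowski's inequality.\<close>

lemma norm_add_power_le:
  fixes x y :: "'b::real_normed_vector"
  assumes "s > 0" "t > 0"
  shows "norm (x + y) ^ p \<le> (s + t) ^ p *
    (s / (s + t) * (norm x ^ p / s ^ p) + t / (s + t) * (norm y ^ p / t ^ p))"
proof -
  define l where "l = t / (s + t)"
  have l: "0 \<le> l" "l \<le> 1" "1 - l = s / (s + t)"
    using assms by (auto simp: l_def field_simps)
  have st: "s + t > 0" using assms by simp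
  have "norm (x + y) \<le> norm x + norm y" by (rule norm_triangle_ineq)
  also have "\<dots> = (s + t) * ((1 - l) * (norm x / s) + l * (norm y / t))"
    using assms st unfolding l(3) by (simp add: l_def distrib_left)
  finally have "norm (x + y) ^ p \<le> ((s + t) * ((1 - l) * (norm x / s) + l * (norm y / t))) ^ p"
    by (rule power_mono) simp
  also have "\<dots> = (s + t) ^ p * ((1 - l) * (norm x / s) + l * (norm y / t)) ^ p"
    by (simp add: power_mult_distrib)
  also have "\<dots> \<le> (s + t) ^ p * ((1 - l) * (norm x / s) ^ p + l * (norm y / t) ^ p)"
  proof (rule mult_left_mono)
    have "convex_on {0::real..} (\<lambda>x. x ^ p)"
      using convex_power_even[of p] convex_power_odd[of p]
      by (cases "even p") (auto intro: convex_on_subset)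
    from convex_onD[OF this l(1,2), of "norm x / s" "norm y / t"]
    show "((1 - l) * (norm x / s) + l * (norm y / t)) ^ p
      \<le> (1 - l) * (norm x / s) ^ p + l * (norm y / t) ^ p"
      using assms by simp
  qed (use st in simp)
  finally show ?thesis
    unfolding l(3) by (simp add: l_def power_divide)
qed

lemma Lp_add: assumes "Lp p f" "Lp p g" shows "Lp p (f + g)"
  using assms
proof (transfer, goal_cases)
  case (1 p f g)
  have [measurable]: "f \<in> borel_measurable lborel" "g \<in> borel_measurable lborel"
    using 1 by (auto simp: ae_eq_def)
  show ?case
  proof (rule Bochner_Integration.integrable_bound)
    show "integrable lborel (\<lambda>x. 2 ^ p * (norm (f x) ^ p / 2 + norm (g x) ^ p / 2))"
      using 1 by auto
    show "AE x in lborel. norm (norm (f x + g x) ^ p)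
        \<le> norm (2 ^ p * (norm (f x) ^ p / 2 + norm (g x) ^ p / 2))"
      using norm_add_power_le[of 1 1 "f x" "g x" p for x] by auto
  qed measurable
qed

lemma integral_norm_pow_add_le:
  assumes "Lp p f" "Lp p g" "s > 0" "t > 0"
    "integral_norm_pow p f \<le> s ^ p" "integral_norm_pow p g \<le> t ^ p"
  shows "integral_norm_pow p (f + g) \<le> (s + t) ^ p"
proof -
  have "integral_norm_pow p (f + g) \<le> (s + t) ^ p *
    (s / (s + t) * (integral_norm_pow p f / s ^ p) + t / (s + t) * (integral_norm_pow p g / t ^ p))"
    using assms(1,2) Lp_add[OF assms(1,2)]
  proof (transfer fixing: s t, goal_cases)
    case (1 p f g)
    have "(LINT x|lborel. norm (f x + g x) ^ p) \<le> (LINT x|lborel. (s + t) ^ p *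
      (s / (s + t) * (norm (f x) ^ p / s ^ p) + t / (s + t) * (norm (g x) ^ p / t ^ p)))"
      using 1 assms(3,4) by (intro integral_mono norm_add_power_le) auto
    then show ?case using 1 by simp
  qed
  also have "\<dots> \<le> (s + t) ^ p * (s / (s + t) * 1 + t / (s + t) * 1)"
    using assms by (intro mult_left_mono add_mono) (auto simp: divide_le_eq)
  also have "\<dots> = (s + t) ^ p"
    using assms by (simp add: add_divide_distrib[symmetric])
  finally show ?thesis .
qed

lemma minkowski:
  assumes "Lp p f" "Lp p g" "p > 0"
  shows "root p (integral_norm_pow p (f + g))
    \<le> root p (integral_norm_pow p f) + root p (integral_norm_pow p g)"
proof (rule field_le_epsilon)
  fix e :: real assume "e > 0"
  let ?s = "root p (integral_norm_pow p f)" and ?t = "root p (integral_norm_pow p g)"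
  have s: "?s \<ge> 0" "?t \<ge> 0"
    by (intro real_root_ge_zero integral_norm_pow_nonneg)+
  have pow: "integral_norm_pow p h \<le> (root p (integral_norm_pow p h) + e / 2) ^ p"
    for h :: "'a mfun"
  proof -
    have "integral_norm_pow p h = root p (integral_norm_pow p h) ^ p"
      using assms(3) by (simp add: integral_norm_pow_nonneg)
    also have "\<dots> \<le> (root p (integral_norm_pow p h) + e / 2) ^ p"
      using \<open>e > 0\<close> by (intro power_mono real_root_ge_zero integral_norm_pow_nonneg) simp
    finally show ?thesis .
  qed
  have "integral_norm_pow p (f + g) \<le> ((?s + e / 2) + (?t + e / 2)) ^ p"
    using s \<open>e > 0\<close> assms(1,2) pow
    by (intro integral_norm_pow_add_le) (auto intro: add_nonneg_pos)
  then have "root p (integral_norm_pow p (f + g)) \<le> root p (((?s + e / 2) + (?t + e / 2)) ^ p)"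
    using assms(3) by simp
  also have "\<dots> = (?s + e / 2) + (?t + e / 2)"
    using s \<open>e > 0\<close> assms(3) by (intro real_root_power_cancel) auto
  also have "\<dots> = ?s + ?t + e" by simp
  finally show "root p (integral_norm_pow p (f + g)) \<le> ?s + ?t + e" .
qed

typedef vecpot = "{A :: (real^3) mfun. Lp 3 A}" morphisms mfun_of Abs_vecpot
  using Lp_zero[of 3] by auto

setup_lifting type_definition_vecpot

instantiation vecpot :: real_vector
begin

lift_definition zero_vecpot :: vecpot is 0
  by (simp add: Lp_zero)

lift_definition plus_vecpot :: "vecpot \<Rightarrow> vecpot \<Rightarrow> vecpot" is "(+)"
  by (rule Lp_add)

lift_definition scaleR_vecpot :: "real \<Rightarrow> vecpot \<Rightarrow> vecpot" is "scaleR"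
  by (rule Lp_scaleR)

lift_definition uminus_vecpot :: "vecpot \<Rightarrow> vecpot" is "uminus"
  subgoal for A using Lp_scaleR[of 3 A "- 1"] by simp done

lift_definition minus_vecpot :: "vecpot \<Rightarrow> vecpot \<Rightarrow> vecpot" is "(-)"
  subgoal for A B using Lp_add[of 3 A "- 1 *\<^sub>R B"] Lp_scaleR[of 3 B "- 1"] by simp done

instance
  by standard (transfer, simp add: algebra_simps)+

end

text \<open>The norm is \<open>(\<integral> \<bar>A\<bar>\<^sup>3)\<^bsup>1/3\<^esup>\<close>, which is equivalent to the product norms on
  the threefold power of \<open>L\<^sup>3\<close>.\<close>

instantiation vecpot :: real_normed_vector
begin

lift_definition norm_vecpot :: "vecpot \<Rightarrow> real" is "\<lambda>A. root 3 (integral_norm_pow 3 A)" .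

definition dist_vecpot :: "vecpot \<Rightarrow> vecpot \<Rightarrow> real" where
  "dist_vecpot A B = norm (A - B)"

definition sgn_vecpot :: "vecpot \<Rightarrow> vecpot" where
  "sgn_vecpot A = A /\<^sub>R norm A"

definition uniformity_vecpot :: "(vecpot \<times> vecpot) filter" where
  "uniformity_vecpot = (INF e\<in>{0<..}. principal {(A, B). dist A B < e})"

definition open_vecpot :: "vecpot set \<Rightarrow> bool" where
  "open_vecpot S = (\<forall>A\<in>S. \<forall>\<^sub>F (A', B) in uniformity. A' = A \<longrightarrow> B \<in> S)"

instance
proof
  fix A B :: vecpot and c :: real
  show "norm A = 0 \<longleftrightarrow> A = 0"
    by transfer (simp add: integral_norm_pow_eq_0_iff)
  show "norm (A + B) \<le> norm A + norm B"
    by transfer (rule minkowski, auto)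
  show "norm (c *\<^sub>R A) = \<bar>c\<bar> * norm A"
    by transfer (simp add: integral_norm_pow_scaleR real_root_mult real_root_power_cancel)
qed (simp_all add: dist_vecpot_def sgn_vecpot_def uniformity_vecpot_def open_vecpot_def)

end


section \<open>Spinor fields and the first Sobolev space\<close>

type_synonym spinor_field = "(complex^4) mfun"

lemma borel_measurable_cmatrix [measurable]:
  fixes M :: "complex^4^4" and f :: "'a \<Rightarrow> complex^4"
  assumes "f \<in> borel_measurable N"
  shows "(\<lambda>x. M *v f x) \<in> borel_measurable N"
proof -
  have "continuous_on UNIV ((*v) M)"
    unfolding matrix_vector_mult_def by (intro continuous_intros)
  from borel_measurable_continuous_on[OF this assms] show ?thesis .
qed

lemma borel_measurable_cscale [measurable]:
  fixes c :: complex and f :: "'a \<Rightarrow> complex^4"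
  assumes "f \<in> borel_measurable N"
  shows "(\<lambda>x. c *s f x) \<in> borel_measurable N"
  using borel_measurable_cmatrix[OF assms, of "mat c"]
  by (simp add: matrix_vector_mult_def vector_scalar_mult_def mat_def if_distrib if_distribR
    cong: if_cong)

lift_definition scaleC :: "complex \<Rightarrow> spinor_field \<Rightarrow> spinor_field" (infixr "*\<^sub>C" 75)
  is "\<lambda>c f x. c *s f x"
  by (auto simp: ae_eq_def elim!: AE_mp)

interpretation cspace: vector_space "scaleC"
proof
  fix a b :: complex and x y :: spinor_field
  show "a *\<^sub>C (x + y) = a *\<^sub>C x + a *\<^sub>C y"
    by transfer (simp add: ae_eq_def vector_add_ldistrib)
  show "(a + b) *\<^sub>C x = a *\<^sub>C x + b *\<^sub>C x"
    by transfer (simp add: ae_eq_def vector_sadd_rdistrib)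
  show "a *\<^sub>C b *\<^sub>C x = (a * b) *\<^sub>C x"
    by transfer (simp add: ae_eq_def vector_smult_assoc)
  show "1 *\<^sub>C x = x"
    by transfer (simp add: ae_eq_def)
qed

text \<open>Since \<open>cspace.dim\<close> is \<open>0\<close> on infinite-dimensional subspaces, bounds on dimensions also
  need the following predicate.\<close>

definition fin_dim :: "spinor_field set \<Rightarrow> bool" where
  "fin_dim V \<longleftrightarrow> (\<exists>B. finite B \<and> V \<subseteq> cspace.span B)"

definition partial :: "3 \<Rightarrow> (real^3 \<Rightarrow> real) \<Rightarrow> real^3 \<Rightarrow> real" where
  "partial j f x = frechet_derivative f (at x) (axis j 1)"

primrec C_diff :: "nat \<Rightarrow> (real^3 \<Rightarrow> real) \<Rightarrow> bool" where
  "C_diff 0 f \<longleftrightarrow> continuous_on UNIV f"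
| "C_diff (Suc k) f \<longleftrightarrow> f differentiable_on UNIV \<and> (\<forall>j. C_diff k (partial j f))"

definition test_function :: "(real^3 \<Rightarrow> real) \<Rightarrow> bool" where
  "test_function f \<longleftrightarrow> (\<forall>k. C_diff k f) \<and> compact (closure {x. f x \<noteq> 0})"

lemma test_function_measurable:
  assumes "test_function f"
  shows "f \<in> borel_measurable lborel" "partial j f \<in> borel_measurable lborel"
proof -
  have "C_diff 0 f" "C_diff (Suc 0) f" using assms by (auto simp only: test_function_def)
  then show "f \<in> borel_measurable lborel" "partial j f \<in> borel_measurable lborel"
    by (simp_all add: borel_measurable_continuous_onI)
qed

text \<open>Used only for square integrable \<open>u\<close> and \<open>g\<close>, for which both integrands are integrable.\<close>

lift_definition weak_partial :: "3 \<Rightarrow> spinor_field \<Rightarrow> spinor_field \<Rightarrow> bool"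
  is "\<lambda>j u g. \<forall>f. test_function f \<longrightarrow>
    (LINT x|lborel. partial j f x *\<^sub>R u x) = - (LINT x|lborel. f x *\<^sub>R g x)"
proof -
  fix j :: 3 and u u' g g' :: "real^3 \<Rightarrow> complex^4"
  assume *: "ae_eq u u'" "ae_eq g g'"
  have "(LINT x|lborel. partial j f x *\<^sub>R u x) = (LINT x|lborel. partial j f x *\<^sub>R u' x)"
       "(LINT x|lborel. f x *\<^sub>R g x) = (LINT x|lborel. f x *\<^sub>R g' x)" if "test_function f" for f
  proof -
    have [measurable]: "f \<in> borel_measurable lborel" "partial j f \<in> borel_measurable lborel"
      "u \<in> borel_measurable lborel" "u' \<in> borel_measurable lborel"
      "g \<in> borel_measurable lborel" "g' \<in> borel_measurable lborel"
      using * test_function_measurable[OF that] by (simp_all add: ae_eq_def)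
    have ae: "AE x in lborel. u x = u' x" "AE x in lborel. g x = g' x"
      using * by (simp_all add: ae_eq_def)
    show "(LINT x|lborel. partial j f x *\<^sub>R u x) = (LINT x|lborel. partial j f x *\<^sub>R u' x)"
      by (rule integral_cong_AE) (use ae(1) in \<open>auto elim: eventually_mono\<close>)
    show "(LINT x|lborel. f x *\<^sub>R g x) = (LINT x|lborel. f x *\<^sub>R g' x)"
      by (rule integral_cong_AE) (use ae(2) in \<open>auto elim: eventually_mono\<close>)
  qed
  then show "(\<forall>f. test_function f \<longrightarrow>
      (LINT x|lborel. partial j f x *\<^sub>R u x) = - (LINT x|lborel. f x *\<^sub>R g x)) =
    (\<forall>f. test_function f \<longrightarrow>
      (LINT x|lborel. partial j f x *\<^sub>R u' x) = - (LINT x|lborel. f x *\<^sub>R g' x))"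
    by simp
qed

definition H1 :: "spinor_field set" where
  "H1 = {u. Lp 2 u \<and> (\<forall>j. \<exists>g. Lp 2 g \<and> weak_partial j u g)}"

text \<open>On \<open>H1\<close> the description below determines a unique element, by the fundamental lemma of the
  calculus of variations.\<close>

definition sobolev_partial :: "3 \<Rightarrow> spinor_field \<Rightarrow> spinor_field" where
  "sobolev_partial j u = (THE g. Lp 2 g \<and> weak_partial j u g)"

definition momentum :: "3 \<Rightarrow> spinor_field \<Rightarrow> spinor_field" where
  "momentum j u = (1 / \<i>) *\<^sub>C sobolev_partial j u"


section \<open>The magnetic Dirac operator\<close>

definition pauli :: "(complex^2^2)^3" where
  "pauli = vector [vector [vector [0, 1], vector [1, 0]],
                   vector [vector [0, - \<i>], vector [\<i>, 0]],
                   vector [vector [1, 0], vector [0, - 1]]]"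

definition block_matrix ::
  "complex^2^2 \<Rightarrow> complex^2^2 \<Rightarrow> complex^2^2 \<Rightarrow> complex^2^2 \<Rightarrow> complex^4^4" where
  "block_matrix P Q R S =
     vector [vector [P $ 1 $ 1, P $ 1 $ 2, Q $ 1 $ 1, Q $ 1 $ 2],
             vector [P $ 2 $ 1, P $ 2 $ 2, Q $ 2 $ 1, Q $ 2 $ 2],
             vector [R $ 1 $ 1, R $ 1 $ 2, S $ 1 $ 1, S $ 1 $ 2],
             vector [R $ 2 $ 1, R $ 2 $ 2, S $ 2 $ 1, S $ 2 $ 2]]"

definition dirac_alpha :: "3 \<Rightarrow> complex^4^4" where
  "dirac_alpha j = block_matrix 0 (pauli $ j) (pauli $ j) 0"

definition dirac_beta :: "complex^4^4" where
  "dirac_beta = block_matrix (mat 1) 0 0 (- mat 1)"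

lift_definition matrix_mult :: "complex^4^4 \<Rightarrow> spinor_field \<Rightarrow> spinor_field"
  is "\<lambda>M u x. M *v u x"
  by (auto simp: ae_eq_def elim!: AE_mp)

text \<open>Multiplication by the matrix-valued function \<open>\<alpha> \<cdot> A(x)\<close>.\<close>

lift_definition alpha_dot :: "(real^3) mfun \<Rightarrow> spinor_field \<Rightarrow> spinor_field"
  is "\<lambda>A u x. \<Sum>j\<in>UNIV. (A x $ j) *\<^sub>R (dirac_alpha j *v u x)"
proof -
  fix A A' :: "real^3 \<Rightarrow> real^3" and u u' :: "real^3 \<Rightarrow> complex^4"
  assume *: "ae_eq A A'" "ae_eq u u'"
  have [measurable]: "(\<lambda>x. B x $ j) \<in> borel_measurable lborel"
    if "B \<in> borel_measurable lborel" for B :: "real^3 \<Rightarrow> real^3" and j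
    using borel_measurable_continuous_on[OF _ that, of "\<lambda>v. v $ j"]
    by (simp add: continuous_on_component)
  show "ae_eq (\<lambda>x. \<Sum>j\<in>UNIV. (A x $ j) *\<^sub>R (dirac_alpha j *v u x))
              (\<lambda>x. \<Sum>j\<in>UNIV. (A' x $ j) *\<^sub>R (dirac_alpha j *v u' x))"
    unfolding ae_eq_def
  proof (intro conjI)
    have "AE x in lborel. A x = A' x" "AE x in lborel. u x = u' x"
      using * by (simp_all add: ae_eq_def)
    then show "AE x in lborel. (\<Sum>j\<in>UNIV. (A x $ j) *\<^sub>R (dirac_alpha j *v u x)) =
        (\<Sum>j\<in>UNIV. (A' x $ j) *\<^sub>R (dirac_alpha j *v u' x))"
      by eventually_elim simp
    have [measurable]: "A \<in> borel_measurable lborel" "A' \<in> borel_measurable lborel"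
      "u \<in> borel_measurable lborel" "u' \<in> borel_measurable lborel"
      using * by (simp_all add: ae_eq_def)
    show "(\<lambda>x. \<Sum>j\<in>UNIV. (A x $ j) *\<^sub>R (dirac_alpha j *v u x)) \<in> borel_measurable lborel"
      "(\<lambda>x. \<Sum>j\<in>UNIV. (A' x $ j) *\<^sub>R (dirac_alpha j *v u' x)) \<in> borel_measurable lborel"
      by (intro borel_measurable_sum borel_measurable_scaleR; measurable)+
  qed
qed

definition free_dirac :: "real \<Rightarrow> spinor_field \<Rightarrow> spinor_field" where
  "free_dirac m u = (\<Sum>j\<in>UNIV. matrix_mult (dirac_alpha j) (momentum j u))
     + m *\<^sub>R matrix_mult dirac_beta u"

text \<open>The operator has domain \<open>H1\<close>; its values outside \<open>H1\<close> carry no meaning.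
  On \<open>H1\<close> they are square integrable, by the Sobolev embedding into \<open>L\<^sup>6\<close> and Hoelder.\<close>

definition magnetic_dirac :: "real \<Rightarrow> vecpot \<Rightarrow> spinor_field \<Rightarrow> spinor_field" where
  "magnetic_dirac m A u = free_dirac m u - alpha_dot (mfun_of A) u"

definition dirac_ker :: "real \<Rightarrow> vecpot \<Rightarrow> real \<Rightarrow> spinor_field set" where
  "dirac_ker m A z = {u \<in> H1. magnetic_dirac m A u - z *\<^sub>R u = 0}"

end

theory Submission
  imports Defs
begin

text \<open>Write \<open>T = \<alpha> \<cdot> (D - A)\<close>. Because \<open>\<beta>\<close> anticommutes with the matrices \<open>\<alpha>\<^sub>j\<close>, a solution of
  \<open>H\<^sub>A u = \<plusminus> m u\<close> has \<open>T u = \<plusminus> m w\<close> and \<open>T w = 0\<close> for \<open>w = u \<mp> \<beta> u\<close>; symmetry of \<open>T\<close> then forces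
  \<open>w = 0\<close>. Hence the kernel of \<open>H\<^sub>A \<mp> m\<close> is \<open>{u. \<beta> u = \<plusminus> u \<and> T u = 0}\<close> (\<open>dirac_ker_eq\<close>), in which
  \<open>m\<close> no longer occurs. The matrix \<open>\<gamma>\<^sub>5\<close> commutes with \<open>T\<close> and anticommutes with \<open>\<beta>\<close>, so it
  exchanges the two kernels. This gives (i), the equality of the dimensions, and their
  independence of \<open>m\<close>.

  The bound on the dimension is an inequality of Cwikel-Lieb-Rozenblum type. The Clifford relations
  give \<open>\<parallel>\<alpha> \<cdot> D u\<parallel> = \<parallel>\<nabla>u\<parallel>\<close>. If \<open>u\<^sub>1, \<dots>, u\<^sub>n\<close> are solutions of \<open>T u = 0\<close> for which the
  \<open>\<alpha> \<cdot> D u\<^sub>i\<close> are orthonormal, then \<open>n = \<Sum> \<parallel>\<alpha> \<cdot> A u\<^sub>i\<parallel>\<^sup>2 = \<integral> \<bar>A\<bar>\<^sup>2 \<rho>\<close> with \<open>\<rho> = \<Sum> \<bar>u\<^sub>i\<bar>\<^sup>2\<close>. The core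
  estimate is \<open>\<integral> \<rho>\<^sup>3 \<le> C n\<close> (\<open>density_cube_bound\<close>); with \<open>\<bar>A\<bar>\<^sup>2 \<rho> \<le> s \<bar>A\<bar>\<^sup>3 + s\<^sup>-\<^sup>2 \<rho>\<^sup>3\<close> it
  yields \<open>n \<le> s \<integral> \<bar>A\<bar>\<^sup>3 + C n s\<^sup>-\<^sup>2\<close> up to constants, and a large fixed \<open>s\<close> absorbs the last term.

  The core estimate follows an argument of Rumin, carried out in position space. Split each \<open>u\<^sub>i\<close>
  into its average over balls of radius \<open>r\<close> and an oscillation. By a Bessel-type argument the
  averages contribute at most \<open>B / r\<close> to \<open>\<rho>\<close> at every point (\<open>avg_density_bound\<close>). The oscillations
  at the scales \<open>r = 2\<^sup>k\<close> are controlled together: by the parallelogram law the squared norms of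
  second differences at these scales telescope (\<open>square_function_bound\<close>). At a point, the scale
  \<open>r\<close> comparable to \<open>1 / \<rho>\<close> shows that the oscillation accounts for a fixed part of \<open>\<rho>\<close>, and integrating
  gives the cube. Differentiability enters through one property of the \<open>u\<^sub>i\<close>: for all combinations \<open>u\<close>
  of them, \<open>\<parallel>u(\<cdot> + h) - u\<parallel>\<close> grows at most linearly in \<open>h\<close> (\<open>shift_norm_kinetic\<close>).

  For (iii), take the interior of the set of potentials with trivial kernel. If it missed a ball
  around \<open>A\<close>, then for any number of distinct \<open>t\<^sub>i < 1\<close> close to \<open>1\<close> there would be potentials
  arbitrarily close to \<open>t\<^sub>i A\<close> with non-trivial kernel, hence approximate solutions of
  \<open>\<alpha> \<cdot> D u\<^sub>i = t\<^sub>i \<alpha> \<cdot> A u\<^sub>i\<close>. Like eigenvectors to distinct eigenvalues these are independent, with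
  quantitative control (\<open>robust_independence\<close>). Triangular orthonormalisation keeps the diagonal
  values \<open>1 / t\<^sub>i\<close> and produces \<open>n\<close> fields with \<open>\<alpha> \<cdot> D w\<^sub>i\<close> orthonormal and \<open>\<parallel>\<alpha> \<cdot> A w\<^sub>i\<parallel> \<ge> 1/2\<close>. The
  estimate above bounds their number by a multiple of \<open>\<integral> \<bar>A\<bar>\<^sup>3\<close>, a contradiction for large \<open>n\<close>.\<close>

section \<open>Square integrable spinor fields as a real inner product space\<close>

lemma inner_L2_integrable:
  fixes f g :: "'a \<Rightarrow> 'b::euclidean_space"
  assumes [measurable]: "f \<in> borel_measurable M" "g \<in> borel_measurable M"
    and "integrable M (\<lambda>x. norm (f x) ^ 2)" "integrable M (\<lambda>x. norm (g x) ^ 2)"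
  shows "integrable M (\<lambda>x. inner (f x) (g x))"
proof (rule Bochner_Integration.integrable_bound)
  show "integrable M (\<lambda>x. norm (f x) ^ 2 + norm (g x) ^ 2)"
    using assms by auto
  have "\<bar>f x \<bullet> g x\<bar> \<le> (norm (f x))\<^sup>2 + (norm (g x))\<^sup>2" for x
  proof -
    have "\<bar>f x \<bullet> g x\<bar> \<le> norm (f x) * norm (g x)" by (rule Cauchy_Schwarz_ineq2)
    also have "\<dots> \<le> (norm (f x))\<^sup>2 + (norm (g x))\<^sup>2"
      using sum_squares_bound[of "norm (f x)" "norm (g x)"]
        mult_nonneg_nonneg[OF norm_ge_zero[of "f x"] norm_ge_zero[of "g x"]] by linarith
    finally show ?thesis .
  qed
  then show "AE x in M. norm (f x \<bullet> g x) \<le> norm ((norm (f x))\<^sup>2 + (norm (g x))\<^sup>2)"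
    by auto
qed measurable

lift_definition inner_mfun :: "'b::euclidean_space mfun \<Rightarrow> 'b mfun \<Rightarrow> real"
  is "\<lambda>f g. LINT x|lborel. inner (f x) (g x)"
  by (rule integral_cong_AE) (auto simp: ae_eq_def elim!: AE_mp)

typedef l2 = "{u :: spinor_field. Lp 2 u}" morphisms field_of Abs_l2
  using Lp_zero[of 2] by auto

setup_lifting type_definition_l2

instantiation l2 :: real_vector
begin

lift_definition zero_l2 :: l2 is 0
  by (simp add: Lp_zero)

lift_definition plus_l2 :: "l2 \<Rightarrow> l2 \<Rightarrow> l2" is "(+)"
  by (rule Lp_add)

lift_definition scaleR_l2 :: "real \<Rightarrow> l2 \<Rightarrow> l2" is "scaleR"
  by (rule Lp_scaleR)

lift_definition uminus_l2 :: "l2 \<Rightarrow> l2" is "uminus"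
  subgoal for u using Lp_scaleR[of 2 u "- 1"] by simp done

lift_definition minus_l2 :: "l2 \<Rightarrow> l2 \<Rightarrow> l2" is "(-)"
  subgoal for u v using Lp_add[of 2 u "- 1 *\<^sub>R v"] Lp_scaleR[of 2 v "- 1"] by simp done

instance
  by standard (transfer, simp add: algebra_simps)+

end

lemma inner_mfun_facts:
  "inner_mfun f g = inner_mfun g f"
  "Lp 2 f \<Longrightarrow> Lp 2 g \<Longrightarrow> Lp 2 h \<Longrightarrow> inner_mfun (f + g) h = inner_mfun f h + inner_mfun g h"
  "inner_mfun (c *\<^sub>R f) h = c * inner_mfun f h"
  "inner_mfun f f = integral_norm_pow 2 f"
proof -
  show "inner_mfun f g = inner_mfun g f"
    by transfer (simp add: inner_commute)
  show "inner_mfun (c *\<^sub>R f) h = c * inner_mfun f h"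
    by transfer simp
  show "inner_mfun f f = integral_norm_pow 2 f"
    by transfer (simp add: power2_norm_eq_inner)
  show "Lp 2 f \<Longrightarrow> Lp 2 g \<Longrightarrow> Lp 2 h \<Longrightarrow> inner_mfun (f + g) h = inner_mfun f h + inner_mfun g h"
  proof (transfer, goal_cases)
    case (1 f g h)
    then show ?case
      by (simp add: inner_add_left ae_eq_def inner_L2_integrable)
  qed
qed

instantiation l2 :: real_inner
begin

lift_definition inner_l2 :: "l2 \<Rightarrow> l2 \<Rightarrow> real" is inner_mfun .

definition norm_l2 :: "l2 \<Rightarrow> real" where
  "norm_l2 u = sqrt (inner u u)"

definition dist_l2 :: "l2 \<Rightarrow> l2 \<Rightarrow> real" where
  "dist_l2 u v = norm (u - v)"

definition sgn_l2 :: "l2 \<Rightarrow> l2" where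
  "sgn_l2 u = u /\<^sub>R norm u"

definition uniformity_l2 :: "(l2 \<times> l2) filter" where
  "uniformity_l2 = (INF e\<in>{0<..}. principal {(u, v). dist u v < e})"

definition open_l2 :: "l2 set \<Rightarrow> bool" where
  "open_l2 S = (\<forall>u\<in>S. \<forall>\<^sub>F (u', v) in uniformity. u' = u \<longrightarrow> v \<in> S)"

instance
proof
  fix u v w :: l2 and c :: real
  show "inner u v = inner v u"
    by transfer (rule inner_mfun_facts)
  show "inner (u + v) w = inner u w + inner v w"
    by transfer (auto intro: inner_mfun_facts)
  show "inner (c *\<^sub>R u) v = c * inner u v"
    by transfer (rule inner_mfun_facts)
  show "0 \<le> inner u u"
    by transfer (simp add: inner_mfun_facts integral_norm_pow_nonneg)
  show "inner u u = 0 \<longleftrightarrow> u = 0"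
    by transfer (simp add: inner_mfun_facts integral_norm_pow_eq_0_iff)
qed (simp_all add: norm_l2_def dist_l2_def sgn_l2_def uniformity_l2_def open_l2_def)

end

text \<open>A fixed Borel representative; all statements about its values therefore hold almost everywhere only.\<close>

definition fun_of :: "l2 \<Rightarrow> real^3 \<Rightarrow> complex^4" where
  "fun_of u = rep_mfun (field_of u)"

definition sq_int :: "(real^3 \<Rightarrow> complex^4) \<Rightarrow> bool" where
  "sq_int f \<longleftrightarrow> f \<in> borel_measurable lborel \<and> integrable lborel (\<lambda>x. norm (f x) ^ 2)"

definition l2_of :: "(real^3 \<Rightarrow> complex^4) \<Rightarrow> l2" where
  "l2_of f = Abs_l2 (abs_mfun f)"

lemma ae_eq_refl_iff: "ae_eq f f \<longleftrightarrow> f \<in> borel_measurable lborel"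
  by (auto simp: ae_eq_def)

lemma rep_mfun_measurable [measurable]: "rep_mfun u \<in> borel_measurable lborel"
  using Quotient3_rep_reflp[OF Quotient3_mfun, of u] by (simp add: ae_eq_refl_iff)

lemma abs_rep_mfun [simp]: "abs_mfun (rep_mfun u) = u"
  by (rule Quotient3_abs_rep[OF Quotient3_mfun])

lemma abs_mfun_eq: 
  "f \<in> borel_measurable lborel \<Longrightarrow> g \<in> borel_measurable lborel \<Longrightarrow>
    abs_mfun f = abs_mfun g \<longleftrightarrow> (AE x in lborel. f x = g x)"
  using Quotient3_rel[OF Quotient3_mfun, of f g] by (auto simp: ae_eq_def)

lemma rep_abs_mfun: "f \<in> borel_measurable lborel \<Longrightarrow> AE x in lborel. rep_mfun (abs_mfun f) x = f x"
  using abs_mfun_eq[of "rep_mfun (abs_mfun f)" f] by simp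

lemma Lp_abs_mfun: "f \<in> borel_measurable lborel \<Longrightarrow> Lp p (abs_mfun f) \<longleftrightarrow> integrable lborel (\<lambda>x. norm (f x) ^ p)"
  by (rule Lp.abs_eq) (simp add: ae_eq_refl_iff eq_onp_def)

lemma fun_of_measurable [measurable]: "fun_of u \<in> borel_measurable lborel"
  by (simp add: fun_of_def)

lemma Lp_field_of [simp]: "Lp 2 (field_of u)"
  using field_of by auto

lemma abs_fun_of [simp]: "abs_mfun (fun_of u) = field_of u"
  by (simp add: fun_of_def)

lemma fun_of_sq_int [simp]: "sq_int (fun_of u)"
  using Lp_abs_mfun[of "fun_of u" 2] Lp_field_of[of u] by (simp add: sq_int_def)

lemma l2_of_fun_of [simp]: "l2_of (fun_of u) = u"
  by (simp add: l2_of_def field_of_inverse)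

lemma field_of_l2_of: "sq_int f \<Longrightarrow> field_of (l2_of f) = abs_mfun f"
  unfolding l2_of_def by (rule Abs_l2_inverse) (auto simp: sq_int_def Lp_abs_mfun)

lemma fun_of_l2_of: "sq_int f \<Longrightarrow> AE x in lborel. fun_of (l2_of f) x = f x"
  unfolding fun_of_def by (simp add: field_of_l2_of sq_int_def rep_abs_mfun)

lemma l2_of_eq_iff: "sq_int f \<Longrightarrow> sq_int g \<Longrightarrow> l2_of f = l2_of g \<longleftrightarrow> (AE x in lborel. f x = g x)"
  by (metis abs_mfun_eq field_of_inject field_of_l2_of sq_int_def)

lemma l2_eqI: "(AE x in lborel. fun_of u x = fun_of v x) \<Longrightarrow> u = v"
  using l2_of_eq_iff[of "fun_of u" "fun_of v"] by simp

lemma abs_mfun_plus: "f \<in> borel_measurable lborel \<Longrightarrow> g \<in> borel_measurable lborel \<Longrightarrow>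
   abs_mfun f + abs_mfun g = abs_mfun (\<lambda>x. f x + g x)"
  by (rule plus_mfun.abs_eq) (auto simp: ae_eq_refl_iff)

lemma abs_mfun_minus: "f \<in> borel_measurable lborel \<Longrightarrow> g \<in> borel_measurable lborel \<Longrightarrow>
   abs_mfun f - abs_mfun g = abs_mfun (\<lambda>x. f x - g x)"
  by (rule minus_mfun.abs_eq) (auto simp: ae_eq_refl_iff)

lemma abs_mfun_scaleR: "f \<in> borel_measurable lborel \<Longrightarrow>
   c *\<^sub>R abs_mfun f = abs_mfun (\<lambda>x. c *\<^sub>R f x)"
  by (rule scaleR_mfun.abs_eq) (auto simp: ae_eq_refl_iff)

lemma fun_of_AE_I: "f \<in> borel_measurable lborel \<Longrightarrow> field_of u = abs_mfun f \<Longrightarrow> AE x in lborel. fun_of u x = f x"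
  unfolding fun_of_def by (simp add: rep_abs_mfun)

lemma fun_of_plus: "AE x in lborel. fun_of (u + v) x = fun_of u x + fun_of v x"
  by (rule fun_of_AE_I) (auto simp: plus_l2.rep_eq abs_mfun_plus[symmetric])

lemma fun_of_minus: "AE x in lborel. fun_of (u - v) x = fun_of u x - fun_of v x"
  by (rule fun_of_AE_I) (auto simp: minus_l2.rep_eq abs_mfun_minus[symmetric])

lemma fun_of_scaleR: "AE x in lborel. fun_of (c *\<^sub>R u) x = c *\<^sub>R fun_of u x"
  by (rule fun_of_AE_I) (auto simp: scaleR_l2.rep_eq abs_mfun_scaleR[symmetric])

lemma fun_of_zero: "AE x in lborel. fun_of 0 x = 0"
  by (rule fun_of_AE_I) (auto simp: zero_l2.rep_eq zero_mfun_def)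

lemma inner_l2_fun_of: "inner u v = (LINT x|lborel. inner (fun_of u x) (fun_of v x))"
proof -
  have "inner u v = inner_mfun (abs_mfun (fun_of u)) (abs_mfun (fun_of v))"
    by (simp add: inner_l2.rep_eq)
  also have "\<dots> = (LINT x|lborel. inner (fun_of u x) (fun_of v x))"
    by (rule inner_mfun.abs_eq) (auto simp: ae_eq_refl_iff)
  finally show ?thesis .
qed

lemma norm_l2_fun_of: "norm u ^ 2 = (LINT x|lborel. norm (fun_of u x) ^ 2)"
  by (simp add: power2_norm_eq_inner inner_l2_fun_of)

lemma sq_int_D: "sq_int f \<Longrightarrow> integrable lborel (\<lambda>x. norm (f x) ^ 2)"
  by (simp add: sq_int_def)

lemma inner_l2_of: "sq_int f \<Longrightarrow> sq_int g \<Longrightarrow> inner (l2_of f) (l2_of g) = (LINT x|lborel. inner (f x) (g x))"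
  unfolding inner_l2_fun_of
  using fun_of_l2_of[of f] fun_of_l2_of[of g]
  by (intro integral_cong_AE) (auto simp: sq_int_def elim!: AE_mp)

lemma inner_l2_of_right: "sq_int g \<Longrightarrow> inner u (l2_of g) = (LINT x|lborel. inner (fun_of u x) (g x))"
  using inner_l2_of[of "fun_of u" g] by simp

lemma norm_l2_of: "sq_int f \<Longrightarrow> norm (l2_of f) ^ 2 = (LINT x|lborel. norm (f x) ^ 2)"
  by (simp add: power2_norm_eq_inner inner_l2_of)

lemma nn_norm_l2_of: "sq_int f \<Longrightarrow> (\<integral>\<^sup>+x. ennreal (norm (f x) ^ 2) \<partial>lborel) = ennreal (norm (l2_of f) ^ 2)"
  by (subst norm_l2_of) (auto intro!: nn_integral_eq_integral sq_int_D)

lemma sq_int_bounded: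
  assumes "sq_int f" "g \<in> borel_measurable lborel" "AE x in lborel. norm (g x) \<le> C * norm (f x)"
  shows "sq_int g"
  unfolding sq_int_def
proof
  show "integrable lborel (\<lambda>x. (norm (g x))\<^sup>2)"
  proof (rule Bochner_Integration.integrable_bound)
    show "integrable lborel (\<lambda>x. C^2 * norm (f x) ^ 2)"
      using assms by (auto simp: sq_int_def)
    have "(norm (g x))\<^sup>2 \<le> C\<^sup>2 * norm (f x) ^ 2" if "norm (g x) \<le> C * norm (f x)" for x
      using power_mono[OF that, of 2] by (simp add: power_mult_distrib)
    then show "AE x in lborel. norm ((norm (g x))\<^sup>2) \<le> norm (C\<^sup>2 * (norm (f x))\<^sup>2)"
      using assms(3) by (auto elim!: AE_mp)
  qed (use assms in auto)
qed fact

section \<open>Translations and constant matrices\<close>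

lemma sq_int_shift:
  assumes "sq_int f" shows "sq_int (\<lambda>x. f (x + h))"
proof -
  have [measurable]: "f \<in> borel_measurable borel" using assms by (simp add: sq_int_def)
  have "integrable (distr lborel borel ((+) h)) (\<lambda>x. (norm (f x))\<^sup>2)"
    using assms by (simp add: lborel_distr_plus sq_int_def)
  then have "integrable lborel (\<lambda>x. (norm (f (h + x)))\<^sup>2)"
    by (subst (asm) integrable_distr_eq) auto
  then show ?thesis by (simp add: sq_int_def add.commute)
qed

definition shift :: "real^3 \<Rightarrow> l2 \<Rightarrow> l2" where
  "shift h u = l2_of (\<lambda>x. fun_of u (x + h))"

lemma AE_shift:
  assumes "AE x in lborel. P x" shows "AE x in lborel. P (x + (h::real^3))"
proof -
  have "AE x in distr lborel borel ((+) h). P x"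
    using assms by (subst lborel_distr_plus)
  then have "AE x in lborel. P (h + x)"
    by (rule AE_distrD[rotated]) simp
  then show ?thesis by (simp add: add.commute)
qed

lemma fun_of_shift: "AE x in lborel. fun_of (shift h u) x = fun_of u (x + h)"
  unfolding shift_def by (rule fun_of_l2_of) (simp add: sq_int_shift)

lemma integral_shift: 
  fixes f :: "real^3 \<Rightarrow> 'b::{banach,second_countable_topology}"
  assumes [measurable]: "f \<in> borel_measurable borel"
  shows "(LINT x|lborel. f (x + h)) = (LINT x|lborel. f x)"
proof -
  have "(LINT x|lborel. f x) = (LINT x|distr lborel borel ((+) h). f x)"
    by (simp add: lborel_distr_plus)
  also have "\<dots> = (LINT x|lborel. f (h + x))"
    by (rule integral_distr) auto
  finally show ?thesis by (simp add: add.commute)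
qed

lemma shift_plus: "shift h (u + v) = shift h u + shift h v"
  by (rule l2_eqI)
    (use fun_of_shift[of h u] fun_of_shift[of h v] fun_of_shift[of h "u + v"] fun_of_plus[of "shift h u" "shift h v"]
      AE_shift[OF fun_of_plus[of u v], of h] in \<open>auto elim!: AE_mp\<close>)

lemma shift_scaleR: "shift h (c *\<^sub>R u) = c *\<^sub>R shift h u"
  by (rule l2_eqI)
    (use fun_of_shift[of h u] fun_of_shift[of h "c *\<^sub>R u"] fun_of_scaleR[of c "shift h u"]
      AE_shift[OF fun_of_scaleR[of c u], of h] in \<open>auto elim!: AE_mp\<close>)

lemma linear_shift: "linear (shift h)"
  by (rule linearI) (auto simp: shift_plus shift_scaleR)

lemmas shift_diff = linear_diff[OF linear_shift] and shift_zero = linear_0[OF linear_shift]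

lemma shift_shift: "shift h (shift k u) = shift (h + k) u"
  by (rule l2_eqI)
    (use fun_of_shift[of h "shift k u"] fun_of_shift[of "h + k" u] AE_shift[OF fun_of_shift[of k u], of h]
     in \<open>auto elim!: AE_mp simp: add.assoc\<close>)

lemma shift_0 [simp]: "shift 0 u = u"
  by (rule l2_eqI) (use fun_of_shift[of 0 u] in auto)

lemma inner_shift: "inner (shift h u) v = inner u (shift (- h) v)"
proof -
  have "inner (shift h u) v = (LINT x|lborel. inner (fun_of u (x + h)) (fun_of v x))"
    unfolding inner_l2_fun_of using fun_of_shift[of h u]
    by (intro integral_cong_AE) (auto elim!: AE_mp)
  also have "\<dots> = (LINT x|lborel. inner (fun_of u ((x + h))) (fun_of v ((x + h) - h)))"
    by simp
  also have "\<dots> = (LINT x|lborel. inner (fun_of u x) (fun_of v (x - h)))"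
    by (rule integral_shift[where f = "\<lambda>x. inner (fun_of u x) (fun_of v (x - h))"]) measurable
  also have "\<dots> = inner u (shift (- h) v)"
    unfolding inner_l2_fun_of using fun_of_shift[of "- h" v]
    by (intro integral_cong_AE) (auto elim!: AE_mp)
  finally show ?thesis .
qed

lemma norm_shift [simp]: "norm (shift h u) = norm u"
  by (simp add: norm_eq_sqrt_inner inner_shift shift_shift)

lemma norm_cmatrix_le:
  fixes M :: "complex^4^4"
  shows "\<exists>C. \<forall>v. norm (M *v v) \<le> C * norm v"
proof -
  have "linear ((*v) M :: complex^4 \<Rightarrow> complex^4)"
  proof (rule linearI)
    fix c and v :: "complex^4"
    show "M *v (c *\<^sub>R v) = c *\<^sub>R (M *v v)"
      by (simp add: vec_eq_iff matrix_vector_mult_def scaleR_sum_right)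
  qed (simp add: matrix_vector_right_distrib)
  then have "bounded_linear ((*v) M :: complex^4 \<Rightarrow> complex^4)"
    by (rule linear_conv_bounded_linear[THEN iffD1])
  then obtain K where "\<And>v. norm (M *v v) \<le> norm v * K"
    using bounded_linear.bounded by blast
  then show ?thesis
    by (intro exI[of _ K]) (simp add: mult.commute)
qed

lemma sq_int_cmatrix: 
  assumes "sq_int f" shows "sq_int (\<lambda>x. M *v f x)"
proof -
  obtain C where C: "\<forall>v. norm (M *v v) \<le> C * norm v"
    using norm_cmatrix_le[of M] by blast
  show ?thesis
  proof (rule sq_int_bounded[OF assms])
    show "AE x in lborel. norm (M *v f x) \<le> C * norm (f x)"
      using C by simp
    show "(\<lambda>x. M *v f x) \<in> borel_measurable lborel"
      using assms by (intro borel_measurable_cmatrix) (simp add: sq_int_def)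
  qed
qed

lemma matrix_mult_abs: "f \<in> borel_measurable lborel \<Longrightarrow>
    matrix_mult M (abs_mfun f) = abs_mfun (\<lambda>x. M *v f x)"
  by (rule matrix_mult.abs_eq) (simp add: ae_eq_refl_iff)

lemma field_of_sq_int: "Lp 2 u \<Longrightarrow> sq_int (rep_mfun u)"
  using Lp_abs_mfun[of "rep_mfun u" 2] by (simp add: sq_int_def)

lemma Lp_matrix_mult: assumes "Lp 2 u" shows "Lp 2 (matrix_mult M u)"
proof -
  have "sq_int (\<lambda>x. M *v rep_mfun u x)"
    by (rule sq_int_cmatrix[OF field_of_sq_int[OF assms]])
  then have "Lp 2 (abs_mfun (\<lambda>x. M *v rep_mfun u x))"
    by (simp add: Lp_abs_mfun sq_int_def)
  then show ?thesis
    by (subst (asm) matrix_mult_abs[symmetric]) simp_all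
qed

lift_definition mat_act :: "complex^4^4 \<Rightarrow> l2 \<Rightarrow> l2" is matrix_mult
  by (rule Lp_matrix_mult)

lemma fun_of_mat_act: "AE x in lborel. fun_of (mat_act M u) x = M *v fun_of u x"
  by (rule fun_of_AE_I) (simp_all add: borel_measurable_cmatrix mat_act.rep_eq matrix_mult_abs[symmetric])

section \<open>Smooth bump functions\<close>

text \<open>With \<open>k = 0\<close> this is the classical smooth function that is flat at \<open>0\<close>. The extra powers of
  \<open>1 / t\<close> make the family closed under differentiation up to linear combinations, which is what the class
  \<open>smooth\<close> below needs of its generators. The parameter \<open>c\<close> tends to \<open>0\<close> later, where the function
  approaches the indicator of the positive half-line.\<close>

definition flat_exp :: "real \<Rightarrow> nat \<Rightarrow> real \<Rightarrow> real" where
  "flat_exp c k t = (if t > 0 then inverse t ^ k * exp (- c / t) else 0)"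

lemma flat_exp_0_tendsto:
  assumes "c > 0" shows "((\<lambda>t. inverse t ^ k * exp (- c / t)) \<longlongrightarrow> 0) (at_right (0::real))"
proof -
  have "((\<lambda>x. x ^ k / exp x) \<longlongrightarrow> (0::real)) at_top"
    by (rule tendsto_power_div_exp_0)
  moreover have "filterlim (\<lambda>t. c * inverse t) at_top (at_right (0::real))"
    using assms by (intro filterlim_tendsto_pos_mult_at_top[OF tendsto_const] filterlim_inverse_at_top_right)
  ultimately have "((\<lambda>t. (c * inverse t) ^ k / exp (c * inverse t)) \<longlongrightarrow> 0) (at_right (0::real))"
    by (rule filterlim_compose)
  then have "((\<lambda>t. inverse c ^ k * ((c * inverse t) ^ k / exp (c * inverse t))) \<longlongrightarrow> inverse c ^ k * 0) (at_right (0::real))"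
    by (intro tendsto_intros)
  moreover have "inverse c ^ k * ((c * inverse t) ^ k / exp (c * inverse t)) = inverse t ^ k * exp (- c / t)" for t
    using assms by (simp add: power_mult_distrib exp_minus field_simps)
  ultimately show ?thesis by simp
qed

lemma DERIV_inverse_power:
  assumes "t > 0"
  shows "((\<lambda>t::real. inverse t ^ k) has_real_derivative - (real k * inverse t ^ (k + 1))) (at t)"
proof (induction k)
  case (Suc k)
  have "((\<lambda>t. inverse t * inverse t ^ k) has_real_derivative
      inverse t * - (real k * inverse t ^ (k + 1)) + - (inverse t ^ Suc (Suc 0)) * inverse t ^ k) (at t)"
    using DERIV_mult'[OF DERIV_inverse[of t] Suc] assms by simp
  then show ?case by (simp add: algebra_simps)
qed auto

lemma flat_exp_deriv:
  assumes "c > 0"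
  shows "(flat_exp c k has_real_derivative
    (c * flat_exp c (k + 2) t - k * flat_exp c (k + 1) t)) (at t)"
proof -
  consider "t > 0" | "t < 0" | "t = 0" by linarith
  then show ?thesis
  proof cases
    case 1
    have "((\<lambda>t. inverse t ^ k * exp (- c / t)) has_real_derivative
      (c * flat_exp c (k + 2) t - k * flat_exp c (k + 1) t)) (at t)"
    proof -
      have "((\<lambda>t. inverse t ^ k * exp (- c / t)) has_real_derivative
        inverse t ^ k * (exp (- c / t) * (c * inverse t ^ 2)) + - (real k * inverse t ^ (k + 1)) * exp (- c / t)) (at t)"
        by (rule DERIV_mult'[OF DERIV_inverse_power[OF 1]])
           (use 1 in \<open>auto intro!: derivative_eq_intros simp: field_simps power2_eq_square\<close>)
      then show ?thesis
        using 1 by (simp add: flat_exp_def algebra_simps power2_eq_square)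
    qed
    then show ?thesis
      by (rule has_field_derivative_transform_within_open[where S = "{0<..}"])
        (use 1 in \<open>auto simp: flat_exp_def\<close>)
  next
    case 2
    have "((\<lambda>t. 0) has_real_derivative
      (c * flat_exp c (k + 2) t - k * flat_exp c (k + 1) t)) (at t)"
      using 2 by (simp add: flat_exp_def)
    then show ?thesis
      by (rule has_field_derivative_transform_within_open[where S = "{..<0}"])
        (use 2 in \<open>auto simp: flat_exp_def\<close>)
  next
    case 3
    have "((\<lambda>h. flat_exp c k h / h) \<longlongrightarrow> 0) (at 0)"
    proof (rule filterlim_split_at)
      show "((\<lambda>h. flat_exp c k h / h) \<longlongrightarrow> 0) (at_left 0)"
        by (rule tendsto_eventually) (auto simp: eventually_at_filter flat_exp_def)
      have "\<forall>\<^sub>F h in at_right 0. inverse h ^ Suc k * exp (- c / h) = flat_exp c k h / h"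
        by (auto simp: eventually_at_filter flat_exp_def divide_inverse)
      then show "((\<lambda>h. flat_exp c k h / h) \<longlongrightarrow> 0) (at_right 0)"
        using flat_exp_0_tendsto[OF assms, of "Suc k"] by (rule Lim_transform_eventually[rotated])
    qed
    then show ?thesis
      using 3 by (simp add: has_field_derivative_iff flat_exp_def)
  qed
qed

lemma flat_exp_bounds: "c > 0 \<Longrightarrow> 0 \<le> flat_exp c 0 t \<and> flat_exp c 0 t \<le> 1"
  by (simp add: flat_exp_def)

lemma flat_exp_tendsto: "(\<lambda>n. flat_exp (1 / Suc n) 0 t) \<longlonglongrightarrow> (if t > 0 then 1 else 0)"
proof (cases "t > 0")
  case True
  have "(\<lambda>n. exp (- (1 / real (Suc n)) / t)) \<longlonglongrightarrow> exp (- 0 / t)"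
    using LIMSEQ_Suc[OF lim_1_over_n] by (intro tendsto_intros) (use True in auto)
  then show ?thesis using True by (simp add: flat_exp_def)
qed (simp add: flat_exp_def)

text \<open>Every function in this class is differentiable with partial derivatives again in the class, which
  makes all of its members infinitely differentiable. Linear functions are included so that the class
  contains all polynomials.\<close>

inductive smooth :: "(real^3 \<Rightarrow> real) \<Rightarrow> bool" where
  smooth_linear: "bounded_linear f \<Longrightarrow> smooth f"
| smooth_const: "smooth (\<lambda>x. c)"
| smooth_add: "smooth f \<Longrightarrow> smooth g \<Longrightarrow> smooth (\<lambda>x. f x + g x)"
| smooth_mult: "smooth f \<Longrightarrow> smooth g \<Longrightarrow> smooth (\<lambda>x. f x * g x)"
| smooth_flat_exp: "c > 0 \<Longrightarrow> smooth (\<lambda>x. flat_exp c k (s * x $ i + a))"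

lemma smooth_has_derivative:
  assumes "smooth f"
  shows "\<exists>f'. (\<forall>x. (f has_derivative f' x) (at x)) \<and> (\<forall>j. smooth (\<lambda>x. f' x (axis j 1)))"
  using assms
proof induction
  case (smooth_linear f)
  then show ?case
    by (intro exI[of _ "\<lambda>x. f"]) (auto intro: bounded_linear_imp_has_derivative smooth.intros)
next
  case (smooth_const c)
  show ?case
    by (intro exI[of _ "\<lambda>x y. 0"]) (auto intro: smooth.intros)
next
  case (smooth_add f g)
  then obtain f' g' where
    "\<And>x. (f has_derivative f' x) (at x)" "\<And>j. smooth (\<lambda>x. f' x (axis j 1))"
    "\<And>x. (g has_derivative g' x) (at x)" "\<And>j. smooth (\<lambda>x. g' x (axis j 1))"
    by blast
  then show ?case
    by (intro exI[of _ "\<lambda>x y. f' x y + g' x y"]) (auto intro: has_derivative_add smooth.intros)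
next
  case (smooth_mult f g)
  then obtain f' g' where
    "\<And>x. (f has_derivative f' x) (at x)" "\<And>j. smooth (\<lambda>x. f' x (axis j 1))"
    "\<And>x. (g has_derivative g' x) (at x)" "\<And>j. smooth (\<lambda>x. g' x (axis j 1))"
    by blast
  then show ?case using smooth_mult.hyps
    by (intro exI[of _ "\<lambda>x y. f x * g' x y + f' x y * g x"])
       (auto intro!: has_derivative_mult smooth.smooth_add smooth.smooth_mult)
next
  case (smooth_flat_exp c k s i a)
  let ?d = "\<lambda>t. c * flat_exp c (k + 2) t - k * flat_exp c (k + 1) t"
  show ?case
  proof (intro exI[of _ "\<lambda>x y. s * y $ i * ?d (s * x $ i + a)"] conjI allI)
    fix x :: "real^3"
    have "((\<lambda>x. s * x $ i + a) has_derivative (\<lambda>y. s * y $ i)) (at x)"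
      by (auto intro!: derivative_eq_intros bounded_linear_imp_has_derivative bounded_linear_vec_nth)
    from has_derivative_compose[OF this flat_exp_deriv[OF smooth_flat_exp, of k, unfolded has_field_derivative_def]]
    show "((\<lambda>x. flat_exp c k (s * x $ i + a)) has_derivative (\<lambda>y. s * y $ i * ?d (s * x $ i + a))) (at x)"
      by (simp add: mult.commute)
  next
    fix j :: 3
    let ?z = "s * (axis j 1 :: real^3) $ i"
    have "smooth (\<lambda>x. ?z * (c * flat_exp c (k + 2) (s * x $ i + a) + (- k) * flat_exp c (k + 1) (s * x $ i + a)))"
      by (intro smooth.intros smooth_flat_exp)
    then show "smooth (\<lambda>x. ?z * (c * flat_exp c (k + 2) (s * x $ i + a) - k * flat_exp c (k + 1) (s * x $ i + a)))"
      by simp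
  qed
qed

lemma smooth_differentiable:
  assumes "smooth f"
  shows "f differentiable (at x)"
  using smooth_has_derivative[OF assms] by (auto simp: differentiable_def)

lemma smooth_partial: assumes "smooth f" shows "smooth (partial j f)"
proof -
  obtain f' where f': "\<And>x. (f has_derivative f' x) (at x)" "\<And>j. smooth (\<lambda>x. f' x (axis j 1))"
    using smooth_has_derivative[OF assms] by blast
  then have "frechet_derivative f (at x) = f' x" for x
    by (metis frechet_derivative_at)
  then have "partial j f = (\<lambda>x. f' x (axis j 1))"
    by (simp add: partial_def fun_eq_iff)
  then show ?thesis using f' by simp
qed

lemma smooth_continuous: "smooth f \<Longrightarrow> continuous_on UNIV f"
  by (meson differentiable_imp_continuous_on differentiable_at_imp_differentiable_on smooth_differentiable)

lemma smooth_measurable [measurable_dest]: "smooth f \<Longrightarrow> f \<in> borel_measurable borel"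
  by (simp add: smooth_continuous borel_measurable_continuous_onI)

lemma smooth_C_diff: "smooth f \<Longrightarrow> C_diff k f"
proof (induction k arbitrary: f)
  case (Suc k)
  then show ?case
    by (auto simp: smooth_partial intro: differentiable_at_imp_differentiable_on smooth_differentiable)
qed (simp add: smooth_continuous)

lemma smooth_shift: "smooth f \<Longrightarrow> smooth (\<lambda>x. f (x + h))"
proof (induction rule: smooth.induct)
  case (smooth_linear f)
  then have "smooth (\<lambda>x. f x + f h)" by (intro smooth.intros)
  then show ?case using smooth_linear by (simp add: linear_simps)
next
  case (smooth_flat_exp c k s i a)
  then have "smooth (\<lambda>x. flat_exp c k (s * x $ i + (s * h $ i + a)))" by (rule smooth.intros)
  then show ?case by (simp add: algebra_simps)
qed (auto intro: smooth.intros)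

lemma smooth_real_polynomial: "real_polynomial_function p \<Longrightarrow> smooth p"
  by (induction rule: real_polynomial_function.induct) (auto intro: smooth.intros)

text \<open>For small \<open>c\<close> this approximates the indicator of the open cube \<open>obox R\<close> from below, pointwise and
  without error outside of it.\<close>

definition bump :: "real \<Rightarrow> real \<Rightarrow> real^3 \<Rightarrow> real" where
  "bump R c x = (\<Prod>i\<in>UNIV. flat_exp c 0 (R - x $ i) * flat_exp c 0 (R + x $ i))"

definition obox :: "real \<Rightarrow> (real^3) set" where
  "obox R = {x. \<forall>i. \<bar>x $ i\<bar> < R}"

lemma smooth_bump: assumes "c > 0" shows "smooth (bump R c)"
proof -
  have "smooth (\<lambda>x. flat_exp c 0 (R - x $ i))" "smooth (\<lambda>x. flat_exp c 0 (R + x $ i))" for i :: 3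
    using smooth_flat_exp[OF assms, of 0 "-1" i R] smooth_flat_exp[OF assms, of 0 1 i R]
    by (simp_all add: add.commute)
  then show ?thesis
    unfolding bump_def[abs_def] UNIV_3 by (auto intro!: smooth_mult)
qed

lemma bump_bounds: assumes "c > 0" shows "0 \<le> bump R c x" "bump R c x \<le> 1"
  unfolding bump_def using flat_exp_bounds[OF assms]
  by (auto intro!: prod_nonneg prod_le_1 mult_le_one)

lemma bump_outside: "x \<notin> obox R \<Longrightarrow> bump R c x = 0"
proof -
  assume "x \<notin> obox R"
  then obtain i where "R \<le> \<bar>x $ i\<bar>" by (auto simp: obox_def not_less)
  then have "flat_exp c 0 (R - x $ i) * flat_exp c 0 (R + x $ i) = 0"
    by (auto simp: flat_exp_def)
  then show ?thesis unfolding bump_def by (intro prod_zero) auto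
qed

lemma bump_tendsto: "(\<lambda>n. bump R (1 / Suc n) x) \<longlonglongrightarrow> indicator (obox R) x"
proof -
  have "(\<lambda>n. bump R (1 / Suc n) x) \<longlonglongrightarrow> 
     (\<Prod>i\<in>UNIV. (if R - x $ i > 0 then 1 else 0) * (if R + x $ i > 0 then 1 else 0))"
    unfolding bump_def by (intro tendsto_intros flat_exp_tendsto)
  also have "(\<Prod>i\<in>UNIV. (if R - x $ i > 0 then 1 else 0) * (if R + x $ i > 0 then 1 else 0)) = (indicator (obox R) x :: real)"
  proof (cases "x \<in> obox R")
    case True
    then have "R - x $ i > 0 \<and> R + x $ i > 0" for i
      unfolding obox_def using abs_less_iff[of "x $ i" R] by (auto dest!: spec[of _ i])
    then show ?thesis using True by simp
  next
    case False
    then obtain i where "R \<le> \<bar>x $ i\<bar>" by (auto simp: obox_def not_less)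
    then have "R - x $ i \<le> 0 \<or> R + x $ i \<le> 0" by linarith
    then have "\<exists>i\<in>UNIV. (if R - x $ i > 0 then 1 else 0) * (if R + x $ i > 0 then 1 else 0) = (0::real)"
      by (intro bexI[of _ i]) auto
    from prod_zero[OF finite this] show ?thesis using False by simp
  qed
  finally show ?thesis .
qed

lemma obox_eq: "obox R = box (\<chi> i. - R) (\<chi> i. R)"
proof -
  have "\<bar>t\<bar> < R \<longleftrightarrow> - R < t \<and> t < R" for t :: real by linarith
  then show ?thesis by (simp add: obox_def set_eq_iff mem_box_cart)
qed

lemma bounded_obox: "bounded (obox R)"
  unfolding obox_eq by simp

lemma obox_measurable [measurable]: "obox R \<in> sets borel"
  unfolding obox_eq by simp

section \<open>Density of test fields\<close>

definition bump_function :: "(real^3 \<Rightarrow> real) \<Rightarrow> bool" where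
  "bump_function f \<longleftrightarrow> smooth f \<and> bounded {x. f x \<noteq> 0}"

lemma bump_function_test: "bump_function f \<Longrightarrow> test_function f"
  by (simp add: bump_function_def test_function_def smooth_C_diff)

lemma bump_function_shift: assumes "bump_function f" shows "bump_function (\<lambda>x. f (x + h))"
proof -
  have "{x. f (x + h) \<noteq> 0} = (\<lambda>x. x - h) ` {x. f x \<noteq> 0}"
    by (force simp: image_iff algebra_simps)
  then show ?thesis
    using assms bounded_translation_minus[of "{x. f x \<noteq> 0}" h]
    by (auto simp: bump_function_def smooth_shift)
qed

lemma sq_int_indicator: "sq_int (\<lambda>x. indicator (cball (0::real^3) R) x *\<^sub>R v)"
proof -
  have "(\<lambda>x. (norm (indicator (cball (0::real^3) R) x *\<^sub>R v))\<^sup>2) = (\<lambda>x. indicator (cball 0 R) x * norm v ^ 2)"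
    by (auto simp: indicator_def)
  moreover have "(\<lambda>x. indicator (cball (0::real^3) R) x *\<^sub>R v) \<in> borel_measurable lborel"
    by (intro borel_measurable_scaleR borel_measurable_indicator) auto
  moreover have "emeasure lborel (cball (0::real^3) R) < \<infinity>"
    by (rule emeasure_bounded_finite[OF bounded_cball])
  then have "integrable lborel (\<lambda>x. indicator (cball (0::real^3) R) x * norm v ^ 2)"
    by (intro integrable_mult_left integrable_real_indicator)
       (simp_all del: infinity_ennreal_def)
  ultimately show ?thesis by (simp only: sq_int_def)
qed

lemma sq_int_bdd_support:
  assumes "f \<in> borel_measurable lborel" "AE x in lborel. norm (f x) \<le> C * indicator (cball (0::real^3) R) x"
  shows "sq_int f"
proof (rule sq_int_bounded[OF sq_int_indicator[of R 1]])
  show "AE x in lborel. norm (f x) \<le> (C / norm (1::complex^4)) * norm (indicat_real (cball 0 R) x *\<^sub>R (1::complex^4))"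
    using assms(2) by simp
qed fact

text \<open>Weak derivatives are tested with arbitrary test functions, and the only properties of them and of
  their partial derivatives that matter for integrability are these two.\<close>

definition cont_bdd :: "(real^3 \<Rightarrow> real) \<Rightarrow> bool" where
  "cont_bdd f \<longleftrightarrow> continuous_on UNIV f \<and> bounded {x. f x \<noteq> 0}"

lemma cont_bdd_measurable: "cont_bdd f \<Longrightarrow> f \<in> borel_measurable borel"
  by (simp add: cont_bdd_def borel_measurable_continuous_onI)

lemma cont_bdd_bounded:
  assumes "cont_bdd f"
  obtains C R where "C > 0" "R > 0" "\<And>x. \<bar>f x\<bar> \<le> C * indicator (cball 0 R) x"
proof -
  obtain R where R: "R > 0" "\<And>x. f x \<noteq> 0 \<Longrightarrow> norm x \<le> R"
    using assms unfolding cont_bdd_def bounded_pos by auto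
  have "compact (f ` cball 0 R)"
    using assms by (intro compact_continuous_image)
      (auto simp: cont_bdd_def intro: continuous_on_subset)
  then have "bounded (f ` cball 0 R)"
    by (rule compact_imp_bounded)
  then obtain C where C: "C > 0" "\<And>x. x \<in> cball 0 R \<Longrightarrow> \<bar>f x\<bar> \<le> C"
    unfolding bounded_pos by (fastforce simp del: mem_cball)
  show ?thesis
  proof (rule that[OF C(1) R(1)])
    show "\<bar>f x\<bar> \<le> C * indicator (cball 0 R) x" for x
      using C R(2)[of x] by (cases "f x = 0") (auto simp: indicator_def)
  qed
qed

lemma cont_bdd_sq_int:
  assumes "cont_bdd f" shows "sq_int (\<lambda>x. f x *\<^sub>R e)"
proof -
  obtain C R where *: "\<And>x. \<bar>f x\<bar> \<le> C * indicator (cball 0 R) x"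
    using cont_bdd_bounded[OF assms] by metis
  show ?thesis
  proof (rule sq_int_bdd_support[where C = "C * norm e" and R = R])
    have "norm (f x *\<^sub>R e) \<le> C * norm e * indicator (cball 0 R) x" for x
      using mult_right_mono[OF *[of x], of "norm e"] by (simp add: mult_ac)
    then show "AE x in lborel. norm (f x *\<^sub>R e) \<le> C * norm e * indicator (cball 0 R) x"
      by simp
  qed (use cont_bdd_measurable[OF assms] in simp)
qed

lemma bump_function_cont_bdd: "bump_function f \<Longrightarrow> cont_bdd f"
  by (simp add: bump_function_def cont_bdd_def smooth_continuous)

definition test_fields :: "l2 set" where
  "test_fields = span {l2_of (\<lambda>x. f x *\<^sub>R e) | f e. bump_function f}"

text \<open>Dominated convergence in the norm of \<open>L\<^sup>2\<close>: the squared norm of the difference is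
  dominated by \<open>4 C\<^sup>2 \<bar>h\<bar>\<^sup>2\<close>.\<close>

lemma l2_dominated_convergence:
  assumes "\<And>n::nat. f n \<in> borel_measurable lborel" "g \<in> borel_measurable lborel" "sq_int h"
    and "\<And>n. AE x in lborel. norm (f n x) \<le> C * norm (h x)"
    and "AE x in lborel. (\<lambda>n. f n x) \<longlonglongrightarrow> g x"
  shows "\<And>n. sq_int (f n)" "sq_int g" "(\<lambda>n. l2_of (f n)) \<longlonglongrightarrow> l2_of g"
proof -
  show sf: "sq_int (f n)" for n
    by (rule sq_int_bounded[OF assms(3,1,4)])
  have *: "AE x in lborel. \<forall>n. norm (f n x) \<le> C * norm (h x)"
    using assms(4) by (simp add: AE_all_countable)
  have gb: "AE x in lborel. norm (g x) \<le> C * norm (h x)"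
    using * assms(5)
  proof eventually_elim
    case (elim x)
    show ?case
      by (rule Lim_bounded[OF tendsto_norm[OF elim(2)], of 0]) (use elim in auto)
  qed
  then show sg: "sq_int g"
    by (rule sq_int_bounded[OF assms(3,2)])
  have eq: "(norm (l2_of (f n) - l2_of g))\<^sup>2 = (LINT x|lborel. (norm (f n x - g x))\<^sup>2)" for n
  proof -
    have "AE x in lborel. fun_of (l2_of (f n) - l2_of g) x = f n x - g x"
      using fun_of_l2_of[OF sf[of n]] fun_of_l2_of[OF sg] fun_of_minus[of "l2_of (f n)" "l2_of g"] by eventually_elim simp
    then show ?thesis
      unfolding norm_l2_fun_of
      by (intro integral_cong_AE) (use assms in auto)
  qed
  have "(\<lambda>n. LINT x|lborel. (norm (f n x - g x))\<^sup>2) \<longlonglongrightarrow> (LINT x|(lborel :: (real^3) measure). (0::real))"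
  proof (rule integral_dominated_convergence[where w = "\<lambda>x. 4 * C^2 * (norm (h x))^2"])
    show "integrable lborel (\<lambda>x. 4 * C^2 * (norm (h x))^2)"
      using assms(3) by (auto simp: sq_int_def)
    show "AE x in lborel. (\<lambda>n. (norm (f n x - g x))\<^sup>2) \<longlonglongrightarrow> 0"
      using assms(5)
    proof eventually_elim
      case (elim x)
      have "(\<lambda>n. (norm (f n x - g x))\<^sup>2) \<longlonglongrightarrow> (norm (g x - g x))\<^sup>2"
        by (intro tendsto_intros elim)
      then show ?case by simp
    qed
    show "AE x in lborel. norm ((norm (f n x - g x))\<^sup>2) \<le> 4 * C^2 * (norm (h x))^2" for n
      using * gb
    proof eventually_elim
      case (elim x)
      have "norm (f n x - g x) \<le> norm (f n x) + norm (g x)" by (rule norm_triangle_ineq4)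
      also have "\<dots> \<le> 2 * C * norm (h x)" using elim(1)[rule_format, of n] elim(2) by simp
      finally have "(norm (f n x - g x))^2 \<le> (2 * C * norm (h x))^2" by (rule power_mono) simp
      then show ?case by (simp add: power_mult_distrib)
    qed
  qed (use assms in auto)
  then have "(\<lambda>n. (norm (l2_of (f n) - l2_of g))\<^sup>2) \<longlonglongrightarrow> 0"
    by (simp add: eq)
  then have "(\<lambda>n. sqrt ((norm (l2_of (f n) - l2_of g))\<^sup>2)) \<longlonglongrightarrow> sqrt 0"
    by (rule tendsto_real_sqrt)
  then have "(\<lambda>n. norm (l2_of (f n) - l2_of g)) \<longlonglongrightarrow> 0"
    by simp
  then show "(\<lambda>n. l2_of (f n)) \<longlonglongrightarrow> l2_of g"
    by (subst Lim_null) (rule tendsto_norm_zero_cancel)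
qed

lemma test_fields_subspace: "subspace test_fields"
  unfolding test_fields_def by (rule subspace_span)

lemma test_fields_I: "bump_function f \<Longrightarrow> l2_of (\<lambda>x. f x *\<^sub>R e) \<in> test_fields"
  unfolding test_fields_def by (rule span_base) auto

lemma sq_int_0: "sq_int (\<lambda>x. 0)"
  by (simp add: sq_int_def)

lemma l2_of_0: "l2_of (\<lambda>x. 0) = 0"
  using fun_of_l2_of[OF sq_int_0] fun_of_zero by (intro l2_eqI) (auto elim!: AE_mp)

lemma sq_int_plus: 
  assumes "sq_int f" "sq_int g" shows "sq_int (\<lambda>x. f x + g x)"
proof (rule sq_int_bounded[where C = 1])
  show "sq_int (fun_of (l2_of f + l2_of g))" by simp
  show "AE x in lborel. norm (f x + g x) \<le> 1 * norm (fun_of (l2_of f + l2_of g) x)"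
    using fun_of_l2_of[OF assms(1)] fun_of_l2_of[OF assms(2)] fun_of_plus[of "l2_of f" "l2_of g"] by eventually_elim simp
  show "(\<lambda>x. f x + g x) \<in> borel_measurable lborel"
    using assms by (auto simp: sq_int_def)
qed

lemma l2_of_plus:
  assumes "sq_int f" "sq_int g" shows "l2_of (\<lambda>x. f x + g x) = l2_of f + l2_of g"
proof (rule l2_eqI)
  show "AE x in lborel. fun_of (l2_of (\<lambda>x. f x + g x)) x = fun_of (l2_of f + l2_of g) x"
    using fun_of_l2_of[OF assms(1)] fun_of_l2_of[OF assms(2)] fun_of_plus[of "l2_of f" "l2_of g"] fun_of_l2_of[OF sq_int_plus[OF assms]]
    by eventually_elim simp
qed

lemma sq_int_sum: "finite I \<Longrightarrow> (\<And>i. i \<in> I \<Longrightarrow> sq_int (f i)) \<Longrightarrow> sq_int (\<lambda>x. \<Sum>i\<in>I. f i x)"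
  by (induction I rule: finite_induct) (auto simp: sq_int_0 sq_int_plus)

lemma l2_of_sum: "finite I \<Longrightarrow> (\<And>i. i \<in> I \<Longrightarrow> sq_int (f i)) \<Longrightarrow> l2_of (\<lambda>x. \<Sum>i\<in>I. f i x) = (\<Sum>i\<in>I. l2_of (f i))"
  by (induction I rule: finite_induct) (auto simp: l2_of_0 l2_of_plus sq_int_sum)

lemma bump_function_bump_times:
  assumes "c > 0" "smooth p" shows "bump_function (\<lambda>x. bump R c x * p x)"
  unfolding bump_function_def
proof
  show "bounded {x. bump R c x * p x \<noteq> 0}"
    by (rule bounded_subset[OF bounded_obox[of R]]) (use bump_outside in force)
qed (intro smooth_mult smooth_bump assms)

lemma bump_polynomial_test_field:
  fixes p :: "real^3 \<Rightarrow> complex^4"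
  assumes "c > 0" "polynomial_function p"
  shows "l2_of (\<lambda>x. bump R c x *\<^sub>R p x) \<in> test_fields"
proof -
  have bf: "bump_function (\<lambda>x. bump R c x * inner (p x) e)" for e
  proof (rule bump_function_bump_times[OF assms(1)])
    have "real_polynomial_function ((\<lambda>y. inner y e) \<circ> p)"
      using assms(2) bounded_linear_inner_left unfolding polynomial_function_def by blast
    then show "smooth (\<lambda>x. inner (p x) e)"
      by (auto dest!: smooth_real_polynomial simp: o_def)
  qed
  have eq: "bump R c x *\<^sub>R p x = (\<Sum>e\<in>Basis. (bump R c x * inner (p x) e) *\<^sub>R e)" for x
    by (simp add: scaleR_sum_right[symmetric] scaleR_scaleR[symmetric] euclidean_representation del: scaleR_scaleR)
  show ?thesis
    unfolding eq using bf
    by (subst l2_of_sum) (auto intro!: subspace_sum test_fields_subspace test_fields_I cont_bdd_sq_int bump_function_cont_bdd)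
qed

lemma closure_limit: 
  fixes X :: "nat \<Rightarrow> 'a::metric_space"
  shows "(\<And>n. X n \<in> closure S) \<Longrightarrow> X \<longlonglongrightarrow> l \<Longrightarrow> l \<in> closure S"
  by (rule closed_sequentially[OF closed_closure])

lemma obox_cball: "obox R \<subseteq> cball 0 (norm (\<chi> i::3. R))"
proof
  fix x assume "x \<in> obox R"
  then have "norm x \<le> norm (\<chi> i::3. R)"
    by (intro norm_le_componentwise_cart) (auto simp: obox_def intro: less_imp_le order_trans[OF _ abs_ge_self])
  then show "x \<in> cball 0 (norm (\<chi> i::3. R))" by simp
qed

text \<open>The three approximation steps below (polynomials by bumps times polynomials, continuous functions
  by polynomials, bounded functions by continuous ones) all pass to a bounded almost everywhere limit on
  a cube, on which constants are square integrable.\<close>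

lemma box_closure_limit:
  fixes f :: "nat \<Rightarrow> real^3 \<Rightarrow> complex^4"
  assumes [measurable]: "\<And>n. f n \<in> borel_measurable borel" "g \<in> borel_measurable borel"
    and bound: "\<And>n x. x \<in> obox R \<Longrightarrow> norm (f n x) \<le> C"
    and lim: "AE x in lborel. x \<in> obox R \<longrightarrow> (\<lambda>n. f n x) \<longlonglongrightarrow> g x"
    and mem: "\<And>n. l2_of (\<lambda>x. indicator (obox R) x *\<^sub>R f n x) \<in> closure S"
  shows "l2_of (\<lambda>x. indicator (obox R) x *\<^sub>R g x) \<in> closure S"
proof (rule closure_limit[OF mem])
  let ?S = "cball (0::real^3) (norm (\<chi> i::3. R))"
  let ?h = "\<lambda>x::real^3. indicator ?S x *\<^sub>R (1 :: complex^4)"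
  show "(\<lambda>n. l2_of (\<lambda>x. indicator (obox R) x *\<^sub>R f n x)) \<longlonglongrightarrow> l2_of (\<lambda>x. indicator (obox R) x *\<^sub>R g x)"
  proof (rule l2_dominated_convergence(3)[where h = ?h and C = "\<bar>C\<bar> / norm (1::complex^4)"])
    show "sq_int ?h" by (rule sq_int_indicator)
    show "AE x in lborel. norm (indicat_real (obox R) x *\<^sub>R f n x) \<le> \<bar>C\<bar> / norm (1::complex^4) * norm (?h x)" for n
    proof (rule AE_I2)
      fix x
      show "norm (indicat_real (obox R) x *\<^sub>R f n x) \<le> \<bar>C\<bar> / norm (1::complex^4) * norm (?h x)"
      proof (cases "x \<in> obox R")
        case True
        then have "x \<in> ?S" using obox_cball by blast
        then show ?thesis using bound[OF True, of n] True by simp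
      qed simp
    qed
    show "AE x in lborel. (\<lambda>n. indicat_real (obox R) x *\<^sub>R f n x) \<longlonglongrightarrow> indicat_real (obox R) x *\<^sub>R g x"
      using lim
    proof eventually_elim
      case (elim x)
      then show ?case by (cases "x \<in> obox R") simp_all
    qed
  qed measurable
qed

lemma continuous_bounded_on_box:
  fixes g :: "real^3 \<Rightarrow> complex^4"
  assumes "continuous_on UNIV g"
  obtains C where "\<And>x. x \<in> cball 0 R \<Longrightarrow> norm (g x) \<le> C"
proof -
  have "compact (g ` cball 0 R)"
    using assms by (intro compact_continuous_image) (auto intro: continuous_on_subset)
  then have "bounded (g ` cball 0 R)" by (rule compact_imp_bounded)
  then show ?thesis using that unfolding bounded_pos by blast
qed

text \<open>A polynomial cut off sharply at the boundary of the cube is the limit of its products with the smooth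
  bumps.\<close>

lemma polynomial_on_box_closure:
  fixes p :: "real^3 \<Rightarrow> complex^4"
  assumes "polynomial_function p"
  shows "l2_of (\<lambda>x. indicator (obox R) x *\<^sub>R p x) \<in> closure test_fields"
proof -
  have pc: "continuous_on UNIV p" using assms by (rule continuous_on_polymonial_function)
  then have [measurable]: "p \<in> borel_measurable borel" by (rule borel_measurable_continuous_onI)
  have b[measurable]: "bump R (1 / real (Suc n)) \<in> borel_measurable borel" for n
    by (intro smooth_measurable smooth_bump) simp
  obtain C where C: "\<And>x. x \<in> cball 0 (norm (\<chi> i::3. R)) \<Longrightarrow> norm (p x) \<le> C"
    using continuous_bounded_on_box[OF pc] by metis
  show ?thesis
  proof (rule box_closure_limit)
    show "(\<lambda>x. bump R (1 / real (Suc n)) x *\<^sub>R p x) \<in> borel_measurable borel" for n by measurable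
    show "norm (bump R (1 / real (Suc n)) x *\<^sub>R p x) \<le> C" if "x \<in> obox R" for n x
    proof -
      have x: "norm (p x) \<le> C" using C that obox_cball by blast
      have "\<bar>bump R (1 / real (Suc n)) x\<bar> * norm (p x) \<le> 1 * C"
        using bump_bounds[of "1 / real (Suc n)" R x] x by (intro mult_mono) auto
      then show ?thesis by simp
    qed
    show "AE x in lborel. x \<in> obox R \<longrightarrow> (\<lambda>n. bump R (1 / real (Suc n)) x *\<^sub>R p x) \<longlonglongrightarrow> p x"
    proof (rule AE_I2, rule impI)
      fix x assume "x \<in> obox R"
      then show "(\<lambda>n. bump R (1 / real (Suc n)) x *\<^sub>R p x) \<longlonglongrightarrow> p x"
        using tendsto_scaleR[OF bump_tendsto[of R x] tendsto_const[of "p x"]] by simp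
    qed
    fix n
    have "(\<lambda>x. indicat_real (obox R) x *\<^sub>R bump R (1 / real (Suc n)) x *\<^sub>R p x) = (\<lambda>x. bump R (1 / real (Suc n)) x *\<^sub>R p x)"
    proof (rule ext)
      fix x
      show "indicat_real (obox R) x *\<^sub>R bump R (1 / real (Suc n)) x *\<^sub>R p x = bump R (1 / real (Suc n)) x *\<^sub>R p x"
        by (cases "x \<in> obox R") (simp_all add: bump_outside)
    qed
    then show "l2_of (\<lambda>x. indicat_real (obox R) x *\<^sub>R bump R (1 / real (Suc n)) x *\<^sub>R p x) \<in> closure test_fields"
      by (simp only:) (rule subsetD[OF closure_subset bump_polynomial_test_field[OF _ assms]], simp)
  qed measurable
qed

lemma continuous_on_box_closure:
  fixes g :: "real^3 \<Rightarrow> complex^4"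
  assumes "continuous_on UNIV g"
  shows "l2_of (\<lambda>x. indicator (obox R) x *\<^sub>R g x) \<in> closure test_fields"
proof -
  let ?S = "cball (0::real^3) (norm (\<chi> i::3. R))"
  have [measurable]: "g \<in> borel_measurable borel" using assms by (rule borel_measurable_continuous_onI)
  have "\<exists>p. polynomial_function p \<and> (\<forall>x\<in>?S. norm (g x - p x) < 1 / Suc n)" for n
    using assms by (intro Stone_Weierstrass_polynomial_function) (auto intro: continuous_on_subset)
  then obtain p where p: "\<And>n. polynomial_function (p n)" "\<And>n x. x \<in> ?S \<Longrightarrow> norm (g x - p n x) < 1 / Suc n"
    by metis
  have [measurable]: "p n \<in> borel_measurable borel" for n
    using p(1) by (intro borel_measurable_continuous_onI continuous_on_polymonial_function)
  obtain C where C: "\<And>x. x \<in> ?S \<Longrightarrow> norm (g x) \<le> C"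
    using continuous_bounded_on_box[OF assms] by metis
  show ?thesis
  proof (rule box_closure_limit)
    show "norm (p n x) \<le> C + 1" if "x \<in> obox R" for n x
    proof -
      have x: "x \<in> ?S" using that obox_cball by blast
      have "norm (p n x) \<le> norm (g x) + norm (g x - p n x)"
        by (metis add.commute norm_minus_commute norm_triangle_sub)
      also have "\<dots> \<le> C + 1"
        using C[OF x] p(2)[OF x, of n] by (intro add_mono) (auto intro: order_trans[OF less_imp_le])
      finally show ?thesis .
    qed
    show "AE x in lborel. x \<in> obox R \<longrightarrow> (\<lambda>n. p n x) \<longlonglongrightarrow> g x"
    proof (rule AE_I2, rule impI)
      fix x assume "x \<in> obox R"
      then have x: "x \<in> ?S" using obox_cball by blast
      have "(\<lambda>n. g x - p n x) \<longlonglongrightarrow> 0"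
        by (rule Lim_null_comparison[OF _ LIMSEQ_Suc[OF lim_1_over_n]])
          (use p(2)[OF x] in \<open>auto intro!: always_eventually less_imp_le\<close>)
      from tendsto_diff[OF tendsto_const[of "g x"] this] show "(\<lambda>n. p n x) \<longlonglongrightarrow> g x" by simp
    qed
    show "l2_of (\<lambda>x. indicator (obox R) x *\<^sub>R p n x) \<in> closure test_fields" for n
      by (rule polynomial_on_box_closure[OF p(1)])
  qed measurable
qed

text \<open>A measurable function is an almost everywhere limit of continuous functions. Composing these with
  a radial truncation keeps them continuous and makes them uniformly bounded.\<close>

lemma bounded_on_box_closure:
  fixes v :: "real^3 \<Rightarrow> complex^4"
  assumes [measurable]: "v \<in> borel_measurable borel" and "K > 0" and "\<And>x. norm (v x) \<le> K"
  shows "l2_of (\<lambda>x. indicator (obox R) x *\<^sub>R v x) \<in> closure test_fields"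
proof -
  have "v \<in> borel_measurable lebesgue"
    using assms(1) by (intro measurable_completion) simp
  then have "v measurable_on UNIV"
    by (rule lebesgue_measurable_imp_measurable_on) simp
  then obtain N g where N: "negligible N" "\<And>n. continuous_on UNIV (g n)"
    "\<And>x. x \<notin> N \<Longrightarrow> (\<lambda>n. g n x) \<longlonglongrightarrow> v x"
    unfolding measurable_on_def by auto
  \<comment> \<open>the radial truncation to norm at most \<open>K\<close>\<close>
  define q where "q = (\<lambda>y::complex^4. (K / max K (norm y)) *\<^sub>R y)"
  have mx: "max K (norm y) \<noteq> 0" for y :: "complex^4"
    using assms(2) max.cobounded1[of K "norm y"] by linarith
  have "continuous_on UNIV (\<lambda>y::complex^4. max K (norm y))"
    by (intro continuous_on_max continuous_on_const continuous_on_norm_id)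
  then have qc: "continuous_on UNIV q"
    unfolding q_def
    by (intro continuous_on_scaleR continuous_on_divide continuous_on_const continuous_on_id ballI mx)
  have qb: "norm (q y) \<le> K" for y
    using assms(2) by (simp add: q_def pos_divide_le_eq max_def)
  have qv: "q (v x) = v x" for x
    using assms(2) assms(3)[of x] by (simp add: q_def max_def)
  have gm[measurable]: "(\<lambda>x. q (g n x)) \<in> borel_measurable borel" for n
    by (rule borel_measurable_continuous_onI[OF continuous_on_compose2[OF qc N(2)[of n]]]) simp
  show ?thesis
  proof (rule box_closure_limit)
    show "norm (q (g n x)) \<le> K" for n x by (rule qb)
    have "AE x in lborel. x \<notin> N"
      using AE_not_in[of N lebesgue] N(1) by (simp add: negligible_iff_null_sets AE_completion_iff)
    then show "AE x in lborel. x \<in> obox R \<longrightarrow> (\<lambda>n. q (g n x)) \<longlonglongrightarrow> v x"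
    proof eventually_elim
      case (elim x)
      have "isCont q (v x)" using qc by (rule continuous_on_interior) simp
      then have "(\<lambda>n. q (g n x)) \<longlonglongrightarrow> q (v x)"
        using N(3)[OF elim] by (rule isCont_tendsto_compose)
      then show ?case by (simp only: qv simp_thms)
    qed
    show "l2_of (\<lambda>x. indicator (obox R) x *\<^sub>R q (g n x)) \<in> closure test_fields" for n
      by (rule continuous_on_box_closure) (rule continuous_on_compose2[OF qc N(2)], simp)
  qed measurable
qed

text \<open>Every \<open>L\<^sup>2\<close> field is the limit of its truncations to cubes and to bounded values.\<close>

theorem test_fields_dense: "closure test_fields = UNIV"
proof -
  have "u \<in> closure test_fields" for u
  proof (rule closure_limit)
    let ?v = "\<lambda>n x. if norm (fun_of u x) \<le> Suc n then fun_of u x else 0"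
    have "(\<lambda>n. l2_of (\<lambda>x. indicator (obox (real n)) x *\<^sub>R ?v n x)) \<longlonglongrightarrow> l2_of (fun_of u)"
    proof (rule l2_dominated_convergence(3)[where h = "fun_of u" and C = 1])
      show "AE x in lborel. (\<lambda>n. indicat_real (obox (real n)) x *\<^sub>R ?v n x) \<longlonglongrightarrow> fun_of u x"
      proof (rule AE_I2)
        fix x
        have "\<forall>\<^sub>F n in sequentially. indicat_real (obox (real n)) x *\<^sub>R ?v n x = fun_of u x"
        proof (rule eventually_sequentiallyI)
          fix n assume n: "nat \<lceil>max (norm (fun_of u x)) (norm x) + 1\<rceil> \<le> n"
          then have "norm (fun_of u x) \<le> Suc n" "norm x < n"
            by linarith+
          moreover have "\<bar>x $ i\<bar> \<le> norm x" for i by (rule component_le_norm_cart)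
          ultimately show "indicat_real (obox (real n)) x *\<^sub>R ?v n x = fun_of u x"
            by (auto simp: obox_def indicator_def intro: le_less_trans)
        qed
        then show "(\<lambda>n. indicat_real (obox (real n)) x *\<^sub>R ?v n x) \<longlonglongrightarrow> fun_of u x"
          by (rule tendsto_eventually)
      qed
      show "AE x in lborel. norm (indicat_real (obox (real n)) x *\<^sub>R ?v n x) \<le> 1 * norm (fun_of u x)" for n
        by (intro AE_I2) (auto simp: indicator_def)
    qed (auto intro!: borel_measurable_scaleR borel_measurable_indicator measurable_If)
    then show "(\<lambda>n. l2_of (\<lambda>x. indicator (obox (real n)) x *\<^sub>R ?v n x)) \<longlonglongrightarrow> u" by simp
    show "l2_of (\<lambda>x. indicator (obox (real n)) x *\<^sub>R ?v n x) \<in> closure test_fields" for n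
      by (rule bounded_on_box_closure[where K = "Suc n"]) (auto intro!: measurable_If)
  qed
  then show ?thesis by blast
qed

section \<open>Weak derivatives and difference quotients\<close>

lemma partial_support: "{x. partial j f x \<noteq> 0} \<subseteq> closure {x. f x \<noteq> 0}"
proof (rule ccontr)
  assume "\<not> ?thesis"
  then obtain x where x: "partial j f x \<noteq> 0" "x \<in> - closure {x. f x \<noteq> 0}" by blast
  have "(f has_derivative (\<lambda>_. 0)) (at x)"
    by (rule has_derivative_transform_within_open[OF has_derivative_const _ x(2), of 0])
      (use closure_subset[of "{x. f x \<noteq> 0}"] in auto)
  then have "partial j f x = 0"
    by (simp add: partial_def frechet_derivative_at[symmetric])
  then show False using x by simp
qed

lemma test_function_cont_bdd:
  assumes "test_function f" shows "cont_bdd f" "cont_bdd (partial j f)"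
proof -
  have C: "C_diff 0 f" "C_diff (Suc 0) f" and b: "bounded (closure {x. f x \<noteq> 0})"
    using assms by (auto simp only: test_function_def intro: compact_imp_bounded)
  show "cont_bdd f"
    using C(1) b closure_subset[of "{x. f x \<noteq> 0}"] by (auto simp: cont_bdd_def intro: bounded_subset)
  show "cont_bdd (partial j f)"
    using C(2) bounded_subset[OF b partial_support[of j f]] by (auto simp: cont_bdd_def)
qed

lemma cont_bdd_integrable:
  assumes "cont_bdd f" shows "integrable lborel (\<lambda>x. f x *\<^sub>R fun_of u x)"
proof (rule Bochner_Integration.integrable_bound)
  have i: "integrable lborel (\<lambda>x. (norm (f x *\<^sub>R (1 :: complex^4)))\<^sup>2)"
    by (rule sq_int_D[OF cont_bdd_sq_int[OF assms]])
  show "integrable lborel (\<lambda>x. norm (f x *\<^sub>R (1::complex^4)) ^ 2 / norm (1::complex^4) ^ 2 + norm (fun_of u x) ^ 2)"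
    by (rule Bochner_Integration.integrable_add[OF integrable_divide[OF i] sq_int_D[OF fun_of_sq_int]])
  show "AE x in lborel. norm (f x *\<^sub>R fun_of u x) \<le> norm (norm (f x *\<^sub>R (1::complex^4)) ^ 2 / norm (1::complex^4) ^ 2 + norm (fun_of u x) ^ 2)"
  proof (rule AE_I2)
    fix x
    have "norm (f x *\<^sub>R fun_of u x) \<le> \<bar>f x\<bar> ^ 2 + norm (fun_of u x) ^ 2"
      using sum_squares_bound[of "\<bar>f x\<bar>" "norm (fun_of u x)"]
        mult_nonneg_nonneg[OF abs_ge_zero[of "f x"] norm_ge_zero[of "fun_of u x"]] 
      unfolding norm_scaleR by linarith
    then show "norm (f x *\<^sub>R fun_of u x) \<le> norm (norm (f x *\<^sub>R (1::complex^4)) ^ 2 / norm (1::complex^4) ^ 2 + norm (fun_of u x) ^ 2)"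
      by (simp add: power_mult_distrib)
  qed
  show "(\<lambda>x. f x *\<^sub>R fun_of u x) \<in> borel_measurable lborel"
    using cont_bdd_measurable[OF assms] by simp
qed

text \<open>Pairing with \<open>f e\<close> in \<open>L\<^sup>2\<close> reads off the \<open>e\<close>-component of the vector valued integral. This turns the
  definition of weak derivatives into a statement about inner products.\<close>

lemma inner_cont_bdd:
  assumes "cont_bdd f" shows "inner u (l2_of (\<lambda>x. f x *\<^sub>R e)) = inner (LINT x|lborel. f x *\<^sub>R fun_of u x) e"
proof -
  have "inner u (l2_of (\<lambda>x. f x *\<^sub>R e)) = (LINT x|lborel. inner (fun_of u x) (f x *\<^sub>R e))"
    by (rule inner_l2_of_right[OF cont_bdd_sq_int[OF assms]])
  also have "\<dots> = (LINT x|lborel. inner (f x *\<^sub>R fun_of u x) e)"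
    by simp
  also have "\<dots> = inner (LINT x|lborel. f x *\<^sub>R fun_of u x) e"
    by (rule integral_inner_left) (simp add: cont_bdd_integrable[OF assms])
  finally show ?thesis .
qed

definition weak_deriv :: "3 \<Rightarrow> l2 \<Rightarrow> l2 \<Rightarrow> bool" where
  "weak_deriv j u g \<longleftrightarrow> weak_partial j (field_of u) (field_of g)"

lemma weak_deriv_iff: "weak_deriv j u g \<longleftrightarrow> (\<forall>f e. test_function f \<longrightarrow> 
   inner u (l2_of (\<lambda>x. partial j f x *\<^sub>R e)) = - inner g (l2_of (\<lambda>x. f x *\<^sub>R e)))"
proof -
  have "weak_deriv j u g \<longleftrightarrow> (\<forall>f. test_function f \<longrightarrow>
    (LINT x|lborel. partial j f x *\<^sub>R fun_of u x) = - (LINT x|lborel. f x *\<^sub>R fun_of g x))"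
    unfolding weak_deriv_def abs_fun_of[symmetric] by (rule weak_partial.abs_eq) (simp_all add: ae_eq_refl_iff)
  also have "\<dots> \<longleftrightarrow> (\<forall>f e. test_function f \<longrightarrow> 
   inner u (l2_of (\<lambda>x. partial j f x *\<^sub>R e)) = - inner g (l2_of (\<lambda>x. f x *\<^sub>R e)))"
  proof -
    have "(LINT x|lborel. partial j f x *\<^sub>R fun_of u x) = - (LINT x|lborel. f x *\<^sub>R fun_of g x) \<longleftrightarrow>
      (\<forall>e. inner u (l2_of (\<lambda>x. partial j f x *\<^sub>R e)) = - inner g (l2_of (\<lambda>x. f x *\<^sub>R e)))" if "test_function f" for f
      unfolding inner_cont_bdd[OF test_function_cont_bdd(1)[OF that]] inner_cont_bdd[OF test_function_cont_bdd(2)[OF that]]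
        inner_minus_left[symmetric]
      by (rule vector_eq_rdot[symmetric])
    then show ?thesis by auto
  qed
  finally show ?thesis .
qed

definition diff_quot :: "3 \<Rightarrow> real \<Rightarrow> l2 \<Rightarrow> l2" where
  "diff_quot j h u = (1 / h) *\<^sub>R (shift (h *\<^sub>R axis j 1) u - u)"

lemma shift_l2_of: "sq_int f \<Longrightarrow> shift h (l2_of f) = l2_of (\<lambda>x. f (x + h))"
  by (rule l2_eqI)
    (use fun_of_shift[of h "l2_of f"] AE_shift[OF fun_of_l2_of[of f], of h] fun_of_l2_of[OF sq_int_shift[of f h]] in \<open>auto elim!: AE_mp\<close>)

lemma l2_of_scaleR: assumes "sq_int f" shows "l2_of (\<lambda>x. c *\<^sub>R f x) = c *\<^sub>R l2_of f"
proof (rule l2_eqI)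
  have "sq_int (\<lambda>x. c *\<^sub>R f x)"
    by (rule sq_int_bounded[OF assms, of _ "\<bar>c\<bar>"]) (use assms in \<open>auto simp: sq_int_def\<close>)
  from fun_of_l2_of[OF this] fun_of_l2_of[OF assms] fun_of_scaleR[of c "l2_of f"]
  show "AE x in lborel. fun_of (l2_of (\<lambda>x. c *\<^sub>R f x)) x = fun_of (c *\<^sub>R l2_of f) x"
    by eventually_elim simp
qed

lemma l2_of_minus: assumes "sq_int f" "sq_int g" shows "l2_of (\<lambda>x. f x - g x) = l2_of f - l2_of g"
  using l2_of_plus[OF assms(1), of "\<lambda>x. (- 1) *\<^sub>R g x"] l2_of_scaleR[OF assms(2), of "- 1"]
    sq_int_bounded[OF assms(2), of "\<lambda>x. (- 1) *\<^sub>R g x" 1] assms(2)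
  by (simp add: sq_int_def)

lemma smooth_line_derivative:
  assumes "smooth f"
  shows "((\<lambda>s. f (x + s *\<^sub>R axis j 1)) has_real_derivative partial j f (x + s *\<^sub>R axis j 1)) (at s)"
proof -
  let ?F = "frechet_derivative f (at (x + s *\<^sub>R axis j 1))"
  have F: "(f has_derivative ?F) (at (x + s *\<^sub>R axis j 1))"
    using smooth_differentiable[OF assms] by (simp add: frechet_derivative_works)
  have "((\<lambda>s. x + s *\<^sub>R axis j 1) has_derivative (\<lambda>h. h *\<^sub>R axis j 1)) (at s)"
    by (auto intro!: derivative_eq_intros)
  from has_derivative_compose[OF this F]
  have "((\<lambda>s. f (x + s *\<^sub>R axis j 1)) has_derivative (\<lambda>h. ?F (h *\<^sub>R axis j 1))) (at s)" .
  moreover have "?F (h *\<^sub>R axis j 1) = h * partial j f (x + s *\<^sub>R axis j 1)" for h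
    using linear_scale[OF has_derivative_linear[OF F]] by (simp add: partial_def)
  ultimately show ?thesis
    by (simp add: has_field_derivative_def mult.commute[of _ "partial j f _"])
qed

lemma bump_function_cont_bdd_partial: "bump_function f \<Longrightarrow> cont_bdd (partial j f)"
  by (intro test_function_cont_bdd bump_function_test)

text \<open>Difference quotients of a bump function converge pointwise to the partial derivative and, by the mean
  value theorem, are dominated by a constant on a slightly larger ball.\<close>

lemma diff_quot_bump_tendsto:
  assumes "bump_function f"
  shows "((\<lambda>h. diff_quot j h (l2_of (\<lambda>x. f x *\<^sub>R e))) \<longlongrightarrow> l2_of (\<lambda>x. partial j f x *\<^sub>R e)) (at 0)"
proof -
  let ?a = "axis j 1 :: real^3"
  have sm: "smooth f" using assms by (simp add: bump_function_def)
  have sqf: "sq_int (\<lambda>x. f x *\<^sub>R e)" by (rule cont_bdd_sq_int[OF bump_function_cont_bdd[OF assms]])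
  obtain C R where CR: "C > 0" "R > 0" "\<And>x. \<bar>partial j f x\<bar> \<le> C * indicator (cball 0 R) x"
    using cont_bdd_bounded[OF bump_function_cont_bdd_partial[OF assms]] by metis
  have bd: "\<bar>f (x + h *\<^sub>R ?a) - f x\<bar> \<le> C * \<bar>h\<bar> * indicator (cball 0 (R + 1)) x" if "\<bar>h\<bar> \<le> 1" for x h
  proof (cases "x \<in> cball 0 (R + 1)")
    case True
    have "norm (f (x + h *\<^sub>R ?a) - f (x + 0 *\<^sub>R ?a)) \<le> C * norm (h - 0)"
    proof (rule field_differentiable_bound[of UNIV _ "\<lambda>s. partial j f (x + s *\<^sub>R ?a)"])
      show "norm (partial j f (x + s *\<^sub>R ?a)) \<le> C" for s
      proof -
        have "C * indicat_real (cball 0 R) (x + s *\<^sub>R ?a) \<le> C * 1"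
          using CR(1) by (intro mult_left_mono indicator_le_1) simp
        then show ?thesis using CR(3)[of "x + s *\<^sub>R ?a"] by simp
      qed
    qed (use smooth_line_derivative[OF sm] in auto)
    then show ?thesis using True by simp
  next
    case False
    have "norm (f (x + h *\<^sub>R ?a) - f (x + 0 *\<^sub>R ?a)) \<le> 0 * norm (h - 0)"
    proof (rule field_differentiable_bound[of "cball 0 1" _ "\<lambda>s. partial j f (x + s *\<^sub>R ?a)"])
      show "norm (partial j f (x + s *\<^sub>R ?a)) \<le> 0" if "s \<in> cball 0 1" for s
      proof -
        have "norm x \<le> norm (x + s *\<^sub>R ?a) + norm (s *\<^sub>R ?a)"
          by (metis add_diff_cancel norm_triangle_ineq4)
        then have "x + s *\<^sub>R ?a \<notin> cball 0 R"
          using False that by (auto simp: norm_axis_1)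
        then show ?thesis using CR(3)[of "x + s *\<^sub>R ?a"] by simp
      qed
    qed (use smooth_line_derivative[OF sm] that in \<open>auto intro: has_field_derivative_at_within\<close>)
    then show ?thesis using CR False by simp
  qed
  have "((\<lambda>h. diff_quot j h (l2_of (\<lambda>x. f x *\<^sub>R e))) \<longlongrightarrow> l2_of (\<lambda>x. partial j f x *\<^sub>R e)) (at 0 within ball 0 1)"
    unfolding tendsto_at_iff_sequentially o_def
  proof (intro allI impI)
    fix X :: "nat \<Rightarrow> real" assume X: "\<forall>i. X i \<in> ball 0 1 - {0}" "X \<longlonglongrightarrow> 0"
    let ?q = "\<lambda>n x. (1 / X n) *\<^sub>R (f (x + X n *\<^sub>R ?a) *\<^sub>R e - f x *\<^sub>R e)"
    have "(\<lambda>n. l2_of (?q n)) \<longlonglongrightarrow> l2_of (\<lambda>x. partial j f x *\<^sub>R e)"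
    proof (rule l2_dominated_convergence(3)[where h = "\<lambda>x. indicator (cball (0::real^3) (R + 1)) x *\<^sub>R e" and C = C])
      show "?q n \<in> borel_measurable lborel" for n
        using cont_bdd_measurable[OF bump_function_cont_bdd[OF assms]] by simp
      show "(\<lambda>x. partial j f x *\<^sub>R e) \<in> borel_measurable lborel"
        using cont_bdd_measurable[OF bump_function_cont_bdd_partial[OF assms]] by simp
      show "sq_int (\<lambda>x. indicator (cball (0::real^3) (R + 1)) x *\<^sub>R e)"
        by (rule sq_int_indicator)
      show "AE x in lborel. norm (?q n x) \<le> C * norm (indicat_real (cball (0::real^3) (R + 1)) x *\<^sub>R e)" for n
      proof (rule AE_I2)
        fix x
        have Xn: "X n \<noteq> 0" "\<bar>X n\<bar> \<le> 1" using X(1)[rule_format, of n] by auto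
        have "norm (?q n x) = \<bar>f (x + X n *\<^sub>R ?a) - f x\<bar> / \<bar>X n\<bar> * norm e"
          by (simp add: scaleR_diff_left[symmetric])
        also have "\<dots> \<le> (C * indicator (cball 0 (R + 1)) x) * norm e"
          using bd[OF Xn(2), of x] Xn by (intro mult_right_mono) (auto simp: divide_le_eq mult_ac)
        finally show "norm (?q n x) \<le> C * norm (indicat_real (cball (0::real^3) (R + 1)) x *\<^sub>R e)"
          by simp
      qed
      show "AE x in lborel. (\<lambda>n. ?q n x) \<longlonglongrightarrow> partial j f x *\<^sub>R e"
      proof (rule AE_I2)
        fix x
        have "((\<lambda>h. (f (x + h *\<^sub>R ?a) - f x) / h) \<longlongrightarrow> partial j f x) (at 0)"
          using smooth_line_derivative[OF sm, of x j 0] by (simp add: has_field_derivative_iff)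
        then have "(\<lambda>n. (f (x + X n *\<^sub>R ?a) - f x) / X n) \<longlonglongrightarrow> partial j f x"
          using X unfolding tendsto_at_iff_sequentially o_def by auto
        then have "(\<lambda>n. ((f (x + X n *\<^sub>R ?a) - f x) / X n) *\<^sub>R e) \<longlonglongrightarrow> partial j f x *\<^sub>R e"
          by (intro tendsto_intros)
        then show "(\<lambda>n. ?q n x) \<longlonglongrightarrow> partial j f x *\<^sub>R e"
          by (simp add: scaleR_diff_left[symmetric])
      qed
    qed
    moreover have "l2_of (?q n) = diff_quot j (X n) (l2_of (\<lambda>x. f x *\<^sub>R e))" for n
    proof -
      have s: "sq_int (\<lambda>x. f (x + X n *\<^sub>R ?a) *\<^sub>R e)" by (rule sq_int_shift[OF sqf])
      have "sq_int (\<lambda>x. f (x + X n *\<^sub>R ?a) *\<^sub>R e + - 1 *\<^sub>R (f x *\<^sub>R e))"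
        by (intro sq_int_plus s sq_int_bounded[OF sqf, of _ 1]) (use sqf in \<open>auto simp: sq_int_def\<close>)
      then show ?thesis
        unfolding diff_quot_def shift_l2_of[OF sqf] l2_of_minus[OF s sqf, symmetric]
        by (intro l2_of_scaleR) simp
    qed
    ultimately show "(\<lambda>n. diff_quot j (X n) (l2_of (\<lambda>x. f x *\<^sub>R e))) \<longlonglongrightarrow> l2_of (\<lambda>x. partial j f x *\<^sub>R e)"
      by simp
  qed
  then show ?thesis by (simp add: at_within_open[of 0 "ball 0 1"])
qed

lemma inner_diff_quot: "inner (diff_quot j h u) v = - inner u (diff_quot j (- h) v)"
  by (simp add: diff_quot_def inner_diff_left inner_diff_right inner_shift field_simps)

text \<open>Translating a test field is differentiable against any \<open>L\<^sup>2\<close> field; the weak derivative of \<open>u\<close> moves the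
  partial derivative from the test field to \<open>u\<close>.\<close>

lemma shift_axis_test_deriv:
  assumes "weak_deriv j u g" "w \<in> test_fields"
  shows "((\<lambda>s. inner u (shift (s *\<^sub>R axis j 1) w)) has_real_derivative - inner g (shift (s *\<^sub>R axis j 1) w)) (at s)"
  using assms(2) unfolding test_fields_def
proof (induction rule: span_induct_alt)
  case base
  then show ?case by (simp add: shift_zero)
next
  case (step c x y)
  then obtain f e where x: "x = l2_of (\<lambda>x. f x *\<^sub>R e)" and f: "bump_function f" by blast
  let ?a = "axis j 1 :: real^3"
  let ?fs = "\<lambda>x. f (x + s *\<^sub>R ?a)"
  have fs: "bump_function ?fs" by (rule bump_function_shift[OF f])
  have xs: "shift (s *\<^sub>R ?a) x = l2_of (\<lambda>x. ?fs x *\<^sub>R e)"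
    unfolding x by (rule shift_l2_of[OF cont_bdd_sq_int[OF bump_function_cont_bdd[OF f]]])
  have "((\<lambda>h. inner u (diff_quot j h (l2_of (\<lambda>x. ?fs x *\<^sub>R e)))) \<longlongrightarrow> inner u (l2_of (\<lambda>x. partial j ?fs x *\<^sub>R e))) (at 0)"
    by (intro tendsto_intros diff_quot_bump_tendsto[OF fs])
  moreover have "inner u (l2_of (\<lambda>x. partial j ?fs x *\<^sub>R e)) = - inner g (shift (s *\<^sub>R ?a) x)"
    unfolding xs using assms(1) bump_function_test[OF fs] unfolding weak_deriv_iff by blast
  moreover have "inner u (diff_quot j h (l2_of (\<lambda>x. ?fs x *\<^sub>R e))) =
      (inner u (shift ((s + h) *\<^sub>R ?a) x) - inner u (shift (s *\<^sub>R ?a) x)) / h" for h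
    unfolding xs[symmetric] by (simp add: diff_quot_def shift_shift inner_diff_right scaleR_add_left add.commute)
  ultimately have "((\<lambda>s. inner u (shift (s *\<^sub>R ?a) x)) has_real_derivative - inner g (shift (s *\<^sub>R ?a) x)) (at s)"
    by (simp add: DERIV_def)
  from DERIV_add[OF DERIV_cmult[OF this, of c] step(2)]
  show ?case by (simp add: shift_plus shift_scaleR inner_add_right)
qed

text \<open>Duality: by density the functional \<open>inner a\<close> may be evaluated at \<open>a\<close> itself.\<close>

lemma dense_norm_bound:
  assumes "C \<ge> 0" "\<And>w. w \<in> test_fields \<Longrightarrow> \<bar>inner a w\<bar> \<le> C * norm w"
  shows "norm a \<le> C"
proof -
  have "closed {w. \<bar>inner a w\<bar> \<le> C * norm w}"
    by (intro closed_Collect_le continuous_intros)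
  then have "closure test_fields \<subseteq> {w. \<bar>inner a w\<bar> \<le> C * norm w}"
    using assms by (intro closure_minimal) auto
  then have "a \<in> {w. \<bar>inner a w\<bar> \<le> C * norm w}" using test_fields_dense by blast
  then have "\<bar>inner a a\<bar> \<le> C * norm a" by simp
  then have "norm a * norm a \<le> C * norm a" by (simp add: dot_square_norm power2_eq_square)
  then show ?thesis
    using assms(1) by (cases "a = 0") auto
qed

lemma dense_eqI:
  assumes "\<And>w. w \<in> test_fields \<Longrightarrow> inner a w = inner b w"
  shows "a = b"
  using dense_norm_bound[of 0 "a - b"] assms by (simp add: inner_diff_left)

lemma weak_deriv_unique: assumes "weak_deriv j u g" "weak_deriv j u g'" shows "g = g'"
proof (rule dense_eqI)
  fix w assume "w \<in> test_fields"
  from DERIV_unique[OF shift_axis_test_deriv[OF assms(1) this, of 0] shift_axis_test_deriv[OF assms(2) this, of 0]]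
  show "inner g w = inner g' w" by simp
qed

text \<open>The mean value theorem for \<open>s \<mapsto> \<langle>u, w(\<cdot> + s e\<^sub>j)\<rangle>\<close> with a test field \<open>w\<close>, followed by duality.\<close>

lemma weak_deriv_shift_norm:
  assumes "weak_deriv j u g"
  shows "norm (shift (h *\<^sub>R axis j 1) u - u) \<le> \<bar>h\<bar> * norm g"
proof (rule dense_norm_bound)
  fix w assume w: "w \<in> test_fields"
  let ?a = "axis j 1 :: real^3"
  have "norm (inner u (shift ((- h) *\<^sub>R ?a) w) - inner u (shift (0 *\<^sub>R ?a) w)) \<le> (norm g * norm w) * norm (- h - 0)"
  proof (rule field_differentiable_bound[of UNIV _ "\<lambda>s. - inner g (shift (s *\<^sub>R ?a) w)"])
    show "norm (- inner g (shift (s *\<^sub>R ?a) w)) \<le> norm g * norm w" for s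
      using Cauchy_Schwarz_ineq2[of g "shift (s *\<^sub>R ?a) w"] by simp
  qed (use shift_axis_test_deriv[OF assms w] in auto)
  then show "\<bar>inner (shift (h *\<^sub>R ?a) u - u) w\<bar> \<le> \<bar>h\<bar> * norm g * norm w"
    by (simp add: inner_diff_left inner_shift mult_ac)
qed simp

lemma diff_quot_norm: assumes "weak_deriv j u g" shows "norm (diff_quot j h u) \<le> norm g"
proof (cases "h = 0")
  case False
  then show ?thesis using weak_deriv_shift_norm[OF assms, of h] by (simp add: diff_quot_def divide_le_eq mult.commute)
qed (simp add: diff_quot_def)

lemma filterlim_uminus_at_0: "filterlim uminus (at 0) (at (0::real))"
  unfolding filterlim_at by (auto simp: eventually_at_filter intro!: tendsto_eq_intros)

text \<open>Weak convergence holds against test fields, and the difference quotients are bounded in norm, so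
  density extends it to all of \<open>L\<^sup>2\<close>.\<close>

lemma diff_quot_tendsto_weak:
  assumes "weak_deriv j u g"
  shows "((\<lambda>h. inner (diff_quot j h u) v) \<longlongrightarrow> inner g v) (at 0)"
proof (rule tendstoI)
  fix e :: real assume e: "e > 0"
  define d where "d = e / (4 * (norm g + 1))"
  have d: "d > 0" unfolding d_def using e by (intro divide_pos_pos) (auto intro: add_nonneg_pos)
  obtain w where w: "w \<in> test_fields" "dist w v < d"
    using test_fields_dense d by (metis UNIV_I closure_approachable)
  let ?a = "axis j 1 :: real^3"
  have "((\<lambda>h. (inner u (shift (h *\<^sub>R ?a) w) - inner u w) / h) \<longlongrightarrow> - inner g w) (at 0)"
    using shift_axis_test_deriv[OF assms w(1), of 0] by (simp add: DERIV_def)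
  from filterlim_compose[OF this filterlim_uminus_at_0]
  have "((\<lambda>h. - ((inner u (shift ((- h) *\<^sub>R ?a) w) - inner u w) / (- h))) \<longlongrightarrow> - (- inner g w)) (at 0)"
    by (intro tendsto_minus)
  then have "((\<lambda>h. inner (diff_quot j h u) w) \<longlongrightarrow> inner g w) (at 0)"
    by (simp add: diff_quot_def inner_diff_left inner_shift)
  from tendstoD[OF this, of "e / 2"] e
  have "\<forall>\<^sub>F h in at 0. dist (inner (diff_quot j h u) w) (inner g w) < e / 2" by simp
  then show "\<forall>\<^sub>F h in at 0. dist (inner (diff_quot j h u) v) (inner g v) < e"
  proof eventually_elim
    case (elim h)
    have "\<bar>inner (diff_quot j h u - g) (v - w)\<bar> \<le> norm (diff_quot j h u - g) * norm (v - w)"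
      by (rule Cauchy_Schwarz_ineq2)
    also have "\<dots> \<le> (2 * norm g) * d"
      using w(2) diff_quot_norm[OF assms, of h] norm_triangle_ineq4[of "diff_quot j h u" g]
      by (intro mult_mono) (auto simp: dist_norm norm_minus_commute)
    also have "\<dots> \<le> 2 * (norm g + 1) * d" using d by (intro mult_right_mono) auto
    also have "\<dots> = e / 2"
    proof -
      have "2 * n * (e / (4 * n)) = e / 2" if "n \<noteq> 0" for n :: real
        using that by simp
      moreover have "norm g + 1 \<noteq> 0" using norm_ge_zero[of g] by linarith
      ultimately show ?thesis unfolding d_def by blast
    qed
    finally have "\<bar>inner (diff_quot j h u) v - inner (diff_quot j h u) w - inner g v + inner g w\<bar> \<le> e / 2"
      by (simp add: inner_diff_left inner_diff_right algebra_simps)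
    then show ?case using elim unfolding dist_real_def by linarith
  qed
qed

text \<open>The first Sobolev space, as a subspace of the inner product space \<open>l2\<close>.\<close>

definition H1_l2 :: "l2 set" where
  "H1_l2 = {u. \<forall>j. \<exists>g. weak_deriv j u g}"

definition wderiv :: "3 \<Rightarrow> l2 \<Rightarrow> l2" where
  "wderiv j u = (THE g. weak_deriv j u g)"

lemma wderiv_eq: "weak_deriv j u g \<Longrightarrow> wderiv j u = g"
  unfolding wderiv_def using weak_deriv_unique by blast

lemma weak_deriv_wderiv: "u \<in> H1_l2 \<Longrightarrow> weak_deriv j u (wderiv j u)"
  using wderiv_eq by (auto simp: H1_l2_def)

lemma weak_deriv_plus: "weak_deriv j u g \<Longrightarrow> weak_deriv j v k \<Longrightarrow> weak_deriv j (u + v) (g + k)"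
  by (simp add: weak_deriv_iff inner_add_left)

lemma weak_deriv_scaleR: "weak_deriv j u g \<Longrightarrow> weak_deriv j (c *\<^sub>R u) (c *\<^sub>R g)"
  by (simp add: weak_deriv_iff)

lemma weak_deriv_zero: "weak_deriv j 0 0"
  by (simp add: weak_deriv_iff)

lemma H1_l2_subspace: "subspace H1_l2"
  unfolding subspace_def using weak_deriv_plus weak_deriv_scaleR weak_deriv_zero by (fastforce simp: H1_l2_def)

lemma wderiv_plus: "u \<in> H1_l2 \<Longrightarrow> v \<in> H1_l2 \<Longrightarrow> wderiv j (u + v) = wderiv j u + wderiv j v"
  by (intro wderiv_eq weak_deriv_plus weak_deriv_wderiv)

lemma wderiv_scaleR: "u \<in> H1_l2 \<Longrightarrow> wderiv j (c *\<^sub>R u) = c *\<^sub>R wderiv j u"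
  by (intro wderiv_eq weak_deriv_scaleR weak_deriv_wderiv)

text \<open>Integration by parts. Difference quotients satisfy it exactly, and both sides converge by weak
  convergence.\<close>

lemma wderiv_adjoint:
  assumes "u \<in> H1_l2" "v \<in> H1_l2"
  shows "inner (wderiv j u) v = - inner u (wderiv j v)"
proof (rule tendsto_unique[of "at (0::real)"])
  show "((\<lambda>h. inner (diff_quot j h u) v) \<longlongrightarrow> inner (wderiv j u) v) (at 0)"
    by (rule diff_quot_tendsto_weak[OF weak_deriv_wderiv[OF assms(1)]])
  have "((\<lambda>h. - inner (diff_quot j (- h) v) u) \<longlongrightarrow> - inner (wderiv j v) u) (at 0)"
    by (intro tendsto_minus filterlim_compose[OF diff_quot_tendsto_weak[OF weak_deriv_wderiv[OF assms(2)]] filterlim_uminus_at_0])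
  moreover have "- inner (diff_quot j (- h) v) u = inner (diff_quot j h u) v" for h
    unfolding inner_diff_quot[of j h u v] by (simp add: inner_commute)
  ultimately show "((\<lambda>h. inner (diff_quot j h u) v) \<longlongrightarrow> - inner u (wderiv j v)) (at 0)"
    by (simp add: inner_commute)
qed simp

lemma diff_quot_commute: "diff_quot j h (diff_quot k l u) = diff_quot k l (diff_quot j h u)"
  by (simp add: diff_quot_def shift_diff shift_scaleR shift_shift add.commute algebra_simps)

text \<open>Two integrations by parts would require second derivatives, which may not exist. Difference
  quotients commute, and they are replaced by derivatives one at a time.\<close>

lemma wderiv_cross:
  assumes "u \<in> H1_l2" "v \<in> H1_l2"
  shows "inner (wderiv j u) (wderiv k v) = inner (wderiv k u) (wderiv j v)"
proof -
  have *: "inner (wderiv j u) (diff_quot k l v) = inner (diff_quot k (- l) u) (wderiv j v)" for l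
  proof (rule tendsto_unique[of "at (0::real)"])
    show "((\<lambda>h. inner (diff_quot j h u) (diff_quot k l v)) \<longlongrightarrow> inner (wderiv j u) (diff_quot k l v)) (at 0)"
      by (rule diff_quot_tendsto_weak[OF weak_deriv_wderiv[OF assms(1)]])
    have "((\<lambda>h. inner (diff_quot j (- h) v) (diff_quot k (- l) u)) \<longlongrightarrow> inner (wderiv j v) (diff_quot k (- l) u)) (at 0)"
      by (rule filterlim_compose[OF diff_quot_tendsto_weak[OF weak_deriv_wderiv[OF assms(2)]] filterlim_uminus_at_0])
    moreover have "inner (diff_quot j (- h) v) (diff_quot k (- l) u) = inner (diff_quot j h u) (diff_quot k l v)" for h
    proof -
      have "inner (diff_quot j h u) (diff_quot k l v) = - inner u (diff_quot k l (diff_quot j (- h) v))"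
        by (simp add: inner_diff_quot diff_quot_commute)
      also have "\<dots> = inner (diff_quot k (- l) u) (diff_quot j (- h) v)"
        using inner_diff_quot[of k "- l" u "diff_quot j (- h) v"] by simp
      finally show ?thesis by (simp add: inner_commute)
    qed
    ultimately show "((\<lambda>h. inner (diff_quot j h u) (diff_quot k l v)) \<longlongrightarrow> inner (diff_quot k (- l) u) (wderiv j v)) (at 0)"
      by (simp add: inner_commute)
  qed simp
  show ?thesis
  proof (rule tendsto_unique[of "at (0::real)"])
    have "((\<lambda>l. inner (diff_quot k l v) (wderiv j u)) \<longlongrightarrow> inner (wderiv k v) (wderiv j u)) (at 0)"
      by (rule diff_quot_tendsto_weak[OF weak_deriv_wderiv[OF assms(2)]])
    then show "((\<lambda>l. inner (wderiv j u) (diff_quot k l v)) \<longlongrightarrow> inner (wderiv j u) (wderiv k v)) (at 0)"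
      by (simp add: inner_commute)
    show "((\<lambda>l. inner (wderiv j u) (diff_quot k l v)) \<longlongrightarrow> inner (wderiv k u) (wderiv j v)) (at 0)"
      unfolding *
      by (rule filterlim_compose[OF diff_quot_tendsto_weak[OF weak_deriv_wderiv[OF assms(1)]] filterlim_uminus_at_0])
  qed simp
qed

section \<open>Clifford relations and the kinetic operator\<close>

definition hconj :: "complex^4^4 \<Rightarrow> complex^4^4" where
  "hconj M = (\<chi> a b. cnj (M $ b $ a))"

lemma inner_hconj: "inner (M *v x) y = inner x (hconj M *v (y :: complex^4))"
proof -
  have c: "inner (z * w) y = inner w (cnj z * y)" for z w y :: complex
    by (simp add: inner_complex_def algebra_simps)
  have "inner (M *v x) y = (\<Sum>a\<in>UNIV. \<Sum>b\<in>UNIV. inner (x $ b) (cnj (M $ a $ b) * y $ a))"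
    by (simp add: inner_vec_def matrix_vector_mult_def inner_sum_left c)
  also have "\<dots> = inner x (hconj M *v y)"
    by (subst sum.swap) (simp add: inner_vec_def matrix_vector_mult_def inner_sum_right hconj_def)
  finally show ?thesis .
qed

lemma mat_act_plus: "mat_act M (u + v) = mat_act M u + mat_act M v"
  by (rule l2_eqI)
    (use fun_of_mat_act[of M u] fun_of_mat_act[of M v] fun_of_mat_act[of M "u + v"] fun_of_plus[of "mat_act M u" "mat_act M v"] fun_of_plus[of u v]
      in \<open>eventually_elim, simp add: matrix_vector_right_distrib\<close>)

lemma cmatrix_scaleR: "M *v (c *\<^sub>R v) = c *\<^sub>R (M *v (v :: complex^4))" for M :: "complex^4^4"
  by (simp add: vec_eq_iff matrix_vector_mult_def scaleR_sum_right)

lemma mat_act_scaleR: "mat_act M (c *\<^sub>R u) = c *\<^sub>R mat_act M u"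
  by (rule l2_eqI)
    (use fun_of_mat_act[of M u] fun_of_mat_act[of M "c *\<^sub>R u"] fun_of_scaleR[of c "mat_act M u"] fun_of_scaleR[of c u]
      in \<open>eventually_elim, simp add: cmatrix_scaleR\<close>)

lemma linear_mat_act: "linear (mat_act M)"
  by (rule linearI) (auto simp: mat_act_plus mat_act_scaleR)

lemma mat_act_mat_act: "mat_act M (mat_act N u) = mat_act (M ** N) u"
  by (rule l2_eqI)
    (use fun_of_mat_act[of N u] fun_of_mat_act[of M "mat_act N u"] fun_of_mat_act[of "M ** N" u]
      in \<open>eventually_elim, simp add: matrix_vector_mul_assoc\<close>)

lemma mat_act_add: "mat_act (M + N) u = mat_act M u + mat_act N u"
  by (rule l2_eqI)
    (use fun_of_mat_act[of N u] fun_of_mat_act[of M u] fun_of_mat_act[of "M + N" u] fun_of_plus[of "mat_act M u" "mat_act N u"]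
      in \<open>eventually_elim, simp add: matrix_vector_mult_add_rdistrib\<close>)

lemma mat_act_1 [simp]: "mat_act (mat 1) u = u"
  by (rule l2_eqI) (use fun_of_mat_act[of "mat 1" u] in simp)

lemma mat_act_0 [simp]: "mat_act 0 u = 0"
  by (rule l2_eqI) (use fun_of_mat_act[of 0 u] fun_of_zero in \<open>eventually_elim, simp\<close>)

lemma mat_act_uminus: "mat_act (- M) u = - mat_act M u"
  using mat_act_add[of "- M" M u] by (simp add: eq_neg_iff_add_eq_0)

lemma inner_mat_act: "inner (mat_act M u) v = inner u (mat_act (hconj M) v)"
proof -
  have "inner (mat_act M u) v = (LINT x|lborel. inner (M *v fun_of u x) (fun_of v x))"
    unfolding inner_l2_fun_of
  proof (rule integral_cong_AE)
    show "AE x in lborel. inner (fun_of (mat_act M u) x) (fun_of v x) = inner (M *v fun_of u x) (fun_of v x)"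
      using fun_of_mat_act[of M u] by eventually_elim simp
  qed simp_all
  also have "\<dots> = (LINT x|lborel. inner (fun_of u x) (hconj M *v fun_of v x))"
    by (simp add: inner_hconj)
  also have "\<dots> = inner u (mat_act (hconj M) v)"
    unfolding inner_l2_fun_of
  proof (rule integral_cong_AE)
    show "AE x in lborel. inner (fun_of u x) (hconj M *v fun_of v x) = inner (fun_of u x) (fun_of (mat_act (hconj M) v) x)"
      using fun_of_mat_act[of "hconj M" v] by eventually_elim simp
  qed simp_all
  finally show ?thesis .
qed

lemma mat_act_l2_of: assumes "sq_int f" shows "mat_act M (l2_of f) = l2_of (\<lambda>x. M *v f x)"
  by (rule l2_eqI)
   (use fun_of_l2_of[OF assms] fun_of_l2_of[OF sq_int_cmatrix[OF assms, of M]] fun_of_mat_act[of M "l2_of f"]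
     in \<open>eventually_elim, simp\<close>)

lemma weak_deriv_mat_act: assumes "weak_deriv j u g" shows "weak_deriv j (mat_act M u) (mat_act M g)"
  using assms unfolding weak_deriv_iff inner_mat_act
  by (simp add: mat_act_l2_of cont_bdd_sq_int test_function_cont_bdd cmatrix_scaleR)

lemma H1_l2_mat_act: "u \<in> H1_l2 \<Longrightarrow> mat_act M u \<in> H1_l2"
  unfolding H1_l2_def using weak_deriv_mat_act by blast

lemma wderiv_mat_act: "u \<in> H1_l2 \<Longrightarrow> wderiv j (mat_act M u) = mat_act M (wderiv j u)"
  by (intro wderiv_eq weak_deriv_mat_act weak_deriv_wderiv)

text \<open>The matrices \<open>\<alpha>\<^sub>j / i\<close>, so that \<open>\<alpha> \<cdot> D = \<Sum> (\<alpha>\<^sub>j / i) \<partial>\<^sub>j\<close> can be formed in the real vector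
  space \<open>l2\<close>.\<close>

definition momentum_mat :: "3 \<Rightarrow> complex^4^4" where
  "momentum_mat j = (\<chi> a b. (1 / \<i>) * dirac_alpha j $ a $ b)"

definition gamma5 :: "complex^4^4" where
  "gamma5 = block_matrix 0 (mat 1) (mat 1) 0"

lemma vector_4:
  "(vector [w, x, y, z] :: 'a::zero ^ 4) $ 1 = w" "(vector [w, x, y, z] :: 'a::zero ^ 4) $ 2 = x"
  "(vector [w, x, y, z] :: 'a::zero ^ 4) $ 3 = y" "(vector [w, x, y, z] :: 'a::zero ^ 4) $ 4 = z"
  unfolding vector_def by simp_all

lemmas cliff_defs = momentum_mat_def gamma5_def dirac_beta_def dirac_alpha_def pauli_def block_matrix_def hconj_def
  matrix_matrix_mult_def mat_def

lemma hconj_momentum_mat: "hconj (momentum_mat j) = - momentum_mat j"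
  using exhaust_3[of j]
  by (elim disjE) (simp_all add: cliff_defs vec_eq_iff forall_4 vector_4)

lemma momentum_mat_sq: "momentum_mat j ** momentum_mat j = - mat 1"
  using exhaust_3[of j]
  by (elim disjE) (simp_all add: cliff_defs vec_eq_iff forall_4 vector_4 sum_4)

lemma momentum_mat_anticommute: "j \<noteq> k \<Longrightarrow> momentum_mat j ** momentum_mat k = - (momentum_mat k ** momentum_mat j)"
  using exhaust_3[of j] exhaust_3[of k]
  by (elim disjE) (simp_all add: cliff_defs vec_eq_iff forall_4 vector_4 sum_4)

lemma beta_momentum_mat: "dirac_beta ** momentum_mat j = - (momentum_mat j ** dirac_beta)"
  using exhaust_3[of j]
  by (elim disjE) (simp_all add: cliff_defs vec_eq_iff forall_4 vector_4 sum_4)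

lemma beta_sq: "dirac_beta ** dirac_beta = mat 1"
  by (simp_all add: cliff_defs vec_eq_iff forall_4 vector_4 sum_4)

lemma gamma5_momentum_mat: "gamma5 ** momentum_mat j = momentum_mat j ** gamma5"
  using exhaust_3[of j]
  by (elim disjE) (simp_all add: cliff_defs vec_eq_iff forall_4 vector_4 sum_4)

lemma gamma5_sq: "gamma5 ** gamma5 = mat 1"
  by (simp_all add: cliff_defs vec_eq_iff forall_4 vector_4 sum_4)

lemma gamma5_beta: "gamma5 ** dirac_beta = - (dirac_beta ** gamma5)"
  by (simp_all add: cliff_defs vec_eq_iff forall_4 vector_4 sum_4)

lemma hconj_alpha: "hconj (dirac_alpha j) = dirac_alpha j"
  using exhaust_3[of j]
  by (elim disjE) (simp_all add: cliff_defs vec_eq_iff forall_4 vector_4)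

lemma alpha_sq: "dirac_alpha j ** dirac_alpha j = mat 1"
  using exhaust_3[of j]
  by (elim disjE) (simp_all add: cliff_defs vec_eq_iff forall_4 vector_4 sum_4)

lemma beta_alpha: "dirac_beta ** dirac_alpha j = - (dirac_alpha j ** dirac_beta)"
  using exhaust_3[of j]
  by (elim disjE) (simp_all add: cliff_defs vec_eq_iff forall_4 vector_4 sum_4)

lemma gamma5_alpha: "gamma5 ** dirac_alpha j = dirac_alpha j ** gamma5"
  using exhaust_3[of j]
  by (elim disjE) (simp_all add: cliff_defs vec_eq_iff forall_4 vector_4 sum_4)

lemma norm_alpha: "norm (dirac_alpha j *v x) = norm x"
  by (simp add: norm_eq_sqrt_inner inner_hconj hconj_alpha matrix_vector_mul_assoc alpha_sq)

text \<open>The operator \<open>\<alpha> \<cdot> D\<close>.\<close>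

definition kinetic :: "l2 \<Rightarrow> l2" where
  "kinetic u = (\<Sum>j\<in>UNIV. mat_act (momentum_mat j) (wderiv j u))"

lemma kinetic_plus: "u \<in> H1_l2 \<Longrightarrow> v \<in> H1_l2 \<Longrightarrow> kinetic (u + v) = kinetic u + kinetic v"
  by (simp add: kinetic_def wderiv_plus mat_act_plus sum.distrib)

lemma kinetic_scaleR: "u \<in> H1_l2 \<Longrightarrow> kinetic (c *\<^sub>R u) = c *\<^sub>R kinetic u"
  by (simp add: kinetic_def wderiv_scaleR mat_act_scaleR scaleR_sum_right)

lemma kinetic_sum: "(\<And>i. i \<in> I \<Longrightarrow> u i \<in> H1_l2) \<Longrightarrow> kinetic (\<Sum>i\<in>I. c i *\<^sub>R u i) = (\<Sum>i\<in>I. c i *\<^sub>R kinetic (u i))"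
proof (induction I rule: infinite_finite_induct)
  case (insert i I)
  have "(\<Sum>i\<in>I. c i *\<^sub>R u i) \<in> H1_l2"
    using insert by (intro subspace_sum subspace_scale H1_l2_subspace) auto
  then show ?case
    using insert by (simp add: kinetic_plus kinetic_scaleR subspace_scale[OF H1_l2_subspace])
qed (use kinetic_scaleR[of 0 0] subspace_0[OF H1_l2_subspace] in simp_all)

text \<open>The derivatives and the matrices \<open>\<alpha>\<^sub>j / i\<close> are both skew.\<close>

lemma kinetic_symmetric: 
  assumes "u \<in> H1_l2" "v \<in> H1_l2" shows "inner (kinetic u) v = inner u (kinetic v)"
  using assms
  by (simp add: kinetic_def inner_sum_left inner_sum_right inner_mat_act hconj_momentum_mat mat_act_uminus wderiv_adjoint H1_l2_mat_act wderiv_mat_act)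

text \<open>In the expanded square the off-diagonal terms cancel in pairs,
  because the matrices anticommute while the derivatives commute.\<close>

lemma kinetic_norm:
  assumes "u \<in> H1_l2" shows "norm (kinetic u) ^ 2 = (\<Sum>j\<in>UNIV. norm (wderiv j u) ^ 2)"
proof -
  let ?T = "\<lambda>j k. inner (mat_act (momentum_mat j) (wderiv j u)) (mat_act (momentum_mat k) (wderiv k u))"
  have T: "?T j k = - inner (wderiv j u) (mat_act (momentum_mat j ** momentum_mat k) (wderiv k u))" for j k
    by (simp add: inner_mat_act hconj_momentum_mat mat_act_uminus) (simp add: mat_act_mat_act)
  have d: "?T j j = norm (wderiv j u) ^ 2" for j
    by (simp add: T momentum_mat_sq mat_act_uminus power2_norm_eq_inner)
  have o: "?T j k + ?T k j = 0" if "j \<noteq> k" for j k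
  proof -
    have "inner (wderiv k u) (mat_act (momentum_mat k ** momentum_mat j) (wderiv j u)) = inner (wderiv k u) (wderiv j (mat_act (momentum_mat k ** momentum_mat j) u))"
      by (simp add: wderiv_mat_act assms)
    also have "\<dots> = inner (wderiv j u) (wderiv k (mat_act (momentum_mat k ** momentum_mat j) u))"
      by (rule wderiv_cross) (simp_all add: assms H1_l2_mat_act)
    also have "\<dots> = - inner (wderiv j u) (mat_act (momentum_mat j ** momentum_mat k) (wderiv k u))"
      using momentum_mat_anticommute[OF that] by (simp add: wderiv_mat_act assms mat_act_uminus)
    finally show ?thesis by (simp add: T)
  qed
  have "norm (kinetic u) ^ 2 = ?T 1 1 + ?T 2 2 + ?T 3 3 + (?T 1 2 + ?T 2 1) + (?T 1 3 + ?T 3 1) + (?T 2 3 + ?T 3 2)"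
    by (simp add: power2_norm_eq_inner kinetic_def sum_3 inner_add_left inner_add_right)
  also have "\<dots> = (\<Sum>j\<in>UNIV. norm (wderiv j u) ^ 2)"
    by (simp only: d o sum_3) (simp add: o)
  finally show ?thesis .
qed

lemma wderiv_le_kinetic: "u \<in> H1_l2 \<Longrightarrow> norm (wderiv j u) \<le> norm (kinetic u)"
proof -
  assume u: "u \<in> H1_l2"
  have "norm (wderiv j u) ^ 2 \<le> (\<Sum>j\<in>UNIV. norm (wderiv j u) ^ 2)"
    by (rule member_le_sum) auto
  then show ?thesis by (simp add: kinetic_norm[OF u, symmetric] power2_le_iff_abs_le)
qed

definition one_norm :: "real^3 \<Rightarrow> real" where
  "one_norm h = (\<Sum>j\<in>UNIV. \<bar>h $ j\<bar>)"

text \<open>The translation is carried out along the three axes in turn. The estimates on averages and densities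
  below start from this property.\<close>

lemma shift_norm_kinetic:
  assumes "u \<in> H1_l2" shows "norm (shift h u - u) \<le> one_norm h * norm (kinetic u)"
proof -
  let ?a = "\<lambda>j. h $ j *\<^sub>R (axis j 1 :: real^3)"
  have h: "h = ?a 1 + ?a 2 + ?a 3"
    by (simp add: vec_eq_iff forall_3 axis_def)
  have b: "norm (shift (?a j) u - u) \<le> \<bar>h $ j\<bar> * norm (kinetic u)" for j
    by (rule order_trans[OF weak_deriv_shift_norm[OF weak_deriv_wderiv[OF assms]]]) (simp add: mult_left_mono wderiv_le_kinetic assms)
  have "shift h u - u = shift (?a 1 + ?a 2) (shift (?a 3) u - u) + shift (?a 1) (shift (?a 2) u - u) + (shift (?a 1) u - u)"
    by (subst h) (simp add: shift_diff shift_shift)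
  then have "norm (shift h u - u) \<le> norm (shift (?a 3) u - u) + norm (shift (?a 2) u - u) + norm (shift (?a 1) u - u)"
    apply (rule ssubst)
    using norm_triangle_ineq[of "shift (?a 1 + ?a 2) (shift (?a 3) u - u) + shift (?a 1) (shift (?a 2) u - u)" "shift (?a 1) u - u"]
      norm_triangle_ineq[of "shift (?a 1 + ?a 2) (shift (?a 3) u - u)" "shift (?a 1) (shift (?a 2) u - u)"] unfolding norm_shift by linarith
  also have "\<dots> \<le> one_norm h * norm (kinetic u)"
    using b[of 1] b[of 2] b[of 3] by (simp add: one_norm_def sum_3 algebra_simps)
  finally show ?thesis .
qed

section \<open>Averages over balls\<close>

text \<open>Averages over balls of all radii are integrals against this one probability measure, with the radius
  moved into the integrand.\<close>

definition unif_ball :: "(real^3) measure" where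
  "unif_ball = uniform_measure lborel (cball 0 1)"

definition ball_vol :: real where
  "ball_vol = measure lborel (cball (0::real^3) 1)"

lemma ball_vol_pos: "ball_vol > 0"
  unfolding ball_vol_def by (rule content_cball_pos) simp

lemma emeasure_ball_vol: "emeasure lborel (cball (0::real^3) 1) = ennreal ball_vol"
  unfolding ball_vol_def
  by (rule emeasure_eq_ennreal_measure)
     (rule less_imp_neq[OF emeasure_bounded_finite[OF bounded_cball], unfolded infinity_ennreal_def])

lemma sets_unif_ball [measurable_cong, simp]: "sets unif_ball = sets borel"
  by (simp add: unif_ball_def)

lemma space_unif_ball [simp]: "space unif_ball = UNIV"
  by (simp add: unif_ball_def)

lemma nn_integral_unif_ball:
  assumes "f \<in> borel_measurable borel"
  shows "(\<integral>\<^sup>+y. f y \<partial>unif_ball) = (\<integral>\<^sup>+y. f y * indicator (cball 0 1) y \<partial>lborel) / ennreal ball_vol"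
  unfolding unif_ball_def emeasure_ball_vol[symmetric] using assms by (intro nn_integral_uniform_measure) auto

lemma emeasure_unif_ball: "emeasure unif_ball UNIV = 1"
proof -
  have "emeasure unif_ball UNIV = emeasure lborel (UNIV \<inter> cball (0::real^3) 1) / emeasure lborel (cball (0::real^3) 1)"
    unfolding unif_ball_def by (simp add: divide_ennreal_def)
  then show ?thesis using ball_vol_pos by (simp add: emeasure_ball_vol divide_ennreal)
qed

lemma finite_measure_unif_ball: "finite_measure unif_ball"
  by (rule finite_measureI) (simp add: emeasure_unif_ball)

lemma sigma_finite_unif_ball: "sigma_finite_measure unif_ball"
  using finite_measure_unif_ball by (rule finite_measure.axioms(1))

lemma measure_unif_ball: "measure unif_ball UNIV = 1"
  by (simp add: measure_def emeasure_unif_ball)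

lemma AE_unif_ball: "AE y in unif_ball. y \<in> cball 0 1"
  unfolding unif_ball_def by (rule AE_uniform_measureI) auto

lemma nn_integral_affine_euclid:
  assumes [measurable]: "f \<in> borel_measurable borel" and "r > 0"
  shows "(\<integral>\<^sup>+y. f (x + r *\<^sub>R y) \<partial>lborel) = (\<integral>\<^sup>+y. f y \<partial>(lborel :: (real^3) measure)) / ennreal (r ^ 3)"
proof -
  have "(\<integral>\<^sup>+y. f y \<partial>(lborel :: (real^3) measure)) =
     (\<integral>\<^sup>+y. f y \<partial>density (distr lborel borel (\<lambda>y. x + r *\<^sub>R y)) (\<lambda>_. ennreal (\<bar>r\<bar> ^ DIM(real^3))))"
    using lborel_affine[of r x] assms(2) by simp
  also have "\<dots> = ennreal (r ^ 3) * (\<integral>\<^sup>+y. f (x + r *\<^sub>R y) \<partial>lborel)"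
    using assms(2) by (simp add: nn_integral_density nn_integral_distr nn_integral_cmult)
  finally show ?thesis
    using assms(2) by (simp add: mult.commute[of "ennreal _"] ennreal_mult_divide_eq)
qed

lemma nn_integral_unif_ball_le:
  assumes [measurable]: "f \<in> borel_measurable borel" and "r > 0"
  shows "(\<integral>\<^sup>+y. f (x + r *\<^sub>R y) \<partial>unif_ball) \<le> (\<integral>\<^sup>+y. f y \<partial>(lborel :: (real^3) measure)) / ennreal (ball_vol * r ^ 3)"
proof -
  have "(\<integral>\<^sup>+y. f (x + r *\<^sub>R y) \<partial>unif_ball) = (\<integral>\<^sup>+y. f (x + r *\<^sub>R y) * indicator (cball 0 1) y \<partial>lborel) / ennreal ball_vol"
    by (rule nn_integral_unif_ball) measurable
  also have "\<dots> \<le> (\<integral>\<^sup>+y. f (x + r *\<^sub>R y) \<partial>lborel) / ennreal ball_vol"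
    by (intro divide_right_mono_ennreal nn_integral_mono) (auto simp: indicator_def)
  also have "\<dots> = (\<integral>\<^sup>+y. f y \<partial>(lborel :: (real^3) measure)) / ennreal (ball_vol * r ^ 3)"
  proof -
    have "inverse (ennreal (r ^ 3)) * inverse (ennreal ball_vol) = inverse (ennreal (ball_vol * r ^ 3))"
      using assms(2) ball_vol_pos by (simp add: inverse_ennreal ennreal_mult[symmetric] mult.commute)
    then show ?thesis
      using assms(2) by (simp add: nn_integral_affine_euclid divide_ennreal_def mult.assoc)
  qed
  finally show ?thesis .
qed

text \<open>The variance of \<open>\<bar>v\<bar>\<close> under the probability measure is non-negative.\<close>

lemma jensen_sq:
  fixes v :: "real^3 \<Rightarrow> complex^4"
  assumes [measurable]: "v \<in> borel_measurable borel" 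
    and fin: "(\<integral>\<^sup>+y. ennreal (norm (v y) ^ 2) \<partial>unif_ball) \<le> ennreal b" and "b \<ge> 0"
  shows "integrable unif_ball v" "ennreal (norm (LINT y|unif_ball. v y) ^ 2) \<le> (\<integral>\<^sup>+y. ennreal (norm (v y) ^ 2) \<partial>unif_ball)"
    "norm (LINT y|unif_ball. v y) \<le> sqrt b"
proof -
  interpret finite_measure unif_ball by (rule finite_measure_unif_ball)
  have i2: "integrable unif_ball (\<lambda>y. norm (v y) ^ 2)"
    by (rule integrableI_bounded) (use fin in \<open>auto simp: less_top[symmetric] top_unique\<close>)
  have i1: "integrable unif_ball (\<lambda>y. norm (v y))"
    by (rule square_integrable_imp_integrable[OF _ i2]) measurable
  then show iv: "integrable unif_ball v" by (simp add: integrable_norm_iff)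
  define c where "c = (LINT y|unif_ball. norm (v y))"
  have "0 \<le> (LINT y|unif_ball. (norm (v y) - c) ^ 2)" by simp
  also have "\<dots> = (LINT y|unif_ball. norm (v y) ^ 2 - 2 * c * norm (v y) + c ^ 2)"
    by (rule Bochner_Integration.integral_cong) (auto simp: power2_eq_square algebra_simps)
  also have "\<dots> = (LINT y|unif_ball. norm (v y) ^ 2) - 2 * c * c + c ^ 2"
    using i1 i2 by (simp add: c_def measure_unif_ball)
  finally have c2: "c ^ 2 \<le> (LINT y|unif_ball. norm (v y) ^ 2)" by (simp add: power2_eq_square)
  have "norm (LINT y|unif_ball. v y) \<le> c" unfolding c_def by (rule integral_norm_bound)
  then have le: "norm (LINT y|unif_ball. v y) ^ 2 \<le> (LINT y|unif_ball. norm (v y) ^ 2)"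
    using c2 power_mono[of "norm (LINT y|unif_ball. v y)" c 2] by simp
  moreover have nn: "(\<integral>\<^sup>+y. ennreal (norm (v y) ^ 2) \<partial>unif_ball) = ennreal (LINT y|unif_ball. norm (v y) ^ 2)"
    by (rule nn_integral_eq_integral[OF i2]) simp
  ultimately show "ennreal (norm (LINT y|unif_ball. v y) ^ 2) \<le> (\<integral>\<^sup>+y. ennreal (norm (v y) ^ 2) \<partial>unif_ball)"
    by (simp add: ennreal_leI)
  have "(LINT y|unif_ball. norm (v y) ^ 2) \<le> b"
    using fin assms(3) unfolding nn by (simp add: ennreal_le_iff)
  then show "norm (LINT y|unif_ball. v y) \<le> sqrt b"
    using le by (intro real_le_rsqrt) simp
qed

definition avg :: "real \<Rightarrow> (real^3 \<Rightarrow> complex^4) \<Rightarrow> real^3 \<Rightarrow> complex^4" where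
  "avg r f x = (LINT y|unif_ball. f (x + r *\<^sub>R y))"

lemma avg_facts:
  assumes f: "sq_int f" and r: "r > 0"
  shows "integrable unif_ball (\<lambda>y. f (x + r *\<^sub>R y))"
    "norm (avg r f x) \<le> norm (l2_of f) / (sqrt ball_vol * r * sqrt r)"
    "(\<integral>\<^sup>+y. ennreal (norm (f (x + r *\<^sub>R y)) ^ 2) \<partial>unif_ball) \<le> ennreal (norm (l2_of f) ^ 2 / (ball_vol * r ^ 3))"
proof -
  have [measurable]: "f \<in> borel_measurable borel" using f by (simp add: sq_int_def)
  have "(\<integral>\<^sup>+y. ennreal (norm (f (x + r *\<^sub>R y)) ^ 2) \<partial>unif_ball)
     \<le> (\<integral>\<^sup>+y. ennreal (norm (f y) ^ 2) \<partial>lborel) / ennreal (ball_vol * r ^ 3)"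
    by (rule nn_integral_unif_ball_le[where f = "\<lambda>z. ennreal (norm (f z) ^ 2)"]) (use r in auto)
  also have "\<dots> = ennreal (norm (l2_of f) ^ 2 / (ball_vol * r ^ 3))"
    unfolding nn_norm_l2_of[OF f] using r ball_vol_pos by (intro divide_ennreal) auto
  finally show b: "(\<integral>\<^sup>+y. ennreal (norm (f (x + r *\<^sub>R y)) ^ 2) \<partial>unif_ball) \<le> ennreal (norm (l2_of f) ^ 2 / (ball_vol * r ^ 3))" .
  have nn: "norm (l2_of f) ^ 2 / (ball_vol * r ^ 3) \<ge> 0" using r ball_vol_pos by simp
  show "integrable unif_ball (\<lambda>y. f (x + r *\<^sub>R y))"
    by (rule jensen_sq(1)[OF _ b nn]) measurable
  have "norm (avg r f x) \<le> sqrt (norm (l2_of f) ^ 2 / (ball_vol * r ^ 3))"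
    unfolding avg_def by (rule jensen_sq(3)[OF _ b nn]) measurable
  also have "\<dots> = norm (l2_of f) / (sqrt ball_vol * r * sqrt r)"
    using r by (simp add: real_sqrt_divide real_sqrt_mult power3_eq_cube)
  finally show "norm (avg r f x) \<le> norm (l2_of f) / (sqrt ball_vol * r * sqrt r)" .
qed

lemma l2_of_shift_diff:
  assumes "sq_int f"
  shows "sq_int (\<lambda>x. f (x + h) - f x)" "l2_of (\<lambda>x. f (x + h) - f x) = shift h (l2_of f) - l2_of f"
proof -
  have "sq_int (\<lambda>x. f (x + h) + (- 1) *\<^sub>R f x)"
    by (intro sq_int_plus sq_int_shift assms sq_int_bounded[OF assms, of _ 1]) (use assms in \<open>auto simp: sq_int_def\<close>)
  then show "sq_int (\<lambda>x. f (x + h) - f x)" by simp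
  show "l2_of (\<lambda>x. f (x + h) - f x) = shift h (l2_of f) - l2_of f"
    by (simp add: l2_of_minus shift_l2_of sq_int_shift assms)
qed

lemma avg_shift:
  assumes f: "sq_int f" and r: "r > 0"
  shows "norm (avg r f (x + h) - avg r f x) \<le> norm (shift h (l2_of f) - l2_of f) / (sqrt ball_vol * r * sqrt r)"
proof -
  have "avg r f (x + h) - avg r f x = (LINT y|unif_ball. f (x + h + r *\<^sub>R y) - f (x + r *\<^sub>R y))"
    unfolding avg_def by (subst Bochner_Integration.integral_diff) (auto intro: avg_facts(1)[OF f r])
  also have "\<dots> = avg r (\<lambda>z. f (z + h) - f z) x"
    unfolding avg_def by (simp add: add_ac)
  finally show ?thesis
    using avg_facts(2)[OF l2_of_shift_diff(1)[OF f] r] by (simp add: l2_of_shift_diff(2)[OF f])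
qed

lemma avg_measurable:
  assumes f[measurable]: "f \<in> borel_measurable borel"
  shows "avg r f \<in> borel_measurable borel"
proof -
  interpret sigma_finite_measure unif_ball by (rule sigma_finite_unif_ball)
  have "(\<lambda>(x, y). f (x + r *\<^sub>R y)) \<in> borel_measurable (borel \<Otimes>\<^sub>M unif_ball)"
    by measurable
  then show ?thesis
    unfolding avg_def by (rule borel_measurable_lebesgue_integral)
qed

text \<open>By \<open>shift_norm_kinetic\<close>, Sobolev fields satisfy this with \<open>L = \<parallel>\<alpha> \<cdot> D f\<parallel>\<close>.\<close>

definition shift_lipschitz :: "(real^3 \<Rightarrow> complex^4) \<Rightarrow> real \<Rightarrow> bool" where
  "shift_lipschitz f L \<longleftrightarrow> sq_int f \<and> L \<ge> 0 \<and> (\<forall>h. norm (shift h (l2_of f) - l2_of f) \<le> one_norm h * L)"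

lemma one_norm_ball: assumes "y \<in> cball 0 1" "r \<ge> 0" shows "one_norm (r *\<^sub>R y) \<le> 3 * r"
proof -
  have "\<bar>y $ j\<bar> \<le> 1" for j using component_le_norm_cart[of y j] assms by auto
  then have "r * \<bar>y $ j\<bar> \<le> r" for j using assms(2) by (simp add: mult_left_le)
  from this[of 1] this[of 2] this[of 3] show ?thesis using assms(2) by (simp add: one_norm_def sum_3 abs_mult)
qed

text \<open>Averaging the averages over a further ball of radius \<open>s\<close> changes them little, since
  each translate of an average differs from it by at most the \<open>L\<^sup>2\<close> distance of the translates, divided by
  the square root of the volume.\<close>

lemma avg_avg_close:
  assumes "shift_lipschitz f L" "r > 0" "s > 0"
  shows "norm ((LINT y|unif_ball. avg r f (x + s *\<^sub>R y)) - avg r f x) \<le> 3 * s * L / (sqrt ball_vol * r * sqrt r)"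
    "integrable unif_ball (\<lambda>y. avg r f (x + s *\<^sub>R y))"
proof -
  interpret finite_measure unif_ball by (rule finite_measure_unif_ball)
  have f: "sq_int f" and L: "L \<ge> 0" using assms(1) by (auto simp: shift_lipschitz_def)
  have fm [measurable]: "f \<in> borel_measurable borel" using f by (simp add: sq_int_def)
  note avg_measurable[OF fm, measurable]
  show i: "integrable unif_ball (\<lambda>y. avg r f (x + s *\<^sub>R y))"
    by (rule integrable_const_bound[where B = "norm (l2_of f) / (sqrt ball_vol * r * sqrt r)"])
      (use avg_facts(2)[OF f assms(2)] in auto)
  have "(LINT y|unif_ball. avg r f (x + s *\<^sub>R y)) - avg r f x = (LINT y|unif_ball. avg r f (x + s *\<^sub>R y) - avg r f x)"
    using i by (simp add: measure_unif_ball)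
  also have "norm \<dots> \<le> (LINT y|unif_ball. norm (avg r f (x + s *\<^sub>R y) - avg r f x))"
    by (rule integral_norm_bound)
  also have "\<dots> \<le> (LINT y|unif_ball. 3 * s * L / (sqrt ball_vol * r * sqrt r))"
  proof (rule integral_mono_AE)
    show "AE y in unif_ball. norm (avg r f (x + s *\<^sub>R y) - avg r f x) \<le> 3 * s * L / (sqrt ball_vol * r * sqrt r)"
      using AE_unif_ball
    proof eventually_elim
      case (elim y)
      have "norm (shift (s *\<^sub>R y) (l2_of f) - l2_of f) \<le> one_norm (s *\<^sub>R y) * L" using assms(1) by (simp add: shift_lipschitz_def)
      also have "\<dots> \<le> 3 * s * L" using one_norm_ball[OF elim, of s] assms(3) L by (intro mult_right_mono) auto
      finally show ?case
        using assms(2) ball_vol_pos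
        by (intro order_trans[OF avg_shift[OF f assms(2)]] divide_right_mono) auto
    qed
  qed (use i in auto)
  finally show "norm ((LINT y|unif_ball. avg r f (x + s *\<^sub>R y)) - avg r f x) \<le> 3 * s * L / (sqrt ball_vol * r * sqrt r)"
    by (simp add: measure_unif_ball)
qed

lemma avg_avg_commute:
  assumes f: "sq_int f" and "r > 0" "s > 0"
  shows "(LINT y|unif_ball. avg r f (x + s *\<^sub>R y)) = (LINT y|unif_ball. avg s f (x + r *\<^sub>R y))"
proof -
  interpret finite_measure unif_ball by (rule finite_measure_unif_ball)
  interpret pair_sigma_finite unif_ball unif_ball by unfold_locales
  have [measurable]: "f \<in> borel_measurable borel" using f by (simp add: sq_int_def)
  let ?F = "\<lambda>(y, z). f (x + s *\<^sub>R y + r *\<^sub>R z)"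
  let ?B = "norm (l2_of f) ^ 2 / (ball_vol * r ^ 3)"
  have B: "?B \<ge> 0" using ball_vol_pos assms by simp
  have "(\<integral>\<^sup>+p. ennreal (norm (?F p)) \<partial>(unif_ball \<Otimes>\<^sub>M unif_ball)) \<le> (\<integral>\<^sup>+p. 1 + ennreal (norm (?F p) ^ 2) \<partial>(unif_ball \<Otimes>\<^sub>M unif_ball))"
  proof (rule nn_integral_mono)
    fix p
    have "norm (?F p) \<le> 1 + norm (?F p) ^ 2"
      using sum_squares_bound[of 1 "norm (?F p)"] norm_ge_zero[of "?F p"]
      unfolding power_one mult_1_right by linarith
    then have "ennreal (norm (?F p)) \<le> ennreal (1 + norm (?F p) ^ 2)"
      by (rule ennreal_leI)
    also have "\<dots> = 1 + ennreal (norm (?F p) ^ 2)"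
      by (subst ennreal_plus) simp_all
    finally show "ennreal (norm (?F p)) \<le> 1 + ennreal (norm (?F p) ^ 2)" .
  qed
  also have "\<dots> = (\<integral>\<^sup>+y. (\<integral>\<^sup>+z. 1 + ennreal (norm (f (x + s *\<^sub>R y + r *\<^sub>R z)) ^ 2) \<partial>unif_ball) \<partial>unif_ball)"
    using sigma_finite_measure.nn_integral_fst[OF sigma_finite_unif_ball, of "\<lambda>p. 1 + ennreal (norm (?F p) ^ 2)" unif_ball]
    by simp
  also have "\<dots> \<le> (\<integral>\<^sup>+y. 1 + ennreal ?B \<partial>unif_ball)"
  proof (rule nn_integral_mono)
    fix y
    have "(\<integral>\<^sup>+z. 1 + ennreal (norm (f (x + s *\<^sub>R y + r *\<^sub>R z)) ^ 2) \<partial>unif_ball) = 1 + (\<integral>\<^sup>+z. ennreal (norm (f (x + s *\<^sub>R y + r *\<^sub>R z)) ^ 2) \<partial>unif_ball)"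
      by (subst nn_integral_add) (auto simp: emeasure_unif_ball)
    also have "\<dots> \<le> 1 + ennreal ?B"
      by (intro add_left_mono avg_facts(3)[OF f assms(2)])
    finally show "(\<integral>\<^sup>+z. 1 + ennreal (norm (f (x + s *\<^sub>R y + r *\<^sub>R z)) ^ 2) \<partial>unif_ball) \<le> 1 + ennreal ?B" .
  qed
  also have "\<dots> < \<infinity>" by (simp add: emeasure_unif_ball)
  finally have i: "integrable (unif_ball \<Otimes>\<^sub>M unif_ball) ?F"
    by (intro integrableI_bounded) (auto simp: case_prod_beta)
  have "(LINT y|unif_ball. avg r f (x + s *\<^sub>R y)) = (LINT y|unif_ball. LINT z|unif_ball. f (x + s *\<^sub>R y + r *\<^sub>R z))"
    by (simp add: avg_def)
  also have "\<dots> = (LINT z|unif_ball. LINT y|unif_ball. f (x + s *\<^sub>R y + r *\<^sub>R z))"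
    using Fubini_integral[OF i] by simp
  also have "\<dots> = (LINT y|unif_ball. avg s f (x + r *\<^sub>R y))"
    by (simp add: avg_def add_ac)
  finally show ?thesis .
qed

text \<open>The two averages are compared with the iterated average, which by Fubini can be read as an average of
  either one.\<close>

lemma avg_double:
  assumes "shift_lipschitz f L" "r > 0"
  shows "norm (avg r f x - avg (2 * r) f x) \<le> 8 * L / (sqrt ball_vol * sqrt r)"
proof -
  have f: "sq_int f" and L: "L \<ge> 0" using assms(1) by (auto simp: shift_lipschitz_def)
  let ?I = "LINT y|unif_ball. avg r f (x + (2 * r) *\<^sub>R y)"
  have r2: "2 * r > 0" using assms by simp
  have 1: "norm (?I - avg r f x) \<le> 6 * L / (sqrt ball_vol * sqrt r)"
    using avg_avg_close(1)[OF assms(1,2) r2, of x] assms(2) by (simp add: field_simps)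
  have "?I = (LINT y|unif_ball. avg (2 * r) f (x + r *\<^sub>R y))"
    by (rule avg_avg_commute[OF f assms(2) r2])
  then have "norm (?I - avg (2 * r) f x) \<le> 3 * r * L / (sqrt ball_vol * (2 * r) * sqrt (2 * r))"
    using avg_avg_close(1)[OF assms(1) r2 assms(2), of x] by simp
  also have "\<dots> \<le> 3 * r * L / (sqrt ball_vol * (2 * r) * sqrt r)"
    using assms(2) L ball_vol_pos by (intro divide_left_mono mult_left_mono) auto
  also have "\<dots> \<le> 2 * L / (sqrt ball_vol * sqrt r)"
    using assms(2) L ball_vol_pos by (simp add: field_simps)
  finally have 2: "norm (?I - avg (2 * r) f x) \<le> 2 * L / (sqrt ball_vol * sqrt r)" .
  have "norm (avg r f x - avg (2 * r) f x) \<le> norm (?I - avg (2 * r) f x) + norm (?I - avg r f x)"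
    using norm_triangle_ineq4[of "?I - avg (2 * r) f x" "?I - avg r f x"] by simp
  moreover have "6 * L / (sqrt ball_vol * sqrt r) + 2 * L / (sqrt ball_vol * sqrt r) = 8 * L / (sqrt ball_vol * sqrt r)"
    by (simp add: add_divide_distrib[symmetric])
  ultimately show ?thesis using 1 2 by linarith
qed

text \<open>The differences between the averages at consecutive dyadic scales are dominated by a geometric
  series, and the averages at very large scales vanish because \<open>f\<close> is square integrable.\<close>

lemma avg_bound:
  assumes "shift_lipschitz f L" "r > 0"
  shows "norm (avg r f x) \<le> 32 * L / (sqrt ball_vol * sqrt r)"
proof -
  have f: "sq_int f" and L: "L \<ge> 0" using assms(1) by (auto simp: shift_lipschitz_def)
  define K where "K = 32 * L / sqrt ball_vol"
  have K: "K \<ge> 0" using L ball_vol_pos by (simp add: K_def)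
  \<comment> \<open>A geometric series of ratio \<open>1 / sqrt 2\<close>: since \<open>1 - 1 / sqrt 2 \<ge> 1 / 4\<close>, each of its differences
    is at least \<open>8 L / (sqrt ball_vol * sqrt s)\<close>, the bound from \<open>avg_double\<close>.\<close>
  have aux: "Z \<le> X * (3/4) \<Longrightarrow> Y = Z \<Longrightarrow> e = X * (1/4) \<Longrightarrow> n \<le> e \<Longrightarrow> n \<le> X - Y" for X Y Z e n :: real
    by linarith
  have step: "norm (avg s f x - avg (2 * s) f x) \<le> K / sqrt s - K / sqrt (2 * s)" if "s > 0" for s
  proof -
    have s2: "sqrt 2 \<ge> 4 / 3" by (rule real_le_rsqrt) (simp add: power2_eq_square)
    then have "1 / sqrt 2 \<le> 3 / 4" by (simp add: field_simps)
    then have "K / sqrt s * (1 / sqrt 2) \<le> K / sqrt s * (3 / 4)"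
      using K that by (intro mult_left_mono) auto
    moreover have "K / sqrt (2 * s) = K / sqrt s * (1 / sqrt 2)" by (simp add: real_sqrt_mult)
    moreover have "8 * L / (sqrt ball_vol * sqrt s) = K / sqrt s * (1 / 4)" by (simp add: K_def)
    ultimately show ?thesis using avg_double[OF assms(1) that, of x] 
      by (rule aux)
  qed
  have "norm (avg r f x) \<le> K / sqrt r - K / sqrt (2 ^ n * r) + norm (avg (2 ^ n * r) f x)" for n
  proof (induction n)
    case (Suc n)
    have "norm (avg (2 ^ n * r) f x) \<le> norm (avg (2 * (2 ^ n * r)) f x) + norm (avg (2 ^ n * r) f x - avg (2 * (2 ^ n * r)) f x)"
      by (metis norm_triangle_sub)
    then show ?case using Suc step[of "2 ^ n * r"] assms(2) by (simp add: mult.assoc)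
  qed simp
  then have b: "norm (avg r f x) \<le> K / sqrt r + norm (l2_of f) / (sqrt ball_vol * (2 ^ n * r) * sqrt (2 ^ n * r))" for n
    using avg_facts(2)[OF f, of "2 ^ n * r" x] assms(2) K
    by (smt (verit) divide_nonneg_nonneg mult_pos_pos real_sqrt_ge_zero zero_less_power)
  have "(\<lambda>n. K / sqrt r + norm (l2_of f) / (sqrt ball_vol * (2 ^ n * r) * sqrt (2 ^ n * r))) \<longlonglongrightarrow> K / sqrt r + 0"
  proof (intro tendsto_add tendsto_const)
    have two_pow: "filterlim (\<lambda>n. 2 ^ n :: real) at_top sequentially"
    proof (rule filterlim_at_top_mono[OF filterlim_real_sequentially])
      show "\<forall>\<^sub>F n in sequentially. real n \<le> 2 ^ n"
        by (intro always_eventually allI of_nat_less_two_power[THEN less_imp_le])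
    qed
    have a: "filterlim (\<lambda>n. 2 ^ n * r) at_top sequentially"
      using assms(2) by (intro filterlim_at_top_mult_tendsto_pos[OF tendsto_const] two_pow) simp
    have "filterlim (\<lambda>n. sqrt ball_vol * (2 ^ n * r) * sqrt (2 ^ n * r)) at_top sequentially"
      using ball_vol_pos by (intro filterlim_at_top_mult_at_top filterlim_tendsto_pos_mult_at_top[OF tendsto_const _ a]
         filterlim_compose[OF sqrt_at_top a]) auto
    then show "(\<lambda>n. norm (l2_of f) / (sqrt ball_vol * (2 ^ n * r) * sqrt (2 ^ n * r))) \<longlonglongrightarrow> 0"
      by (intro tendsto_divide_0[OF tendsto_const] filterlim_at_top_imp_at_infinity)
  qed
  from LIMSEQ_le_const[OF this] b have "norm (avg r f x) \<le> K / sqrt r" by auto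
  then show ?thesis by (simp add: K_def)
qed

section \<open>Second differences and the square function estimate\<close>

lemma lborel_uminus: "distr lborel borel uminus = (lborel :: (real^3) measure)"
  using lborel_affine[of "-1" "0 :: real^3"] by (simp add: density_1)

lemma unif_ball_uminus: "distr unif_ball borel uminus = unif_ball"
proof (rule measure_eqI)
  fix A assume "A \<in> sets (distr unif_ball borel uminus)"
  then have A[measurable]: "A \<in> sets borel" by simp
  let ?f = "\<lambda>y::real^3. indicator A y * indicator (cball 0 1) y :: ennreal"
  have fm: "?f \<in> borel_measurable borel"
    unfolding indicator_inter_arith[symmetric] by (rule borel_measurable_indicator) simp
  have "emeasure (distr unif_ball borel uminus) A = (\<integral>\<^sup>+y. indicator A y \<partial>distr unif_ball borel uminus)"
    by simp
  also have "\<dots> = (\<integral>\<^sup>+y. indicator A (- y) \<partial>unif_ball)"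
    by (rule nn_integral_distr) (auto simp: measurable_cong_sets[OF sets_unif_ball refl])
  also have "\<dots> = (\<integral>\<^sup>+y. ?f (- y) \<partial>lborel) / ennreal ball_vol"
    by (subst nn_integral_unif_ball) (auto simp: indicator_def)
  also have "(\<integral>\<^sup>+y. ?f (- y) \<partial>lborel) = (\<integral>\<^sup>+y. ?f y \<partial>distr lborel borel uminus)"
    by (rule nn_integral_distr[symmetric]) (use fm in auto)
  also have "\<dots> / ennreal ball_vol = (\<integral>\<^sup>+y. indicator A y \<partial>unif_ball)"
    by (subst nn_integral_unif_ball) (auto simp: lborel_uminus)
  finally show "emeasure (distr unif_ball borel uminus) A = emeasure unif_ball A" by simp
qed simp

lemma integral_unif_ball_uminus:
  fixes f :: "real^3 \<Rightarrow> complex^4"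
  assumes [measurable]: "f \<in> borel_measurable borel"
  shows "(LINT y|unif_ball. f (- y)) = (LINT y|unif_ball. f y)"
        "integrable unif_ball (\<lambda>y. f (- y)) \<longleftrightarrow> integrable unif_ball f"
proof -
  have m: "uminus \<in> unif_ball \<rightarrow>\<^sub>M borel" by (simp add: measurable_cong_sets[OF sets_unif_ball refl])
  have "(LINT y|unif_ball. f y) = (LINT y|distr unif_ball borel uminus. f y)" by (simp add: unif_ball_uminus)
  also have "\<dots> = (LINT y|unif_ball. f (- y))" by (rule integral_distr[OF m]) simp
  finally show "(LINT y|unif_ball. f (- y)) = (LINT y|unif_ball. f y)" by simp
  show "integrable unif_ball (\<lambda>y. f (- y)) \<longleftrightarrow> integrable unif_ball f"
    using integrable_distr_eq[OF m, of f] by (simp add: unif_ball_uminus)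
qed

definition shift_dist2 :: "l2 \<Rightarrow> real^3 \<Rightarrow> real" where
  "shift_dist2 u h = norm (shift h u - u) ^ 2"

text \<open>The parallelogram law for the two first differences, whose sum is a translate of the first
  difference with step \<open>2 h\<close>.\<close>

lemma second_difference_norm:
  "norm (shift h u + shift (- h) u - 2 *\<^sub>R u) ^ 2 = 4 * shift_dist2 u h - shift_dist2 u (2 *\<^sub>R h)"
proof -
  let ?X = "shift h u - u" and ?Y = "u - shift (- h) u"
  have X: "?X = shift h ?Y" by (simp add: shift_diff shift_shift)
  have "?X + ?Y = shift (- h) (shift (2 *\<^sub>R h) u - u)"
    by (simp add: shift_diff shift_shift scaleR_2)
  then have s: "norm (?X + ?Y) ^ 2 = shift_dist2 u (2 *\<^sub>R h)" by (simp add: shift_dist2_def)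
  have Y: "norm ?Y ^ 2 = shift_dist2 u h" unfolding shift_dist2_def X norm_shift ..
  have "norm (?X - ?Y) ^ 2 = 2 * norm ?X ^ 2 + 2 * norm ?Y ^ 2 - norm (?X + ?Y) ^ 2"
    by (simp add: power2_norm_eq_inner inner_add_left inner_add_right inner_diff_left inner_diff_right
       inner_commute algebra_simps)
  moreover have "?X - ?Y = shift h u + shift (- h) u - 2 *\<^sub>R u" by (simp add: scaleR_2)
  ultimately show ?thesis using s Y by (simp add: shift_dist2_def)
qed

lemma shift_dist2_double: "shift_dist2 u (2 *\<^sub>R h) \<le> 4 * shift_dist2 u h"
  using second_difference_norm[of h u] zero_le_power2[of "norm (shift h u + shift (- h) u - 2 *\<^sub>R u)"]
  by linarith

definition second_diff :: "real \<Rightarrow> (real^3 \<Rightarrow> complex^4) \<Rightarrow> real^3 \<Rightarrow> real^3 \<Rightarrow> complex^4" where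
  "second_diff r f x y = f (x + r *\<^sub>R y) + f (x + r *\<^sub>R (- y)) - 2 *\<^sub>R f x"

lemma second_diff_measurable [measurable]:
  assumes [measurable]: "f \<in> borel_measurable borel"
  shows "(\<lambda>p. second_diff r f (fst p) (snd p)) \<in> borel_measurable (lborel \<Otimes>\<^sub>M unif_ball)"
    "(\<lambda>y. second_diff r f x y) \<in> borel_measurable borel" "(\<lambda>x. second_diff r f x y) \<in> borel_measurable borel"
  unfolding second_diff_def by measurable

lemma nn_second_diff:
  assumes f: "sq_int f"
  shows "(\<integral>\<^sup>+x. ennreal (norm (second_diff r f x y) ^ 2) \<partial>lborel) = ennreal (4 * shift_dist2 (l2_of f) (r *\<^sub>R y) - shift_dist2 (l2_of f) ((2 * r) *\<^sub>R y))"
proof -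
  have s1: "sq_int (\<lambda>x. f (x + r *\<^sub>R y))" "sq_int (\<lambda>x. f (x + r *\<^sub>R (- y)))"
    by (simp_all add: sq_int_shift f del: scaleR_minus_right)
  have s2: "sq_int (\<lambda>x. (- 2) *\<^sub>R f x)"
    by (rule sq_int_bounded[OF f, of _ 2]) (use f in \<open>auto simp: sq_int_def\<close>)
  have eq: "second_diff r f x y = f (x + r *\<^sub>R y) + f (x + r *\<^sub>R (- y)) + (- 2) *\<^sub>R f x" for x
    by (simp add: second_diff_def)
  have sq: "sq_int (\<lambda>x. second_diff r f x y)"
    unfolding eq by (intro sq_int_plus s1 s2)
  have "l2_of (\<lambda>x. second_diff r f x y) = shift (r *\<^sub>R y) (l2_of f) + shift (r *\<^sub>R (- y)) (l2_of f) + (- 2) *\<^sub>R l2_of f"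
    unfolding eq by (simp only: l2_of_plus s1 s2 sq_int_plus shift_l2_of f l2_of_scaleR)
  also have "\<dots> = shift (r *\<^sub>R y) (l2_of f) + shift (- (r *\<^sub>R y)) (l2_of f) - 2 *\<^sub>R l2_of f"
    by simp
  finally show ?thesis
    by (simp add: nn_norm_l2_of[OF sq] second_difference_norm)
qed

text \<open>The ball is symmetric, so the first order part of \<open>f(x + r y) - f x\<close> cancels under the average.\<close>

lemma sub_avg_eq:
  assumes f: "sq_int f" and r: "r > 0"
  shows "f x - avg r f x = (- 1 / 2) *\<^sub>R (LINT y|unif_ball. second_diff r f x y)"
proof -
  have [measurable]: "f \<in> borel_measurable borel" using f by (simp add: sq_int_def)
  interpret finite_measure unif_ball by (rule finite_measure_unif_ball)
  have i: "integrable unif_ball (\<lambda>y. f (x + r *\<^sub>R y))" by (rule avg_facts(1)[OF f r])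
  have i': "integrable unif_ball (\<lambda>y. f (x + r *\<^sub>R (- y)))"
    using integral_unif_ball_uminus(2)[of "\<lambda>y. f (x + r *\<^sub>R y)"] i by simp
  have e: "(LINT y|unif_ball. f (x + r *\<^sub>R (- y))) = avg r f x"
    unfolding avg_def using integral_unif_ball_uminus(1)[of "\<lambda>y. f (x + r *\<^sub>R y)"] by simp
  have "(LINT y|unif_ball. second_diff r f x y) = (LINT y|unif_ball. f (x + r *\<^sub>R y)) + (LINT y|unif_ball. f (x + r *\<^sub>R (- y))) - (LINT y|unif_ball. 2 *\<^sub>R f x)"
    unfolding second_diff_def using i i' 
    by (subst Bochner_Integration.integral_diff Bochner_Integration.integral_add; simp)+
  also have "\<dots> = 2 *\<^sub>R avg r f x - 2 *\<^sub>R f x"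
    unfolding e by (simp add: avg_def[symmetric] measure_unif_ball scaleR_2)
  finally show ?thesis by (simp add: scaleR_diff_right)
qed

text \<open>Jensen's inequality followed by Tonelli's theorem and the parallelogram law.\<close>

lemma nn_sub_avg:
  assumes f: "sq_int f" and r: "r > 0"
  shows "(\<integral>\<^sup>+x. ennreal (norm (f x - avg r f x) ^ 2) \<partial>lborel)
    \<le> (\<integral>\<^sup>+y. ennreal (shift_dist2 (l2_of f) (r *\<^sub>R y) - shift_dist2 (l2_of f) ((2 * r) *\<^sub>R y) / 4) \<partial>unif_ball)"
    "(\<lambda>y. ennreal (shift_dist2 (l2_of f) (r *\<^sub>R y) - shift_dist2 (l2_of f) ((2 * r) *\<^sub>R y) / 4)) \<in> borel_measurable unif_ball"
proof -
  have fm[measurable]: "f \<in> borel_measurable borel" using f by (simp add: sq_int_def)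
  interpret finite_measure unif_ball by (rule finite_measure_unif_ball)
  interpret pair_sigma_finite lborel unif_ball by unfold_locales
  have pt: "ennreal (norm (f x - avg r f x) ^ 2) \<le> (\<integral>\<^sup>+y. ennreal (norm (second_diff r f x y) ^ 2 / 4) \<partial>unif_ball)" for x
  proof -
    define V where "V = (\<integral>\<^sup>+y. ennreal (norm (second_diff r f x y) ^ 2) \<partial>unif_ball)"
    have q: "(\<integral>\<^sup>+y. ennreal (norm (second_diff r f x y) ^ 2 / 4) \<partial>unif_ball) = V / 4"
      unfolding V_def by (subst nn_integral_divide[symmetric]) (auto simp: divide_ennreal[symmetric])
    show ?thesis
    proof (cases "V = \<infinity>")
      case True
      then show ?thesis unfolding q by (simp add: ennreal_top_divide)
    next
      case False
      then obtain b where b: "b \<ge> 0" "V = ennreal b" by (cases V) auto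
      have "norm (f x - avg r f x) ^ 2 = norm (LINT y|unif_ball. second_diff r f x y) ^ 2 / 4"
        unfolding sub_avg_eq[OF f r] by (simp add: power_divide)
      then have "ennreal (norm (f x - avg r f x) ^ 2) = ennreal (norm (LINT y|unif_ball. second_diff r f x y) ^ 2) / 4"
        using divide_ennreal[of "norm (LINT y|unif_ball. second_diff r f x y) ^ 2" 4] by simp
      moreover have "ennreal (norm (LINT y|unif_ball. second_diff r f x y) ^ 2) \<le> V"
        unfolding V_def by (rule jensen_sq(2)[of _ b]) (use b in \<open>auto simp: V_def[symmetric]\<close>)
      ultimately show ?thesis unfolding q
        using divide_right_mono_ennreal[of _ V 4] by simp
    qed
  qed
  have Q: "(\<integral>\<^sup>+x. ennreal (norm (second_diff r f x y) ^ 2 / 4) \<partial>lborel) = ennreal (shift_dist2 (l2_of f) (r *\<^sub>R y) - shift_dist2 (l2_of f) ((2 * r) *\<^sub>R y) / 4)" for y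
  proof -
    have "(\<integral>\<^sup>+x. ennreal (norm (second_diff r f x y) ^ 2 / 4) \<partial>lborel) = (\<integral>\<^sup>+x. ennreal (norm (second_diff r f x y) ^ 2) \<partial>lborel) / 4"
      by (subst nn_integral_divide[symmetric]) (auto simp: divide_ennreal[symmetric])
    also have "\<dots> = ennreal ((4 * shift_dist2 (l2_of f) (r *\<^sub>R y) - shift_dist2 (l2_of f) ((2 * r) *\<^sub>R y)) / 4)"
    proof -
      have "4 * shift_dist2 (l2_of f) (r *\<^sub>R y) - shift_dist2 (l2_of f) ((2 * r) *\<^sub>R y) \<ge> 0"
        using shift_dist2_double[of "l2_of f" "r *\<^sub>R y"] by simp
      then show ?thesis by (simp add: nn_second_diff[OF f] divide_ennreal[symmetric])
    qed
    finally show ?thesis by (simp add: diff_divide_distrib)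
  qed
  have m: "(\<lambda>(x, y). ennreal (norm (second_diff r f x y) ^ 2 / 4)) \<in> borel_measurable (lborel \<Otimes>\<^sub>M unif_ball)"
    unfolding case_prod_beta by measurable
  have "(\<integral>\<^sup>+x. ennreal (norm (f x - avg r f x) ^ 2) \<partial>lborel) \<le> (\<integral>\<^sup>+x. (\<integral>\<^sup>+y. ennreal (norm (second_diff r f x y) ^ 2 / 4) \<partial>unif_ball) \<partial>lborel)"
    by (intro nn_integral_mono pt)
  also have "\<dots> = (\<integral>\<^sup>+y. (\<integral>\<^sup>+x. ennreal (norm (second_diff r f x y) ^ 2 / 4) \<partial>lborel) \<partial>unif_ball)"
    using Fubini'[OF m] by simp
  finally show "(\<integral>\<^sup>+x. ennreal (norm (f x - avg r f x) ^ 2) \<partial>lborel)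
    \<le> (\<integral>\<^sup>+y. ennreal (shift_dist2 (l2_of f) (r *\<^sub>R y) - shift_dist2 (l2_of f) ((2 * r) *\<^sub>R y) / 4) \<partial>unif_ball)"
    unfolding Q .
  have "(\<lambda>(y, x). ennreal (norm (second_diff r f x y) ^ 2 / 4)) \<in> borel_measurable (unif_ball \<Otimes>\<^sub>M lborel)"
    using measurable_pair_swap[OF m] by (simp add: case_prod_beta)
  from lborel.borel_measurable_nn_integral[OF this]
  show "(\<lambda>y. ennreal (shift_dist2 (l2_of f) (r *\<^sub>R y) - shift_dist2 (l2_of f) ((2 * r) *\<^sub>R y) / 4)) \<in> borel_measurable unif_ball"
    unfolding Q .
qed

text \<open>Sums over dyadic scales. With \<open>d(h) = \<parallel>f(\<cdot> + h) - f\<parallel>\<^sup>2\<close>, the weight \<open>4\<^sup>-\<^sup>i\<close> turns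
  \<open>d(2\<^sup>i r y) - d(2\<^sup>i\<^sup>+\<^sup>1 r y) / 4\<close> into a telescoping sum whose first term is at most \<open>(3 r L)\<^sup>2\<close>.\<close>

lemma square_function_bound:
  assumes "shift_lipschitz f L" and r: "r > 0"
  shows "(\<Sum>i<n. ennreal (1 / (2 ^ i * r) ^ 2) * (\<integral>\<^sup>+x. ennreal (norm (f x - avg (2 ^ i * r) f x) ^ 2) \<partial>lborel))
     \<le> ennreal (9 * L ^ 2)"
proof -
  have f: "sq_int f" and L: "L \<ge> 0" using assms(1) by (auto simp: shift_lipschitz_def)
  interpret finite_measure unif_ball by (rule finite_measure_unif_ball)
  let ?q = "\<lambda>i y. shift_dist2 (l2_of f) ((2 ^ i * r) *\<^sub>R y) - shift_dist2 (l2_of f) ((2 * (2 ^ i * r)) *\<^sub>R y) / 4"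
  have qnn: "?q i y \<ge> 0" for i y
    using shift_dist2_double[of "l2_of f" "(2 ^ i * r) *\<^sub>R y"] by (simp add: mult.assoc)
  have ri: "2 ^ i * r > 0" for i using r by simp
  have tel: "(\<Sum>i<n. 1 / (2 ^ i * r) ^ 2 * ?q i y) = (1 / r ^ 2) * (shift_dist2 (l2_of f) (r *\<^sub>R y) - shift_dist2 (l2_of f) ((2 ^ n * r) *\<^sub>R y) / 4 ^ n)" for y
  proof (induction n)
    case (Suc n)
    have "((2::real) ^ n)\<^sup>2 = 4 ^ n"
      by (simp add: power2_eq_square flip: power_mult_distrib)
    then have "(2 ^ n * r)\<^sup>2 = 4 ^ n * r\<^sup>2" by (simp add: power_mult_distrib)
    then show ?case using Suc r by (simp add: field_simps)
  qed simp
  have "(\<Sum>i<n. ennreal (1 / (2 ^ i * r) ^ 2) * (\<integral>\<^sup>+x. ennreal (norm (f x - avg (2 ^ i * r) f x) ^ 2) \<partial>lborel))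
     \<le> (\<Sum>i<n. ennreal (1 / (2 ^ i * r) ^ 2) * (\<integral>\<^sup>+y. ennreal (?q i y) \<partial>unif_ball))"
    by (intro sum_mono mult_left_mono nn_sub_avg(1)[OF f ri]) simp
  also have "\<dots> = (\<integral>\<^sup>+y. (\<Sum>i<n. ennreal (1 / (2 ^ i * r) ^ 2) * ennreal (?q i y)) \<partial>unif_ball)"
    using nn_sub_avg(2)[OF f ri] by (simp add: nn_integral_sum nn_integral_cmult)
  also have "\<dots> \<le> (\<integral>\<^sup>+y. ennreal (9 * L ^ 2) \<partial>unif_ball)"
  proof (rule nn_integral_mono_AE)
    show "AE y in unif_ball. (\<Sum>i<n. ennreal (1 / (2 ^ i * r) ^ 2) * ennreal (?q i y)) \<le> ennreal (9 * L ^ 2)"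
      using AE_unif_ball
    proof eventually_elim
      case (elim y)
      have "(\<Sum>i<n. ennreal (1 / (2 ^ i * r) ^ 2) * ennreal (?q i y)) = ennreal (\<Sum>i<n. 1 / (2 ^ i * r) ^ 2 * ?q i y)"
        using qnn by (simp add: ennreal_mult[symmetric] sum_ennreal)
      also have "\<dots> \<le> ennreal (9 * L ^ 2)"
      proof (rule ennreal_leI)
        have "norm (shift (r *\<^sub>R y) (l2_of f) - l2_of f) \<le> one_norm (r *\<^sub>R y) * L" using assms(1) by (simp add: shift_lipschitz_def)
        also have "\<dots> \<le> 3 * r * L" using one_norm_ball[OF elim, of r] r L by (intro mult_right_mono) auto
        finally have "shift_dist2 (l2_of f) (r *\<^sub>R y) \<le> (3 * r * L) ^ 2" unfolding shift_dist2_def by (rule power_mono) simp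
        moreover have "shift_dist2 (l2_of f) ((2 ^ n * r) *\<^sub>R y) / 4 ^ n \<ge> 0" by (simp add: shift_dist2_def)
        ultimately have "(1 / r ^ 2) * (shift_dist2 (l2_of f) (r *\<^sub>R y) - shift_dist2 (l2_of f) ((2 ^ n * r) *\<^sub>R y) / 4 ^ n) \<le> (1 / r ^ 2) * (3 * r * L) ^ 2"
          by (intro mult_left_mono) auto
        also have "\<dots> = 9 * L ^ 2" using r by (simp add: power_mult_distrib)
        finally show "(\<Sum>i<n. 1 / (2 ^ i * r) ^ 2 * ?q i y) \<le> 9 * L ^ 2" unfolding tel .
      qed
      finally show ?case .
    qed
  qed
  also have "\<dots> = ennreal (9 * L ^ 2)" by (simp add: emeasure_unif_ball)
  finally show ?thesis .
qed

section \<open>Integrability of the density of a Bessel family\<close>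

text \<open>The hypothesis under which \<open>\<integral> \<rho>\<^sup>3\<close> is estimated: all combinations are Lipschitz under translation with
  the Euclidean norm of the coefficients as constant, as happens when the gradients are orthonormal.\<close>

definition shift_bessel :: "nat \<Rightarrow> (nat \<Rightarrow> l2) \<Rightarrow> bool" where
  "shift_bessel n u \<longleftrightarrow> (\<forall>c h. norm (shift h (\<Sum>i<n. c i *\<^sub>R u i) - (\<Sum>i<n. c i *\<^sub>R u i))
      \<le> one_norm h * sqrt (\<Sum>i<n. (c i)\<^sup>2))"

lemma sq_int_scaleR: "sq_int f \<Longrightarrow> sq_int (\<lambda>x. c *\<^sub>R f x)"
  by (rule sq_int_bounded[of f _ "\<bar>c\<bar>"]) (auto simp: sq_int_def)

lemma shift_bessel_shift_lipschitz:
  assumes "shift_bessel n u"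
  shows "shift_lipschitz (\<lambda>x. \<Sum>i<n. c i *\<^sub>R fun_of (u i) x) (sqrt (\<Sum>i<n. (c i)\<^sup>2))"
proof -
  have s: "sq_int (\<lambda>x. c i *\<^sub>R fun_of (u i) x)" for i
    by (simp add: sq_int_scaleR)
  have "l2_of (\<lambda>x. \<Sum>i<n. c i *\<^sub>R fun_of (u i) x) = (\<Sum>i<n. c i *\<^sub>R u i)"
    using s by (simp add: l2_of_sum l2_of_scaleR)
  then show ?thesis
    using assms s by (simp add: shift_lipschitz_def shift_bessel_def sq_int_sum sum_nonneg)
qed

lemma shift_bessel_shift_lipschitz_1:
  assumes "shift_bessel n u" "i < n"
  shows "shift_lipschitz (fun_of (u i)) 1"
proof -
  let ?c = "\<lambda>j. if j = i then 1 else 0 :: real"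
  have "(\<Sum>j<n. ?c j *\<^sub>R u j) = u i" "(\<Sum>j<n. (?c j)\<^sup>2) = 1"
    using assms(2) by (simp_all add: if_distrib[of "\<lambda>c. c *\<^sub>R _"] if_distrib[of "\<lambda>c. c\<^sup>2"] cong: if_cong)
  then show ?thesis
    using assms(1)[unfolded shift_bessel_def, rule_format, of _ ?c] by (simp add: shift_lipschitz_def)
qed

lemma avg_sum:
  assumes "r > 0"
  shows "avg r (\<lambda>x. \<Sum>i<n. c i *\<^sub>R fun_of (u i) x) x = (\<Sum>i<n. c i *\<^sub>R avg r (fun_of (u i)) x)"
  unfolding avg_def
  using avg_facts(1)[OF fun_of_sq_int assms]
  by (subst Bochner_Integration.integral_sum) auto

definition avg_const :: real where
  "avg_const = real DIM(complex^4) * (32\<^sup>2 / ball_vol)"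

lemma avg_const_pos: "avg_const > 0"
  using ball_vol_pos by (simp add: avg_const_def)

text \<open>Apply the pointwise bound for averages to the combination whose coefficients are the components
  of the averages themselves. Dividing by their norm gives a bound that is independent of the number of fields.\<close>

lemma avg_density_bound:
  assumes "shift_bessel n u" "r > 0"
  shows "(\<Sum>i<n. norm (avg r (fun_of (u i)) x) ^ 2) \<le> avg_const / r"
proof -
  let ?v = "\<lambda>i. avg r (fun_of (u i)) x"
  have e: "(\<Sum>i<n. (inner (?v i) e)\<^sup>2) \<le> 32\<^sup>2 / ball_vol / r" if "e \<in> Basis" for e
  proof -
    \<comment> \<open>testing with the averages themselves\<close>
    define c where "c i = inner (?v i) e" for i
    define S where "S = (\<Sum>i<n. (c i)\<^sup>2)"
    have S: "S \<ge> 0" by (simp add: S_def sum_nonneg)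
    have "S = inner (\<Sum>i<n. c i *\<^sub>R ?v i) e"
      by (simp add: S_def c_def inner_sum_left power2_eq_square)
    also have "\<dots> \<le> norm (\<Sum>i<n. c i *\<^sub>R ?v i) * norm e"
      by (rule norm_cauchy_schwarz)
    also have "\<dots> = norm (avg r (\<lambda>x. \<Sum>i<n. c i *\<^sub>R fun_of (u i) x) x)"
      using that by (simp add: avg_sum assms(2))
    also have "\<dots> \<le> 32 * sqrt S / (sqrt ball_vol * sqrt r)"
      unfolding S_def by (rule avg_bound[OF shift_bessel_shift_lipschitz[OF assms(1)] assms(2)])
    finally have "sqrt S * sqrt S \<le> 32 / (sqrt ball_vol * sqrt r) * sqrt S" using S by simp
    then have "sqrt S \<le> 32 / (sqrt ball_vol * sqrt r)"
    proof (cases "S = 0")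
      case True
      then show ?thesis using ball_vol_pos assms(2) by simp
    next
      case False
      then have "sqrt S > 0" using S by simp
      with \<open>sqrt S * sqrt S \<le> _\<close> show ?thesis by (rule mult_right_le_imp_le)
    qed
    then have "(sqrt S)\<^sup>2 \<le> (32 / (sqrt ball_vol * sqrt r))\<^sup>2" by (rule power_mono) (use S in simp)
    then show ?thesis
      using S ball_vol_pos assms(2) by (simp add: S_def c_def power_divide power_mult_distrib)
  qed
  have "norm a ^ 2 = (\<Sum>e\<in>Basis. (inner a e)\<^sup>2)" for a :: "complex^4"
    using euclidean_inner[of a a] by (simp only: power2_norm_eq_inner power2_eq_square[of "inner _ _"])
  then have "(\<Sum>i<n. norm (?v i) ^ 2) = (\<Sum>i<n. \<Sum>e\<in>Basis. (inner (?v i) e)\<^sup>2)"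
    by (simp only:)
  also have "\<dots> = (\<Sum>e\<in>Basis. \<Sum>i<n. (inner (?v i) e)\<^sup>2)"
    by (rule sum.swap)
  also have "\<dots> \<le> (\<Sum>e\<in>(Basis :: (complex^4) set). 32\<^sup>2 / ball_vol / r)"
    by (intro sum_mono e)
  also have "\<dots> = avg_const / r" by (simp add: avg_const_def)
  finally show ?thesis .
qed

definition pt_density :: "nat \<Rightarrow> (nat \<Rightarrow> l2) \<Rightarrow> real^3 \<Rightarrow> real" where
  "pt_density n u x = (\<Sum>i<n. norm (fun_of (u i) x) ^ 2)"

lemma pt_density_nonneg: "pt_density n u x \<ge> 0"
  by (simp add: pt_density_def sum_nonneg)

lemma pt_density_measurable [measurable]: "pt_density n u \<in> borel_measurable borel"
  unfolding pt_density_def[abs_def] using fun_of_measurable by (intro borel_measurable_sum) simp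

definition oscillation :: "nat \<Rightarrow> (nat \<Rightarrow> l2) \<Rightarrow> real \<Rightarrow> real^3 \<Rightarrow> real" where
  "oscillation n u r x = (\<Sum>i<n. norm (fun_of (u i) x - avg r (fun_of (u i)) x) ^ 2)"

lemma oscillation_nonneg: "oscillation n u r x \<ge> 0"
  by (simp add: oscillation_def sum_nonneg)

lemma oscillation_measurable: "oscillation n u r \<in> borel_measurable borel"
proof -
  have [measurable]: "fun_of (u i) \<in> borel_measurable borel" "avg r (fun_of (u i)) \<in> borel_measurable borel" for i
    using fun_of_measurable[of "u i"] by (auto intro: avg_measurable)
  show ?thesis unfolding oscillation_def[abs_def] by measurable
qed

lemma pt_density_le_oscillation:
  assumes "shift_bessel n u" "r > 0"
  shows "pt_density n u x \<le> 2 * (avg_const / r) + 2 * oscillation n u r x"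
proof -
  have "norm a ^ 2 \<le> 2 * norm b ^ 2 + 2 * norm (a - b) ^ 2" for a b :: "complex^4"
  proof -
    have "norm a \<le> norm b + norm (a - b)" by (metis norm_triangle_sub)
    then have "norm a ^ 2 \<le> (norm b + norm (a - b)) ^ 2" by (rule power_mono) simp
    also have "\<dots> \<le> 2 * norm b ^ 2 + 2 * norm (a - b) ^ 2"
      using sum_squares_bound[of "norm b" "norm (a - b)"] by (simp add: power2_sum)
    finally show ?thesis .
  qed
  then have "pt_density n u x \<le> (\<Sum>i<n. 2 * norm (avg r (fun_of (u i)) x) ^ 2 + 2 * norm (fun_of (u i) x - avg r (fun_of (u i)) x) ^ 2)"
    unfolding pt_density_def by (intro sum_mono)
  also have "\<dots> = 2 * (\<Sum>i<n. norm (avg r (fun_of (u i)) x) ^ 2) + 2 * oscillation n u r x"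
    by (simp add: oscillation_def sum.distrib sum_distrib_left)
  finally show ?thesis using avg_density_bound[OF assms, of x] by linarith
qed

text \<open>At the scale \<open>r \<approx> 4 B / \<rho>\<close> the averages make up at most half of \<open>\<rho>\<close>, so that the oscillation is at
  least \<open>\<rho> / 4\<close>, while \<open>r\<^sup>-\<^sup>2\<close> is comparable to \<open>\<rho>\<^sup>2\<close>.\<close>

lemma pt_density_cube_le_oscillation:
  assumes "shift_bessel n u" "r > 0" "4 * avg_const / pt_density n u x \<le> r" "r \<le> 2 * (4 * avg_const / pt_density n u x)"
  shows "pt_density n u x ^ 3 \<le> 256 * avg_const\<^sup>2 * (1 / r\<^sup>2 * oscillation n u r x)"
proof (cases "pt_density n u x = 0")
  case True
  then show ?thesis using oscillation_nonneg[of n u r x] by simp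
next
  case False
  define p where "p = pt_density n u x"
  have p: "p > 0" using False pt_density_nonneg[of n u x] by (simp add: p_def)
  have "4 * avg_const \<le> r * p" using assms(3) p by (simp add: p_def[symmetric] divide_le_eq)
  then have "avg_const / r \<le> p / 4" using assms(2) by (simp add: field_simps)
  then have o: "p / 4 \<le> oscillation n u r x" using pt_density_le_oscillation[OF assms(1,2), of x] unfolding p_def by linarith
  have "r * p \<le> 8 * avg_const" using assms(4) p by (simp add: p_def[symmetric] le_divide_eq)
  then have "(r * p)\<^sup>2 \<le> (8 * avg_const)\<^sup>2" using assms(2) p by (intro power_mono) auto
  then have "p\<^sup>2 \<le> 64 * avg_const\<^sup>2 / r\<^sup>2" using assms(2) by (simp add: power_mult_distrib le_divide_eq mult.commute)
  then have "p\<^sup>2 * (p / 4) \<le> 64 * avg_const\<^sup>2 / r\<^sup>2 * oscillation n u r x"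
    using o p by (intro mult_mono) auto
  then show ?thesis by (simp add: p_def power2_eq_square power3_eq_cube)
qed

lemma dyadic_scale:
  assumes "t > (0::real)"
  shows "\<forall>\<^sub>F K in sequentially. \<exists>k<2 * K. t \<le> 2 ^ k * (1 / 2 ^ K) \<and> 2 ^ k * (1 / 2 ^ K) \<le> 2 * t"
proof -
  define z where "z = \<lceil>log 2 t\<rceil>"
  have "t = 2 powr (log 2 t)" using assms by simp
  also have "\<dots> \<le> 2 powr z" by (intro powr_mono) (auto simp: z_def)
  finally have 1: "t \<le> 2 powr z" .
  have "real_of_int z \<le> log 2 t + 1" unfolding z_def by linarith
  then have "2 powr z \<le> 2 powr (log 2 t + 1)" by (intro powr_mono) simp_all
  also have "\<dots> = 2 * t" using assms by (simp add: powr_add)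
  finally have 2: "2 powr z \<le> 2 * t" .
  show ?thesis
  proof (rule eventually_sequentiallyI)
    fix K assume K: "nat (\<bar>z\<bar> + 1) \<le> K"
    let ?k = "nat (z + int K)"
    have "real ?k = z + real K" using K by (simp add: nat_le_iff)
    then have "2 ^ ?k = 2 powr (z + real K)" by (metis powr_realpow zero_less_numeral)
    then have "2 ^ ?k * (1 / 2 ^ K) = 2 powr z" by (simp add: powr_add powr_realpow)
    moreover have "?k < 2 * K" using K by linarith
    ultimately show "\<exists>k<2 * K. t \<le> 2 ^ k * (1 / 2 ^ K) \<and> 2 ^ k * (1 / 2 ^ K) \<le> 2 * t"
      using 1 2 by metis
  qed
qed

lemma ennreal_sum_nn: "(\<And>i. i \<in> I \<Longrightarrow> f i \<ge> 0) \<Longrightarrow> ennreal (\<Sum>i\<in>I. f i) = (\<Sum>i\<in>I. ennreal (f i))"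
  by (simp add: sum_ennreal)

text \<open>The dual form of the Cwikel-Lieb-Rozenblum inequality. The right scale depends on the point, so the
  pointwise bound is summed over the dyadic scales \<open>2\<^sup>-\<^sup>K, \<dots>, 2\<^sup>K\<^sup>-\<^sup>1\<close>, one of which is within a factor
  \<open>2\<close> of the right one once \<open>K\<close> is large; Fatou's lemma removes \<open>K\<close>.\<close>

theorem density_cube_bound:
  assumes "shift_bessel n u"
  shows "(\<integral>\<^sup>+x. ennreal (pt_density n u x ^ 3) \<partial>lborel) \<le> ennreal (2304 * avg_const\<^sup>2 * n)"
proof -
  let ?r = "\<lambda>K k. 2 ^ k * (1 / 2 ^ K) :: real"
  let ?G = "\<lambda>K x. \<Sum>k<2 * K. 1 / (?r K k)\<^sup>2 * oscillation n u (?r K k) x"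
  have G: "(\<integral>\<^sup>+x. ennreal (256 * avg_const\<^sup>2 * ?G K x) \<partial>lborel) \<le> ennreal (2304 * avg_const\<^sup>2 * n)" for K
  proof -
    have "(\<integral>\<^sup>+x. ennreal (256 * avg_const\<^sup>2 * ?G K x) \<partial>lborel) = 
      (\<integral>\<^sup>+x. ennreal (256 * avg_const\<^sup>2) * (\<Sum>k<2 * K. ennreal (1 / (?r K k)\<^sup>2) * ennreal (oscillation n u (?r K k) x)) \<partial>lborel)"
      by (intro nn_integral_cong) (simp add: ennreal_mult[symmetric] ennreal_sum_nn[symmetric] oscillation_nonneg sum_nonneg)
    also have "\<dots> = ennreal (256 * avg_const\<^sup>2) * (\<Sum>k<2 * K. ennreal (1 / (?r K k)\<^sup>2) * (\<integral>\<^sup>+x. ennreal (oscillation n u (?r K k) x) \<partial>lborel))"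
      using oscillation_measurable by (simp add: nn_integral_cmult nn_integral_sum)
    also have "\<dots> = ennreal (256 * avg_const\<^sup>2) * (\<Sum>k<2 * K. ennreal (1 / (?r K k)\<^sup>2) *
        (\<Sum>i<n. \<integral>\<^sup>+x. ennreal (norm (fun_of (u i) x - avg (?r K k) (fun_of (u i)) x) ^ 2) \<partial>lborel))"
    proof -
      have [measurable]: "fun_of (u i) \<in> borel_measurable borel" "avg r (fun_of (u i)) \<in> borel_measurable borel" for i r
        using fun_of_measurable[of "u i"] by (auto intro: avg_measurable)
      have "(\<integral>\<^sup>+x. ennreal (oscillation n u r x) \<partial>lborel) = (\<Sum>i<n. \<integral>\<^sup>+x. ennreal (norm (fun_of (u i) x - avg r (fun_of (u i)) x) ^ 2) \<partial>lborel)" for r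
      proof -
        have "(\<lambda>x. ennreal (norm (fun_of (u i) x - avg r (fun_of (u i)) x) ^ 2)) \<in> borel_measurable lborel" for i
          by measurable
        then show ?thesis
          unfolding oscillation_def by (subst nn_integral_sum[symmetric]) simp_all
      qed
      then show ?thesis by simp
    qed
    also have "\<dots> = ennreal (256 * avg_const\<^sup>2) * (\<Sum>i<n. \<Sum>k<2 * K. ennreal (1 / (?r K k)\<^sup>2) *
        (\<integral>\<^sup>+x. ennreal (norm (fun_of (u i) x - avg (?r K k) (fun_of (u i)) x) ^ 2) \<partial>lborel))"
      unfolding sum_distrib_left by (subst sum.swap) simp
    also have "\<dots> \<le> ennreal (256 * avg_const\<^sup>2) * (\<Sum>i<n. ennreal (9 * 1\<^sup>2))"
      by (intro mult_left_mono sum_mono square_function_bound shift_bessel_shift_lipschitz_1[OF assms]) auto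
    also have "\<dots> = ennreal (256 * avg_const\<^sup>2) * ennreal (9 * n)"
      by (simp add: ennreal_of_nat_eq_real_of_nat ennreal_mult' mult.commute)
    also have "\<dots> = ennreal (2304 * avg_const\<^sup>2 * n)"
      by (simp add: ennreal_mult[symmetric])
    finally show ?thesis .
  qed
  have "ennreal (pt_density n u x ^ 3) \<le> liminf (\<lambda>K. ennreal (256 * avg_const\<^sup>2 * ?G K x))" for x
  proof (cases "pt_density n u x = 0")
    case False
    then have "4 * avg_const / pt_density n u x > 0" using avg_const_pos pt_density_nonneg[of n u x] by simp
    from dyadic_scale[OF this] show ?thesis
    proof (intro Liminf_bounded, elim eventually_mono, goal_cases)
      case (1 K)
      then obtain k where k: "k < 2 * K" "4 * avg_const / pt_density n u x \<le> ?r K k" "?r K k \<le> 2 * (4 * avg_const / pt_density n u x)" by blast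
      have "pt_density n u x ^ 3 \<le> 256 * avg_const\<^sup>2 * (1 / (?r K k)\<^sup>2 * oscillation n u (?r K k) x)"
        by (rule pt_density_cube_le_oscillation[OF assms _ k(2,3)]) simp
      also have "\<dots> \<le> 256 * avg_const\<^sup>2 * ?G K x"
        using k(1) by (intro mult_left_mono member_le_sum) (auto simp: oscillation_nonneg)
      finally show ?case by (rule ennreal_leI)
    qed
  qed simp
  then have "(\<integral>\<^sup>+x. ennreal (pt_density n u x ^ 3) \<partial>lborel) \<le> (\<integral>\<^sup>+x. liminf (\<lambda>K. ennreal (256 * avg_const\<^sup>2 * ?G K x)) \<partial>lborel)"
    by (intro nn_integral_mono)
  also have "\<dots> \<le> liminf (\<lambda>K. \<integral>\<^sup>+x. ennreal (256 * avg_const\<^sup>2 * ?G K x) \<partial>lborel)"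
  proof (rule nn_integral_liminf)
    note oscillation_measurable[measurable]
    show "(\<lambda>x. ennreal (256 * avg_const\<^sup>2 * ?G K x)) \<in> borel_measurable lborel" for K by measurable
  qed
  also have "\<dots> \<le> liminf (\<lambda>K::nat. ennreal (2304 * avg_const\<^sup>2 * n))"
    by (intro Liminf_mono always_eventually allI G)
  also have "\<dots> = ennreal (2304 * avg_const\<^sup>2 * n)"
    by (intro Liminf_const) simp
  finally show ?thesis .
qed

text \<open>With Lipschitz constant \<open>0\<close>, the averages vanish and so does the distance to them.\<close>

lemma kinetic_injective:
  assumes "u \<in> H1_l2" "kinetic u = 0" shows "u = 0"
proof -
  have t: "shift h u - u = 0" for h
    using shift_norm_kinetic[OF assms(1), of h] assms(2) by simp
  have e: "shift_lipschitz (fun_of u) 0" by (simp add: shift_lipschitz_def t)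
  have "AE x in lborel. fun_of u x = 0"
  proof -
    have "(\<integral>\<^sup>+x. ennreal (norm (fun_of u x - avg 1 (fun_of u) x) ^ 2) \<partial>lborel) \<le> 0"
      using square_function_bound[OF e, of 1 1] by simp
    moreover have "avg 1 (fun_of u) x = 0" for x
      using avg_bound[OF e, of 1 x] by simp
    ultimately have "(\<integral>\<^sup>+x. ennreal (norm (fun_of u x) ^ 2) \<partial>lborel) = 0" by simp
    then show ?thesis by (subst (asm) nn_integral_0_iff_AE) (auto elim!: AE_mp)
  qed
  then show ?thesis using fun_of_zero by (intro l2_eqI) (auto elim!: AE_mp)
qed

section \<open>Potentials\<close>

lemma kinetic_orthonormal_shift_bessel:
  assumes "\<And>i. i < n \<Longrightarrow> u i \<in> H1_l2"
    and "\<And>i j. i < n \<Longrightarrow> j < n \<Longrightarrow> inner (kinetic (u i)) (kinetic (u j)) = (if i = j then 1 else 0)"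
  shows "shift_bessel n u"
  unfolding shift_bessel_def
proof (intro allI)
  fix c h
  let ?w = "\<Sum>i<n. c i *\<^sub>R u i"
  have w: "?w \<in> H1_l2"
    using assms(1) by (intro subspace_sum subspace_scale H1_l2_subspace) auto
  have Pw: "kinetic ?w = (\<Sum>i<n. c i *\<^sub>R kinetic (u i))"
    by (rule kinetic_sum) (use assms(1) in simp)
  have "norm (kinetic ?w) ^ 2 = (\<Sum>i<n. \<Sum>j<n. c i * c j * inner (kinetic (u i)) (kinetic (u j)))"
    unfolding Pw by (simp add: power2_norm_eq_inner inner_sum_left inner_sum_right sum_distrib_left mult_ac inner_commute)
  also have "\<dots> = (\<Sum>i<n. \<Sum>j<n. if i = j then c i * c j else 0)"
    using assms(2) by (intro sum.cong refl) auto
  also have "\<dots> = (\<Sum>i<n. (c i)\<^sup>2)"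
    by (simp add: power2_eq_square)
  finally have "norm (kinetic ?w) = sqrt (\<Sum>i<n. (c i)\<^sup>2)"
    by (simp add: real_sqrt_unique)
  then show "norm (shift h ?w - ?w) \<le> one_norm h * sqrt (\<Sum>i<n. (c i)\<^sup>2)"
    using shift_norm_kinetic[OF w, of h] by simp
qed

definition pot_fun :: "vecpot \<Rightarrow> real^3 \<Rightarrow> real^3" where
  "pot_fun A = rep_mfun (mfun_of A)"

lemma pot_fun_measurable [measurable]: "pot_fun A \<in> borel_measurable borel"
  using rep_mfun_measurable[of "mfun_of A"] by (simp add: pot_fun_def)

lemma pot_fun_component_measurable [measurable]: "(\<lambda>x. pot_fun A x $ j) \<in> borel_measurable borel"
  using borel_measurable_continuous_on[OF _ pot_fun_measurable[of A], of "\<lambda>v. v $ j"]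
  by (simp add: continuous_on_component)

lemma Lp_mfun_of [simp]: "Lp 3 (mfun_of A)"
  using mfun_of by auto

lemma abs_pot_fun [simp]: "abs_mfun (pot_fun A) = mfun_of A"
  by (simp add: pot_fun_def)

definition cube_int :: "vecpot \<Rightarrow> real" where
  "cube_int A = integral_norm_pow 3 (mfun_of A)"

lemma cube_int_nonneg: "cube_int A \<ge> 0"
  by (simp add: cube_int_def integral_norm_pow_nonneg)

lemma nn_cube_int: "(\<integral>\<^sup>+x. ennreal (norm (pot_fun A x) ^ 3) \<partial>lborel) = ennreal (cube_int A)"
proof -
  have i: "integrable lborel (\<lambda>x. norm (pot_fun A x) ^ 3)"
    using Lp_abs_mfun[of "pot_fun A" 3] by simp
  have "cube_int A = (LINT x|lborel. norm (pot_fun A x) ^ 3)"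
    unfolding cube_int_def abs_pot_fun[symmetric] by (rule integral_norm_pow.abs_eq) (simp add: ae_eq_refl_iff)
  then show ?thesis by (simp add: nn_integral_eq_integral[OF i])
qed

lemma pot_fun_AE_I: "a \<in> borel_measurable borel \<Longrightarrow> mfun_of A = abs_mfun a \<Longrightarrow> AE x in lborel. pot_fun A x = a x"
  unfolding pot_fun_def by (simp add: rep_abs_mfun)

lemma pot_fun_minus: "AE x in lborel. pot_fun (A - B) x = pot_fun A x - pot_fun B x"
  by (rule pot_fun_AE_I) (auto simp: minus_vecpot.rep_eq abs_mfun_minus[symmetric])

lemma pot_fun_scaleR: "AE x in lborel. pot_fun (c *\<^sub>R A) x = c *\<^sub>R pot_fun A x"
  by (rule pot_fun_AE_I) (auto simp: scaleR_vecpot.rep_eq abs_mfun_scaleR[symmetric])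

definition alpha_mult :: "real^3 \<Rightarrow> complex^4 \<Rightarrow> complex^4" where
  "alpha_mult a v = (\<Sum>j\<in>UNIV. (a $ j) *\<^sub>R (dirac_alpha j *v v))"

lemma norm_alpha_mult: "norm (alpha_mult a v) \<le> 3 * norm a * norm v"
proof -
  have "norm (alpha_mult a v) \<le> (\<Sum>j\<in>UNIV. \<bar>a $ j\<bar> * norm v)"
    unfolding alpha_mult_def by (rule order_trans[OF norm_sum]) (simp add: norm_alpha)
  also have "\<dots> \<le> (\<Sum>j\<in>(UNIV :: 3 set). norm a * norm v)"
    by (intro sum_mono mult_right_mono component_le_norm_cart) simp
  finally show ?thesis by simp
qed

lemma alpha_mult_measurable [measurable]: "(\<lambda>x. alpha_mult (pot_fun A x) (fun_of u x)) \<in> borel_measurable borel"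
  unfolding alpha_mult_def
  by (intro borel_measurable_sum borel_measurable_scaleR pot_fun_component_measurable borel_measurable_cmatrix)
     (use fun_of_measurable[of u] in simp)

lemma alpha_dot_eq: "alpha_dot (mfun_of A) (field_of u) = abs_mfun (\<lambda>x. alpha_mult (pot_fun A x) (fun_of u x))"
  unfolding alpha_mult_def abs_pot_fun[symmetric] abs_fun_of[symmetric]
  by (rule alpha_dot.abs_eq) (simp_all add: ae_eq_refl_iff)

text \<open>Whichever of \<open>b\<close> and \<open>s a\<close> is larger, one of the two terms suffices.\<close>

lemma young_cube:
  fixes a b s :: real
  assumes "a \<ge> 0" "b \<ge> 0" "s > 0"
  shows "a\<^sup>2 * b \<le> s * a ^ 3 + b ^ 3 / s\<^sup>2"
proof (cases "b \<le> s * a")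
  case True
  have "a\<^sup>2 * b \<le> a\<^sup>2 * (s * a)" using True by (intro mult_left_mono) auto
  also have "\<dots> = s * a ^ 3" by (simp add: power2_eq_square power3_eq_cube)
  finally show ?thesis using assms by (simp add: add_increasing2)
next
  case False
  then have "a \<le> b / s" using assms by (simp add: field_simps)
  then have "a\<^sup>2 * b \<le> (b / s)\<^sup>2 * b" using assms by (intro mult_right_mono power_mono) auto
  also have "\<dots> = b ^ 3 / s\<^sup>2" by (simp add: power2_eq_square power3_eq_cube)
  finally show ?thesis using assms by (simp add: add_increasing)
qed

definition cube_const :: real where "cube_const = 2304 * avg_const\<^sup>2"

lemma cube_const_pos: "cube_const > 0" using avg_const_pos by (simp add: cube_const_def)

lemma potential_bound_nn:
  assumes "shift_bessel n u" "s > 0"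
  shows "(\<integral>\<^sup>+x. ennreal (\<Sum>i<n. norm (alpha_mult (pot_fun A x) (fun_of (u i) x)) ^ 2) \<partial>lborel)
    \<le> ennreal (9 * (s * cube_int A + cube_const * n / s\<^sup>2))"
proof -
  have "(\<integral>\<^sup>+x. ennreal (\<Sum>i<n. norm (alpha_mult (pot_fun A x) (fun_of (u i) x)) ^ 2) \<partial>lborel)
    \<le> (\<integral>\<^sup>+x. ennreal (9 * s) * ennreal (norm (pot_fun A x) ^ 3) + ennreal (9 / s\<^sup>2) * ennreal (pt_density n u x ^ 3) \<partial>lborel)"
  proof (rule nn_integral_mono)
    fix x
    have "(\<Sum>i<n. norm (alpha_mult (pot_fun A x) (fun_of (u i) x)) ^ 2) \<le> (\<Sum>i<n. (3 * norm (pot_fun A x) * norm (fun_of (u i) x)) ^ 2)"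
      by (intro sum_mono power_mono norm_alpha_mult) simp
    also have "\<dots> = 9 * ((norm (pot_fun A x))\<^sup>2 * pt_density n u x)"
      by (simp add: pt_density_def power_mult_distrib sum_distrib_left mult_ac)
    also have "\<dots> \<le> 9 * (s * norm (pot_fun A x) ^ 3 + pt_density n u x ^ 3 / s\<^sup>2)"
      using assms(2) pt_density_nonneg by (intro mult_left_mono young_cube) auto
    finally have "ennreal (\<Sum>i<n. norm (alpha_mult (pot_fun A x) (fun_of (u i) x)) ^ 2) \<le> ennreal (9 * (s * norm (pot_fun A x) ^ 3 + pt_density n u x ^ 3 / s\<^sup>2))"
      by (rule ennreal_leI)
    also have "\<dots> = ennreal (9 * s * norm (pot_fun A x) ^ 3 + 9 / s\<^sup>2 * pt_density n u x ^ 3)"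
      by (simp add: algebra_simps)
    also have "\<dots> = ennreal (9 * s) * ennreal (norm (pot_fun A x) ^ 3) + ennreal (9 / s\<^sup>2) * ennreal (pt_density n u x ^ 3)"
    proof -
      have c: "9 * s \<ge> 0" "norm (pot_fun A x) ^ 3 \<ge> 0" "9 / s\<^sup>2 \<ge> 0" "pt_density n u x ^ 3 \<ge> 0"
        using assms(2) pt_density_nonneg[of n u x] by auto
      show ?thesis
        by (simp only: ennreal_plus[OF mult_nonneg_nonneg[OF c(1,2)] mult_nonneg_nonneg[OF c(3,4)]]
          ennreal_mult[OF c(1,2)] ennreal_mult[OF c(3,4)])
    qed
    finally show "ennreal (\<Sum>i<n. norm (alpha_mult (pot_fun A x) (fun_of (u i) x)) ^ 2) \<le> ennreal (9 * s) * ennreal (norm (pot_fun A x) ^ 3) + ennreal (9 / s\<^sup>2) * ennreal (pt_density n u x ^ 3)" .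
  qed
  also have "\<dots> = ennreal (9 * s) * ennreal (cube_int A) + ennreal (9 / s\<^sup>2) * (\<integral>\<^sup>+x. ennreal (pt_density n u x ^ 3) \<partial>lborel)"
    by (simp add: nn_integral_add nn_integral_cmult nn_cube_int)
  also have "\<dots> \<le> ennreal (9 * s) * ennreal (cube_int A) + ennreal (9 / s\<^sup>2) * ennreal (cube_const * n)"
    unfolding cube_const_def by (intro add_left_mono mult_left_mono density_cube_bound assms) simp
  also have "\<dots> = ennreal (9 * (s * cube_int A + cube_const * n / s\<^sup>2))"
    using assms(2) cube_int_nonneg[of A] cube_const_pos
    by (simp add: ennreal_mult[symmetric] ennreal_plus[symmetric] algebra_simps del: ennreal_plus)
  finally show ?thesis .
qed

lemma shift_bessel_normalized:
  assumes "u \<in> H1_l2" "kinetic u \<noteq> 0"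
  shows "shift_bessel 1 (\<lambda>_. (1 / norm (kinetic u)) *\<^sub>R u)"
proof (rule kinetic_orthonormal_shift_bessel)
  show "inner (kinetic ((1 / norm (kinetic u)) *\<^sub>R u)) (kinetic ((1 / norm (kinetic u)) *\<^sub>R u)) = (if i = j then 1 else 0)" if "i < 1" "j < 1" for i j :: nat
    using that assms by (simp add: kinetic_scaleR dot_square_norm power2_eq_square)
qed (simp add: assms subspace_scale[OF H1_l2_subspace])

text \<open>The operator \<open>\<alpha> \<cdot> A\<close>, which maps \<open>H1_l2\<close> into \<open>l2\<close> by \<open>sq_int_alpha_mult\<close>.\<close>

definition pot_op :: "vecpot \<Rightarrow> l2 \<Rightarrow> l2" where
  "pot_op A u = l2_of (\<lambda>x. alpha_mult (pot_fun A x) (fun_of u x))"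

lemma alpha_mult_scaleR: "alpha_mult a (c *\<^sub>R v) = c *\<^sub>R alpha_mult a v" "alpha_mult (c *\<^sub>R a) v = c *\<^sub>R alpha_mult a v"
  by (simp_all add: alpha_mult_def scaleR_sum_right cmatrix_scaleR mult.commute)

lemma alpha_mult_add: "alpha_mult a (v + w) = alpha_mult a v + alpha_mult a w"
  by (simp add: alpha_mult_def matrix_vector_right_distrib scaleR_right_distrib sum.distrib)

lemma alpha_mult_diff: "alpha_mult (a - b) v = alpha_mult a v - alpha_mult b v"
  by (simp add: alpha_mult_def scaleR_diff_left sum_subtractf)

text \<open>Relative boundedness of the potential: after normalisation this is the case of a single field. If
  \<open>\<alpha> \<cdot> D u = 0\<close>, normalisation is impossible, but then \<open>u = 0\<close>.\<close>

lemma sq_int_alpha_mult: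
  assumes "u \<in> H1_l2"
  shows "sq_int (\<lambda>x. alpha_mult (pot_fun A x) (fun_of u x))"
proof (cases "kinetic u = 0")
  case True
  then have "u = 0" using kinetic_injective[OF assms] by simp
  then have "AE x in lborel. fun_of u x = 0" using fun_of_zero by simp
  then have "AE x in lborel. norm (alpha_mult (pot_fun A x) (fun_of u x)) \<le> 1 * norm (fun_of u x)"
    by eventually_elim (simp add: alpha_mult_def)
  then show ?thesis by (rule sq_int_bounded[OF fun_of_sq_int, rotated]) simp
next
  case False
  let ?N = "norm (kinetic u)"
  let ?v = "(1 / ?N) *\<^sub>R u"
  have "(\<integral>\<^sup>+x. ennreal (norm (alpha_mult (pot_fun A x) (fun_of ?v x)) ^ 2) \<partial>lborel) \<le> ennreal (9 * (1 * cube_int A + cube_const * 1 / 1\<^sup>2))"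
    using potential_bound_nn[OF shift_bessel_normalized[OF assms False], of 1 A] by simp
  also have "\<dots> < \<infinity>" by simp
  finally have "sq_int (\<lambda>x. alpha_mult (pot_fun A x) (fun_of ?v x))"
    unfolding sq_int_def by (intro conjI integrableI_bounded) simp_all
  then show ?thesis
  proof (rule sq_int_bounded)
    show "AE x in lborel. norm (alpha_mult (pot_fun A x) (fun_of u x)) \<le> ?N * norm (alpha_mult (pot_fun A x) (fun_of ?v x))"
      using fun_of_scaleR[of "1 / ?N" u] by eventually_elim (use False in \<open>simp add: alpha_mult_scaleR\<close>)
  qed simp
qed

lemma fun_of_pot_op: "u \<in> H1_l2 \<Longrightarrow> AE x in lborel. fun_of (pot_op A u) x = alpha_mult (pot_fun A x) (fun_of u x)"
  unfolding pot_op_def by (intro fun_of_l2_of sq_int_alpha_mult)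

lemma field_of_pot_op: "u \<in> H1_l2 \<Longrightarrow> field_of (pot_op A u) = alpha_dot (mfun_of A) (field_of u)"
  unfolding pot_op_def alpha_dot_eq by (intro field_of_l2_of sq_int_alpha_mult)

lemma pot_op_plus: assumes "u \<in> H1_l2" "v \<in> H1_l2" shows "pot_op A (u + v) = pot_op A u + pot_op A v"
proof (rule l2_eqI)
  show "AE x in lborel. fun_of (pot_op A (u + v)) x = fun_of (pot_op A u + pot_op A v) x"
    using fun_of_pot_op[OF assms(1), of A] fun_of_pot_op[OF assms(2), of A] fun_of_pot_op[OF subspace_add[OF H1_l2_subspace assms], of A]
      fun_of_plus[of u v] fun_of_plus[of "pot_op A u" "pot_op A v"]
    by eventually_elim (simp add: alpha_mult_add)
qed

lemma pot_op_scaleR: assumes "u \<in> H1_l2" shows "pot_op A (c *\<^sub>R u) = c *\<^sub>R pot_op A u"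
proof (rule l2_eqI)
  show "AE x in lborel. fun_of (pot_op A (c *\<^sub>R u)) x = fun_of (c *\<^sub>R pot_op A u) x"
    using fun_of_pot_op[OF assms, of A] fun_of_pot_op[OF subspace_scale[OF H1_l2_subspace assms], of A c]
      fun_of_scaleR[of c u] fun_of_scaleR[of c "pot_op A u"]
    by eventually_elim (simp add: alpha_mult_scaleR)
qed

lemma pot_op_sum: "(\<And>i. i \<in> I \<Longrightarrow> u i \<in> H1_l2) \<Longrightarrow> pot_op A (\<Sum>i\<in>I. c i *\<^sub>R u i) = (\<Sum>i\<in>I. c i *\<^sub>R pot_op A (u i))"
proof (induction I rule: infinite_finite_induct)
  case (insert i I)
  have "(\<Sum>i\<in>I. c i *\<^sub>R u i) \<in> H1_l2"
    using insert by (intro subspace_sum subspace_scale H1_l2_subspace) auto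
  then show ?case
    using insert by (simp add: pot_op_plus pot_op_scaleR subspace_scale[OF H1_l2_subspace])
qed (use pot_op_scaleR[of 0 A 0] subspace_0[OF H1_l2_subspace] in simp_all)

lemma pot_op_diff_scaleR:
  assumes "u \<in> H1_l2" shows "pot_op (B - c *\<^sub>R A) u = pot_op B u - c *\<^sub>R pot_op A u"
proof (rule l2_eqI)
  show "AE x in lborel. fun_of (pot_op (B - c *\<^sub>R A) u) x = fun_of (pot_op B u - c *\<^sub>R pot_op A u) x"
    using fun_of_pot_op[OF assms, of A] fun_of_pot_op[OF assms, of B] fun_of_pot_op[OF assms, of "B - c *\<^sub>R A"]
      pot_fun_minus[of B "c *\<^sub>R A"] pot_fun_scaleR[of c A] fun_of_minus[of "pot_op B u" "c *\<^sub>R pot_op A u"] fun_of_scaleR[of c "pot_op A u"]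
    by eventually_elim (simp add: alpha_mult_diff alpha_mult_scaleR)
qed

lemma pot_op_symmetric: assumes "u \<in> H1_l2" "v \<in> H1_l2" shows "inner (pot_op A u) v = inner u (pot_op A v)"
proof -
  have "inner (pot_op A u) v = (LINT x|lborel. inner (alpha_mult (pot_fun A x) (fun_of u x)) (fun_of v x))"
    unfolding inner_l2_fun_of
  proof (rule integral_cong_AE)
    show "AE x in lborel. inner (fun_of (pot_op A u) x) (fun_of v x) = inner (alpha_mult (pot_fun A x) (fun_of u x)) (fun_of v x)"
      using fun_of_pot_op[OF assms(1), of A] by eventually_elim simp
  qed simp_all
  also have "\<dots> = (LINT x|lborel. inner (fun_of u x) (alpha_mult (pot_fun A x) (fun_of v x)))"
    by (simp add: alpha_mult_def inner_sum_left inner_sum_right inner_hconj hconj_alpha)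
  also have "\<dots> = inner u (pot_op A v)"
    unfolding inner_l2_fun_of
  proof (rule integral_cong_AE)
    show "AE x in lborel. inner (fun_of u x) (alpha_mult (pot_fun A x) (fun_of v x)) = inner (fun_of u x) (fun_of (pot_op A v) x)"
      using fun_of_pot_op[OF assms(2), of A] by eventually_elim simp
  qed simp_all
  finally show ?thesis .
qed

lemma linear_cmatrix: "linear ((*v) M :: complex^4 \<Rightarrow> complex^4)" for M :: "complex^4^4"
  by (rule linearI) (simp_all add: matrix_vector_right_distrib cmatrix_scaleR)

text \<open>The sign \<open>c = - 1\<close> is that of \<open>\<beta>\<close>, which anticommutes with the matrices \<open>\<alpha>\<^sub>j\<close>, and \<open>c = 1\<close> that of
  \<open>\<gamma>\<^sub>5\<close>, which commutes with them.\<close>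

lemma pot_op_mat_act:
  assumes "u \<in> H1_l2" "\<And>j v. M *v (dirac_alpha j *v v) = c *\<^sub>R (dirac_alpha j *v (M *v v))"
  shows "mat_act M (pot_op A u) = c *\<^sub>R pot_op A (mat_act M u)"
proof (rule l2_eqI)
  have *: "M *v alpha_mult a v = c *\<^sub>R alpha_mult a (M *v v)" for a v
    unfolding alpha_mult_def
    by (simp add: linear_sum[OF linear_cmatrix] cmatrix_scaleR assms(2) scaleR_sum_right mult.commute)
  show "AE x in lborel. fun_of (mat_act M (pot_op A u)) x = fun_of (c *\<^sub>R pot_op A (mat_act M u)) x"
    using fun_of_pot_op[OF assms(1), of A] fun_of_pot_op[OF H1_l2_mat_act[OF assms(1)], of A M] fun_of_mat_act[of M u] fun_of_mat_act[of M "pot_op A u"]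
      fun_of_scaleR[of c "pot_op A (mat_act M u)"] 
    by eventually_elim (simp add: *)
qed

text \<open>Orthonormality under \<open>\<alpha> \<cdot> D\<close> is what makes the fields a Bessel family for translations. In the
  applications a large \<open>s\<close> absorbs the term with \<open>n\<close>.\<close>

theorem potential_bound:
  fixes n :: nat
  assumes "\<And>i. i < n \<Longrightarrow> u i \<in> H1_l2"
    and "\<And>i j. i < n \<Longrightarrow> j < n \<Longrightarrow> inner (kinetic (u i)) (kinetic (u j)) = (if i = j then 1 else 0)"
    and "s > 0"
  shows "(\<Sum>i<n. norm (pot_op A (u i)) ^ 2) \<le> 9 * (s * cube_int A + cube_const * n / s\<^sup>2)"
proof -
  have o: "shift_bessel n u" by (rule kinetic_orthonormal_shift_bessel[OF assms(1,2)])
  have "ennreal (\<Sum>i<n. norm (pot_op A (u i)) ^ 2) = (\<Sum>i<n. ennreal (norm (pot_op A (u i)) ^ 2))"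
    by simp
  also have "\<dots> = (\<Sum>i<n. \<integral>\<^sup>+x. ennreal (norm (alpha_mult (pot_fun A x) (fun_of (u i) x)) ^ 2) \<partial>lborel)"
    using assms(1) by (intro sum.cong refl) (simp add: pot_op_def sq_int_alpha_mult nn_norm_l2_of)
  also have "\<dots> = (\<integral>\<^sup>+x. (\<Sum>i<n. ennreal (norm (alpha_mult (pot_fun A x) (fun_of (u i) x)) ^ 2)) \<partial>lborel)"
    by (rule nn_integral_sum[symmetric]) simp
  also have "\<dots> \<le> ennreal (9 * (s * cube_int A + cube_const * n / s\<^sup>2))"
    using potential_bound_nn[OF o assms(3), of A] by simp
  finally show ?thesis
    using assms(3) cube_int_nonneg[of A] cube_const_pos by (subst (asm) ennreal_le_iff) auto
qed

corollary potential_relative_bound: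
  assumes "u \<in> H1_l2" "s > 0"
  shows "norm (pot_op A u) ^ 2 \<le> 9 * (s * cube_int A + cube_const / s\<^sup>2) * norm (kinetic u) ^ 2"
proof (cases "kinetic u = 0")
  case True
  then have "u = 0" using kinetic_injective[OF assms(1)] by simp
  then show ?thesis using pot_op_scaleR[OF assms(1), of A 0] True by simp
next
  case False
  let ?N = "norm (kinetic u)"
  let ?v = "\<lambda>i::nat. (1 / ?N) *\<^sub>R u"
  have "(\<Sum>i<1. norm (pot_op A (?v i)) ^ 2) \<le> 9 * (s * cube_int A + cube_const * real 1 / s\<^sup>2)"
  proof (rule potential_bound[OF _ _ assms(2)])
    show "inner (kinetic (?v i)) (kinetic (?v j)) = (if i = j then 1 else 0)" if "i < 1" "j < 1" for i j
      using that assms False by (simp add: kinetic_scaleR dot_square_norm power2_eq_square)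
  qed (simp add: assms subspace_scale[OF H1_l2_subspace])
  then have "(norm (pot_op A u) / ?N) ^ 2 \<le> 9 * (s * cube_int A + cube_const / s\<^sup>2)"
    by (simp add: pot_op_scaleR assms(1))
  then show ?thesis using False by (simp add: power_divide divide_le_eq)
qed

section \<open>Approximate eigenvectors to distinct eigenvalues\<close>

text \<open>Gram-Schmidt orthonormalisation, keeping the coefficients: in the applications the \<open>p k\<close> are images of
  fields, and the same triangular combinations have to be formed of the fields themselves.\<close>

lemma triangular_gram_schmidt:
  fixes p :: "nat \<Rightarrow> 'h::real_inner"
  assumes "\<forall>c. (\<Sum>i<n. c i *\<^sub>R p i) = 0 \<longrightarrow> (\<forall>i<n. c i = 0)"
  shows "\<exists>e b. (\<forall>i<n. \<forall>j<n. inner (e i) (e j) = (if i = j then 1 else 0))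
    \<and> (\<forall>i<n. e i = (\<Sum>k<Suc i. b i k *\<^sub>R p k))
    \<and> (\<forall>i<n. \<forall>k<i. inner (p k) (e i) = 0)"
proof -
  have "\<exists>e b. (\<forall>i<m. \<forall>j<m. inner (e i) (e j) = (if i = j then 1 else 0))
    \<and> (\<forall>i<m. e i = (\<Sum>k<Suc i. b i k *\<^sub>R p k))
    \<and> (\<forall>i<m. p i \<in> span (e ` {..<Suc i}))" if "m \<le> n" for m
    using that
  proof (induction m)
    case (Suc m)
    from Suc.IH[OF Suc_leD[OF Suc.prems]] obtain e b where eo: "\<And>i j. i < m \<Longrightarrow> j < m \<Longrightarrow> inner (e i) (e j) = (if i = j then 1 else 0)"
      and eb: "\<And>i. i < m \<Longrightarrow> e i = (\<Sum>k<Suc i. b i k *\<^sub>R p k)"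
      and ps: "\<And>i. i < m \<Longrightarrow> p i \<in> span (e ` {..<Suc i})"
      by blast
    \<comment> \<open>\<open>pr\<close> is the projection of \<open>p m\<close>, with coefficients \<open>d k\<close> in terms of the \<open>p k\<close>\<close>
    define pr where "pr = (\<Sum>i<m. inner (p m) (e i) *\<^sub>R e i)"
    define q where "q = p m - pr"
    define d where "d k = (\<Sum>i<m. if k < Suc i then inner (p m) (e i) * b i k else 0)" for k
    have "pr = (\<Sum>i<m. \<Sum>k<m. (if k < Suc i then inner (p m) (e i) * b i k else 0) *\<^sub>R p k)"
      unfolding pr_def
    proof (rule sum.cong[OF refl])
      fix i assume i: "i \<in> {..<m}"
      then have "e i = (\<Sum>k\<in>{..<m} \<inter> {k. k < Suc i}. b i k *\<^sub>R p k)"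
      proof -
        have "{..<m} \<inter> {k. k < Suc i} = {..<Suc i}" using i by auto
        then show ?thesis using eb[of i] i by simp
      qed
      also have "\<dots> = (\<Sum>k<m. if k < Suc i then b i k *\<^sub>R p k else 0)"
        by (simp add: sum.inter_restrict)
      finally show "inner (p m) (e i) *\<^sub>R e i = (\<Sum>k<m. (if k < Suc i then inner (p m) (e i) * b i k else 0) *\<^sub>R p k)"
        by (simp add: scaleR_sum_right if_distrib[of "\<lambda>x. _ *\<^sub>R x"] if_distrib[of "\<lambda>x. x *\<^sub>R _"] cong: if_cong)
    qed
    also have "\<dots> = (\<Sum>k<m. d k *\<^sub>R p k)"
      by (subst sum.swap) (simp add: d_def scaleR_sum_left)
    finally have prd: "pr = (\<Sum>k<m. d k *\<^sub>R p k)" .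
    have q0: "q \<noteq> 0"
    proof
      assume q0: "q = 0"
      let ?c = "\<lambda>k. if k < m then - d k else if k = m then 1 else 0"
      have "(\<Sum>k<n. ?c k *\<^sub>R p k) = (\<Sum>k<Suc m. ?c k *\<^sub>R p k)"
        by (rule sum.mono_neutral_right) (use Suc.prems in auto)
      also have "\<dots> = q" by (simp add: q_def prd sum_negf)
      finally have "\<forall>i<n. ?c i = 0" using spec[OF assms, of ?c] q0 by simp
      from spec[OF this, of m] show False using Suc.prems by simp
    qed
    define e' where "e' i = (if i = m then q /\<^sub>R norm q else e i)" for i
    define b' where "b' i k = (if i = m then (if k = m then 1 / norm q else - d k / norm q) else b i k)" for i k
    have qe: "inner q (e j) = 0" if "j < m" for j
    proof -
      have "inner pr (e j) = (\<Sum>i<m. if i = j then inner (p m) (e i) else 0)"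
        unfolding pr_def inner_sum_left using eo that by (intro sum.cong) simp_all
      also have "\<dots> = inner (p m) (e j)"
        by (subst sum.delta) (use that in simp_all)
      finally show ?thesis by (simp add: q_def inner_diff_left)
    qed
    show ?case
    proof (intro exI[of _ e'] exI[of _ b'] conjI allI impI)
      fix i j assume "i < Suc m" "j < Suc m"
      then show "inner (e' i) (e' j) = (if i = j then 1 else 0)"
        using eo[of i j] qe[of i] qe[of j] q0
        by (auto simp: e'_def inner_commute dot_square_norm power2_eq_square less_Suc_eq)
    next
      fix i assume i: "i < Suc m"
      show "e' i = (\<Sum>k<Suc i. b' i k *\<^sub>R p k)"
      proof (cases "i = m")
        case True
        have "(\<Sum>k<Suc m. b' m k *\<^sub>R p k) = (\<Sum>k<m. (- d k / norm q) *\<^sub>R p k) + (1 / norm q) *\<^sub>R p m"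
          by (simp add: b'_def)
        also have "\<dots> = (1 / norm q) *\<^sub>R (p m - (\<Sum>k<m. d k *\<^sub>R p k))"
          by (simp add: scaleR_diff_right scaleR_sum_right sum_negf)
        also have "\<dots> = e' m" by (simp add: e'_def q_def prd inverse_eq_divide)
        finally show ?thesis using True by simp
      next
        case False
        then show ?thesis using eb[of i] i by (simp add: e'_def b'_def)
      qed
      show "p i \<in> span (e' ` {..<Suc i})"
      proof (cases "i = m")
        case True
        have "p m = norm q *\<^sub>R e' m + pr" using q0 by (simp add: e'_def q_def)
        moreover have "pr \<in> span (e' ` {..<Suc m})"
          unfolding pr_def
        proof (intro span_sum span_scale)
          fix k assume "k \<in> {..<m}"
          then have "e k = e' k" "k \<in> {..<Suc m}" by (auto simp: e'_def)
          then show "e k \<in> span (e' ` {..<Suc m})" by (metis imageI span_base)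
        qed
        moreover have "e' m \<in> span (e' ` {..<Suc m})" by (intro span_base) auto
        ultimately show ?thesis using True by (auto intro: span_add span_scale)
      next
        case False
        then have "e' ` {..<Suc i} = e ` {..<Suc i}" using i by (intro image_cong) (auto simp: e'_def)
        then show ?thesis using ps[of i] False i by simp
      qed
    qed
  qed simp
  from this[OF order_refl] obtain e b where eo: "\<And>i j. i < n \<Longrightarrow> j < n \<Longrightarrow> inner (e i) (e j) = (if i = j then 1 else 0)"
      and eb: "\<And>i. i < n \<Longrightarrow> e i = (\<Sum>k<Suc i. b i k *\<^sub>R p k)"
      and ps: "\<And>i. i < n \<Longrightarrow> p i \<in> span (e ` {..<Suc i})"
    by blast
  have "inner (p k) (e i) = 0" if "i < n" "k < i" for i k
  proof -
    have "span (e ` {..<Suc k}) \<subseteq> {x. inner x (e i) = 0}"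
    proof (rule span_minimal)
      show "subspace {x. inner x (e i) = 0}" by (auto simp: subspace_def inner_add_left)
      show "e ` {..<Suc k} \<subseteq> {x. inner x (e i) = 0}" using eo that by auto
    qed
    then show ?thesis using ps[of k] that by auto
  qed
  then show ?thesis using eo eb by blast
qed

lemma half_absorb_step: "a \<le> x \<Longrightarrow> b \<le> y \<Longrightarrow> t = m + a + b / 2 \<Longrightarrow> z = m + x \<Longrightarrow> t \<le> z + y / (2::real)"
  by simp

lemma absorb_half: "y \<le> z + y / 2 \<Longrightarrow> y \<le> 2 * (z::real)"
  by simp

lemma add_last_bound: "S \<le> q \<Longrightarrow> n \<le> X + S \<Longrightarrow> S + n \<le> X + 2 * (q::real)"
  by simp

lemma divide_bound: "T \<le> k * X \<Longrightarrow> k > 0 \<Longrightarrow> 1 / k * T \<le> (X::real)"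
  by (simp add: divide_le_eq mult.commute)

text \<open>Here \<open>p i\<close> stands for \<open>\<alpha> \<cdot> D u\<^sub>i\<close> and \<open>s i\<close> for \<open>\<alpha> \<cdot> A u\<^sub>i\<close>, so that \<open>u\<^sub>i\<close> is nearly an eigenvector of
  \<open>(\<alpha> \<cdot> D)\<^sup>-\<^sup>1 (\<alpha> \<cdot> A)\<close> for the eigenvalue \<open>mu i\<close>. The second condition, boundedness of that operator on the span,
  replaces the operator itself, whose inverse factor is not defined on all of \<open>L\<^sup>2\<close>.\<close>

definition near_eigen :: "nat \<Rightarrow> (nat \<Rightarrow> real) \<Rightarrow> real \<Rightarrow> real \<Rightarrow> (nat \<Rightarrow> 'h::real_inner) \<Rightarrow> (nat \<Rightarrow> 'h) \<Rightarrow> bool" where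
  "near_eigen n mu M d p s \<longleftrightarrow> (\<forall>i<n. norm (p i) = 1 \<and> norm (mu i *\<^sub>R p i - s i) \<le> d)
    \<and> (\<forall>c. norm (\<Sum>i<n. c i *\<^sub>R s i) \<le> M * norm (\<Sum>i<n. c i *\<^sub>R p i))"

lemma near_eigen_mono: "near_eigen n mu M d' p s \<Longrightarrow> d' \<le> d \<Longrightarrow> near_eigen n mu M d p s"
  unfolding near_eigen_def by (blast intro: order_trans)

lemma near_eigen_restrict:
  assumes "near_eigen (Suc n) mu M d p s" shows "near_eigen n mu M d p s"
  unfolding near_eigen_def
proof (intro conjI allI)
  fix c
  show "norm (\<Sum>i<n. c i *\<^sub>R s i) \<le> M * norm (\<Sum>i<n. c i *\<^sub>R p i)"
    using assms[unfolded near_eigen_def, THEN conjunct2, rule_format, of "\<lambda>i. if i < n then c i else 0"] by simp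
qed (use assms in \<open>simp add: near_eigen_def\<close>)

text \<open>A quantitative form of the independence of eigenvectors to distinct eigenvalues. Subtracting
  \<open>mu n\<close> times the combination from its image eliminates the last vector up to the error \<open>\<delta>\<close>, and the
  induction hypothesis applies to the coefficients \<open>c i (mu i - mu n)\<close>.\<close>

lemma robust_independence:
  fixes mu :: "nat \<Rightarrow> real" and M :: real
  assumes "inj_on mu {..<n}" "\<forall>i<n. 0 \<le> mu i \<and> mu i \<le> 2" "M \<ge> 0"
  shows "\<exists>\<kappa>>0. \<exists>\<delta>>0. \<forall>(p :: nat \<Rightarrow> 'h::real_inner) s c. near_eigen n mu M \<delta> p s
    \<longrightarrow> \<kappa> * (\<Sum>i<n. \<bar>c i\<bar>) \<le> norm (\<Sum>i<n. c i *\<^sub>R p i)"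
  using assms(1,2)
proof (induction n)
  case 0
  show ?case by (rule exI[of _ 1]) (auto intro: exI[of _ "1 :: real"])
next
  case (Suc n)
  have "inj_on mu {..<n}" using Suc.prems(1) by (rule inj_on_subset) auto
  moreover have "\<forall>i<n. 0 \<le> mu i \<and> mu i \<le> 2" using Suc.prems(2) by auto
  ultimately obtain \<kappa> \<delta> where k: "\<kappa> > 0" "\<delta> > 0" and IH: "\<forall>(p :: nat \<Rightarrow> 'h) s c. near_eigen n mu M \<delta> p s
    \<longrightarrow> \<kappa> * (\<Sum>i<n. \<bar>c i\<bar>) \<le> norm (\<Sum>i<n. c i *\<^sub>R p i)"
    using Suc.IH by blast
  have mun: "0 \<le> mu n" "mu n \<le> 2" using Suc.prems(2) by auto
  have "\<exists>d>0. \<forall>i<n. d \<le> \<bar>mu i - mu n\<bar>"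
  proof -
    let ?S = "insert 1 ((\<lambda>i. \<bar>mu i - mu n\<bar>) ` {..<n})"
    have "\<forall>x\<in>?S. x > 0" using Suc.prems(1) by (auto simp: inj_on_def)
    then have "Min ?S > 0" by (subst Min_gr_iff) auto
    moreover have "\<forall>i<n. Min ?S \<le> \<bar>mu i - mu n\<bar>" by (auto intro!: Min_le)
    ultimately show ?thesis by blast
  qed
  then obtain d where d: "d > 0" "\<And>i. i < n \<Longrightarrow> d \<le> \<bar>mu i - mu n\<bar>" by blast
  \<comment> \<open>The bound \<open>\<kappa> d / 4\<close> lets the error term be absorbed into the left side at the end.\<close>
  define \<delta>' where "\<delta>' = min \<delta> (min 1 (\<kappa> * d / 4))"
  have \<delta>': "\<delta>' > 0" "\<delta>' \<le> \<delta>" "\<delta>' \<le> 1" "4 * \<delta>' \<le> \<kappa> * d"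
    using k d by (auto simp: \<delta>'_def min_def)
  define Q where "Q = 2 * (M + 3) / (\<kappa> * d)"
  have Q: "Q \<ge> 0" using k d assms(3) by (simp add: Q_def)
  show ?case
  proof (intro exI conjI allI impI)
    show "0 < 1 / (1 + 2 * Q)" using Q by simp
    show "0 < \<delta>'" by (rule \<delta>')
    fix p s :: "nat \<Rightarrow> 'h" and c
    assume ne: "near_eigen (Suc n) mu M \<delta>' p s"
    note ne' = ne[unfolded near_eigen_def]
    have ps: "\<forall>i<Suc n. norm (p i) = 1 \<and> norm (mu i *\<^sub>R p i - s i) \<le> \<delta>'"
      by (rule conjunct1[OF ne'])
    have M: "\<forall>c. norm (\<Sum>i<Suc n. c i *\<^sub>R s i) \<le> M * norm (\<Sum>i<Suc n. c i *\<^sub>R p i)"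
      by (rule conjunct2[OF ne'])
    have IH': "\<kappa> * (\<Sum>i<n. \<bar>c i\<bar>) \<le> norm (\<Sum>i<n. c i *\<^sub>R p i)" for c
      by (rule IH[rule_format, OF near_eigen_mono[OF near_eigen_restrict[OF ne] \<delta>'(2)]])
    define X where "X = norm (\<Sum>i<Suc n. c i *\<^sub>R p i)"
    define S where "S = (\<Sum>i<n. \<bar>c i\<bar>)"
    have S: "S \<ge> 0" by (simp add: S_def sum_nonneg)
    have X: "X \<ge> 0" by (simp add: X_def)
    have Sn: "norm (\<Sum>i<n. c i *\<^sub>R p i) \<le> S"
      unfolding S_def by (rule order_trans[OF norm_sum]) (use ps in \<open>auto intro!: sum_mono\<close>)
    have "norm (c n *\<^sub>R p n) \<le> X + norm (\<Sum>i<n. c i *\<^sub>R p i)"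
      unfolding X_def using norm_triangle_ineq4[of "\<Sum>i<Suc n. c i *\<^sub>R p i" "\<Sum>i<n. c i *\<^sub>R p i"] by simp
    then have cn: "\<bar>c n\<bar> \<le> X + S" using ps Sn by simp
    let ?r = "\<lambda>i. mu i *\<^sub>R p i - s i"
    have "(\<Sum>i<n. (c i * (mu i - mu n)) *\<^sub>R p i) = (\<Sum>i<Suc n. (c i * (mu i - mu n)) *\<^sub>R p i)"
      by simp
    also have "\<dots> = (\<Sum>i<Suc n. c i *\<^sub>R s i + c i *\<^sub>R ?r i - mu n *\<^sub>R (c i *\<^sub>R p i))"
      by (intro sum.cong refl) (simp add: algebra_simps)
    also have "\<dots> = (\<Sum>i<Suc n. c i *\<^sub>R s i) + (\<Sum>i<Suc n. c i *\<^sub>R ?r i) - mu n *\<^sub>R (\<Sum>i<Suc n. c i *\<^sub>R p i)"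
      by (simp only: sum.distrib sum_subtractf scaleR_sum_right)
    finally have eq: "(\<Sum>i<n. (c i * (mu i - mu n)) *\<^sub>R p i) = \<dots>" .
    have r: "norm (\<Sum>i<Suc n. c i *\<^sub>R ?r i) \<le> \<delta>' * (X + 2 * S)"
    proof -
      have "norm (\<Sum>i<Suc n. c i *\<^sub>R ?r i) \<le> (\<Sum>i<Suc n. \<bar>c i\<bar> * \<delta>')"
      proof (rule sum_norm_le)
        fix i assume "i \<in> {..<Suc n}"
        then have "norm (?r i) \<le> \<delta>'" using ps by blast
        then show "norm (c i *\<^sub>R ?r i) \<le> \<bar>c i\<bar> * \<delta>'" by (simp only: norm_scaleR mult_left_mono abs_ge_zero)
      qed
      also have "\<dots> = (\<Sum>i<Suc n. \<bar>c i\<bar>) * \<delta>'" by (rule sum_distrib_right[symmetric])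
      also have "\<dots> = \<delta>' * (S + \<bar>c n\<bar>)" by (simp add: S_def)
      also have "\<dots> \<le> \<delta>' * (X + 2 * S)" using cn \<delta>' by (intro mult_left_mono) auto
      finally show ?thesis .
    qed
    have "\<kappa> * d * S \<le> \<kappa> * (\<Sum>i<n. \<bar>c i * (mu i - mu n)\<bar>)"
    proof -
      have "d * S \<le> (\<Sum>i<n. \<bar>c i * (mu i - mu n)\<bar>)"
        unfolding S_def sum_distrib_left
        using d(2) by (intro sum_mono) (simp add: abs_mult mult.commute[of d] mult_left_mono)
      then show ?thesis using k by (simp add: mult.assoc)
    qed
    also have "\<dots> \<le> norm (\<Sum>i<n. (c i * (mu i - mu n)) *\<^sub>R p i)" by (rule IH')
    also have "\<dots> \<le> norm (\<Sum>i<Suc n. c i *\<^sub>R s i) + norm (\<Sum>i<Suc n. c i *\<^sub>R ?r i) + norm (mu n *\<^sub>R (\<Sum>i<Suc n. c i *\<^sub>R p i))"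
      unfolding eq by (rule order_trans[OF norm_triangle_ineq4 add_right_mono[OF norm_triangle_ineq]])
    also have "\<dots> \<le> M * X + \<delta>' * (X + 2 * S) + 2 * X"
    proof -
      have "norm (mu n *\<^sub>R (\<Sum>i<Suc n. c i *\<^sub>R p i)) \<le> 2 * X"
        using mun X by (simp add: X_def[symmetric] mult_right_mono del: sum.lessThan_Suc)
      moreover have "norm (\<Sum>i<Suc n. c i *\<^sub>R s i) \<le> M * X" unfolding X_def using M by blast
      ultimately show ?thesis using r by linarith
    qed
    also have "\<dots> \<le> (M + 3) * X + (\<kappa> * d * S) / 2"
    proof -
      have "\<delta>' * X \<le> 1 * X" using \<delta>'(3) X by (rule mult_right_mono)
      moreover have "4 * \<delta>' * S \<le> \<kappa> * d * S" using \<delta>'(4) S by (rule mult_right_mono)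
      moreover have "M * X + \<delta>' * (X + 2 * S) + 2 * X = (M + 2) * X + \<delta>' * X + (4 * \<delta>' * S) / 2"
        by (simp add: distrib_left distrib_right)
      moreover have "(M + 3) * X = (M + 2) * X + 1 * X" by (simp add: distrib_right)
      ultimately show ?thesis by (rule half_absorb_step)
    qed
    finally have "\<kappa> * d * S \<le> (M + 3) * X + (\<kappa> * d * S) / 2" .
    then have "\<kappa> * d * S \<le> 2 * ((M + 3) * X)" by (rule absorb_half)
    moreover have kd: "\<kappa> * d > 0" using k d by simp
    ultimately have "S \<le> 2 * ((M + 3) * X) / (\<kappa> * d)"
      by (subst pos_le_divide_eq[OF kd]) (simp only: mult.commute)
    then have SQ: "S \<le> Q * X" by (simp only: Q_def times_divide_eq_left mult.assoc)
    have "(\<Sum>i<Suc n. \<bar>c i\<bar>) = S + \<bar>c n\<bar>" by (simp add: S_def)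
    also have "\<dots> \<le> X + 2 * (Q * X)" using SQ cn by (rule add_last_bound)
    also have "\<dots> = (1 + 2 * Q) * X" by (simp add: distrib_right)
    finally have "(\<Sum>i<Suc n. \<bar>c i\<bar>) \<le> (1 + 2 * Q) * X" .
    then have "(\<Sum>i<Suc n. \<bar>c i\<bar>) \<le> (1 + 2 * Q) * norm (\<Sum>i<Suc n. c i *\<^sub>R p i)"
      unfolding X_def .
    moreover have "1 + 2 * Q > 0" using Q by simp
    ultimately show "1 / (1 + 2 * Q) * (\<Sum>i<Suc n. \<bar>c i\<bar>) \<le> norm (\<Sum>i<Suc n. c i *\<^sub>R p i)"
      by (rule divide_bound)
  qed
qed

text \<open>After triangular orthonormalisation the diagonal entries of the matrix of \<open>p i \<mapsto> s i\<close> are still the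
  numbers \<open>mu i \<ge> 1\<close>, up to an error that the bound on the coefficients keeps below \<open>1/2\<close>.\<close>

lemma approximate_eigenvectors:
  fixes mu :: "nat \<Rightarrow> real" and M :: real
  assumes "inj_on mu {..<n}" "\<And>i. i < n \<Longrightarrow> 1 \<le> mu i \<and> mu i \<le> 2" "M \<ge> 0"
  shows "\<exists>\<delta>>0. \<forall>p s :: nat \<Rightarrow> 'h::real_inner. near_eigen n mu M \<delta> p s
    \<longrightarrow> (\<exists>b. (\<forall>i<n. \<forall>j<n. inner (\<Sum>k<Suc i. b i k *\<^sub>R p k) (\<Sum>k<Suc j. b j k *\<^sub>R p k) = (if i = j then 1 else 0))
          \<and> (\<forall>i<n. norm (\<Sum>k<Suc i. b i k *\<^sub>R s k) \<ge> 1 / 2))"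
proof -
  have "\<forall>i<n. 0 \<le> mu i \<and> mu i \<le> 2" using assms(2) by force
  from robust_independence[OF assms(1) this assms(3), where 'h = 'h]
  obtain \<kappa> \<delta> where k: "\<kappa> > 0" "\<delta> > 0" and R: "\<forall>(p :: nat \<Rightarrow> 'h) s c. near_eigen n mu M \<delta> p s
    \<longrightarrow> \<kappa> * (\<Sum>i<n. \<bar>c i\<bar>) \<le> norm (\<Sum>i<n. c i *\<^sub>R p i)"
    by blast
  define \<delta>' where "\<delta>' = min \<delta> (\<kappa> / 2)"
  have \<delta>': "\<delta>' > 0" "\<delta>' \<le> \<delta>" "\<delta>' \<le> \<kappa> / 2" using k by (auto simp: \<delta>'_def)
  show ?thesis
  proof (rule exI[of _ \<delta>'], rule conjI, rule \<delta>'(1), intro allI impI)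
    fix p s :: "nat \<Rightarrow> 'h"
    assume ne: "near_eigen n mu M \<delta>' p s"
    have ps: "\<forall>i<n. norm (p i) = 1 \<and> norm (mu i *\<^sub>R p i - s i) \<le> \<delta>'"
      by (rule conjunct1[OF ne[unfolded near_eigen_def]])
    have ind: "\<kappa> * (\<Sum>i<n. \<bar>c i\<bar>) \<le> norm (\<Sum>i<n. c i *\<^sub>R p i)" for c
      by (rule R[rule_format, OF near_eigen_mono[OF ne \<delta>'(2)]])
    have "\<forall>c. (\<Sum>i<n. c i *\<^sub>R p i) = 0 \<longrightarrow> (\<forall>i<n. c i = 0)"
    proof (rule allI, rule impI)
      fix c assume c0: "(\<Sum>i<n. c i *\<^sub>R p i) = 0"
      have "\<kappa> * (\<Sum>i<n. \<bar>c i\<bar>) \<le> 0" using ind[of c] unfolding c0 norm_zero .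
      then have "(\<Sum>i<n. \<bar>c i\<bar>) \<le> 0" using k(1) by (simp add: mult_le_0_iff)
      then have "(\<Sum>i<n. \<bar>c i\<bar>) = 0" by (simp add: sum_nonneg order_antisym)
      then show "\<forall>i<n. c i = 0" by (simp add: sum_nonneg_eq_0_iff)
    qed
    from triangular_gram_schmidt[OF this] obtain e b where
      eo0: "\<forall>i<n. \<forall>j<n. inner (e i) (e j) = (if i = j then 1 else 0)"
      and eb0: "\<forall>i<n. e i = (\<Sum>k<Suc i. b i k *\<^sub>R p k)"
      and ep0: "\<forall>i<n. \<forall>k<i. inner (p k) (e i) = 0"
      by (elim exE conjE) (rule that)
    note eo = eo0[rule_format] and eb = eb0[rule_format] and ep = ep0[rule_format]
    have "norm (\<Sum>k<Suc i. b i k *\<^sub>R s k) \<ge> 1 / 2" if i: "i < n" for i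
    proof -
      have ne: "norm (e i) = 1" using eo[OF i i] by (simp add: norm_eq_1)
      have 1: "b i i * inner (p i) (e i) = 1"
      proof -
        have "1 = inner (\<Sum>k<Suc i. b i k *\<^sub>R p k) (e i)" using eo[OF i i] eb[OF i] by simp
        also have "\<dots> = b i i * inner (p i) (e i)"
          by (simp add: inner_sum_left inner_add_left ep[OF i])
        finally show ?thesis by simp
      qed
      have "\<kappa> * (\<Sum>k<Suc i. \<bar>b i k\<bar>) \<le> 1"
      proof -
        let ?c = "\<lambda>k. if k < Suc i then b i k else 0"
        have "(\<Sum>k<n. \<bar>?c k\<bar>) = (\<Sum>k<Suc i. \<bar>?c k\<bar>)" "(\<Sum>k<n. ?c k *\<^sub>R p k) = (\<Sum>k<Suc i. ?c k *\<^sub>R p k)"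
          by (rule sum.mono_neutral_right; use i in auto)+
        moreover have "(\<Sum>k<Suc i. ?c k *\<^sub>R p k) = e i" "(\<Sum>k<Suc i. \<bar>?c k\<bar>) = (\<Sum>k<Suc i. \<bar>b i k\<bar>)"
          using eb[OF i] by simp_all
        ultimately show ?thesis using ind[of ?c] ne by simp
      qed
      then have B: "(\<Sum>k<Suc i. \<bar>b i k\<bar>) * \<delta>' \<le> 1 / 2"
      proof -
        have "(\<Sum>k<Suc i. \<bar>b i k\<bar>) * \<delta>' \<le> (\<Sum>k<Suc i. \<bar>b i k\<bar>) * (\<kappa> / 2)"
          using \<delta>' by (intro mult_left_mono sum_nonneg) auto
        also have "\<dots> = \<kappa> * (\<Sum>k<Suc i. \<bar>b i k\<bar>) / 2" by simp
        finally show ?thesis using \<open>\<kappa> * _ \<le> 1\<close> by linarith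
      qed
      let ?r = "\<lambda>k. mu k *\<^sub>R p k - s k"
      have "inner (\<Sum>k<Suc i. b i k *\<^sub>R (mu k *\<^sub>R p k)) (e i) = mu i * (b i i * inner (p i) (e i))"
        by (simp add: inner_sum_left inner_add_left ep[OF i])
      then have "mu i = inner (\<Sum>k<Suc i. b i k *\<^sub>R (mu k *\<^sub>R p k)) (e i)" using 1 by simp
      also have "(\<Sum>k<Suc i. b i k *\<^sub>R (mu k *\<^sub>R p k)) = (\<Sum>k<Suc i. b i k *\<^sub>R s k) + (\<Sum>k<Suc i. b i k *\<^sub>R ?r k)"
        unfolding sum.distrib[symmetric] by (intro sum.cong refl) (simp add: algebra_simps)
      also have "inner \<dots> (e i) \<le> norm ((\<Sum>k<Suc i. b i k *\<^sub>R s k) + (\<Sum>k<Suc i. b i k *\<^sub>R ?r k)) * norm (e i)"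
        by (rule norm_cauchy_schwarz)
      also have "\<dots> \<le> norm (\<Sum>k<Suc i. b i k *\<^sub>R s k) + norm (\<Sum>k<Suc i. b i k *\<^sub>R ?r k)"
        unfolding ne by (simp add: norm_triangle_ineq del: sum.lessThan_Suc)
      also have "norm (\<Sum>k<Suc i. b i k *\<^sub>R ?r k) \<le> (\<Sum>k<Suc i. \<bar>b i k\<bar> * \<delta>')"
      proof (rule sum_norm_le)
        fix k assume "k \<in> {..<Suc i}"
        then have "norm (?r k) \<le> \<delta>'" using ps i by (meson lessThan_iff less_Suc_eq_le le_less_trans)
        then show "norm (b i k *\<^sub>R ?r k) \<le> \<bar>b i k\<bar> * \<delta>'" by (simp only: norm_scaleR mult_left_mono abs_ge_zero)
      qed
      also have "(\<Sum>k<Suc i. \<bar>b i k\<bar> * \<delta>') \<le> 1 / 2" using B by (simp only: sum_distrib_right)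
      finally show ?thesis using assms(2)[OF i] by linarith
    qed
    moreover have "inner (\<Sum>k<Suc i. b i k *\<^sub>R p k) (\<Sum>k<Suc j. b j k *\<^sub>R p k) = (if i = j then 1 else 0)"
      if "i < n" "j < n" for i j
      using eo[OF that] unfolding eb[OF that(1)] eb[OF that(2)] .
    ultimately show "\<exists>b. (\<forall>i<n. \<forall>j<n. inner (\<Sum>k<Suc i. b i k *\<^sub>R p k) (\<Sum>k<Suc j. b j k *\<^sub>R p k) = (if i = j then 1 else 0))
          \<and> (\<forall>i<n. norm (\<Sum>k<Suc i. b i k *\<^sub>R s k) \<ge> 1 / 2)"
      by (intro exI[of _ b] conjI allI impI)
  qed
qed

section \<open>Dimension bound and generic triviality of the kernel\<close>

definition bound_const :: real where
  "bound_const = 18 * sqrt (18 * cube_const)"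

text \<open>On the kernel \<open>\<alpha> \<cdot> D\<close> and \<open>\<alpha> \<cdot> A\<close> agree, so that orthonormalising the images under \<open>\<alpha> \<cdot> D\<close>
  makes the left side of \<open>potential_bound\<close> equal to \<open>n\<close>.\<close>

lemma kernel_family_bound:
  fixes n :: nat
  assumes v: "\<And>i. i < n \<Longrightarrow> v i \<in> H1_l2" and k: "\<And>i. i < n \<Longrightarrow> kinetic (v i) = pot_op A (v i)"
    and ind: "\<And>c. (\<Sum>i<n. c i *\<^sub>R v i) = 0 \<Longrightarrow> \<forall>i<n. c i = 0"
  shows "n \<le> bound_const * cube_int A"
proof -
  have sums: "(\<Sum>i<m. c i *\<^sub>R v i) \<in> H1_l2" "kinetic (\<Sum>i<m. c i *\<^sub>R v i) = (\<Sum>i<m. c i *\<^sub>R kinetic (v i))"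
    "pot_op A (\<Sum>i<m. c i *\<^sub>R v i) = kinetic (\<Sum>i<m. c i *\<^sub>R v i)" if "m \<le> n" for c m
  proof -
    have vm: "v i \<in> H1_l2" if "i \<in> {..<m}" for i using v that \<open>m \<le> n\<close> by simp
    show "(\<Sum>i<m. c i *\<^sub>R v i) \<in> H1_l2"
      using vm by (intro subspace_sum subspace_scale H1_l2_subspace)
    show P: "kinetic (\<Sum>i<m. c i *\<^sub>R v i) = (\<Sum>i<m. c i *\<^sub>R kinetic (v i))" by (rule kinetic_sum[OF vm])
    have "pot_op A (\<Sum>i<m. c i *\<^sub>R v i) = (\<Sum>i<m. c i *\<^sub>R pot_op A (v i))" by (rule pot_op_sum[OF vm])
    also have "\<dots> = (\<Sum>i<m. c i *\<^sub>R kinetic (v i))" using k that by (intro sum.cong) auto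
    finally show "pot_op A (\<Sum>i<m. c i *\<^sub>R v i) = kinetic (\<Sum>i<m. c i *\<^sub>R v i)" unfolding P .
  qed
  have "\<forall>c. (\<Sum>i<n. c i *\<^sub>R kinetic (v i)) = 0 \<longrightarrow> (\<forall>i<n. c i = 0)"
  proof (rule allI, rule impI)
    fix c assume c: "(\<Sum>i<n. c i *\<^sub>R kinetic (v i)) = 0"
    have "kinetic (\<Sum>i<n. c i *\<^sub>R v i) = 0" unfolding sums(2)[OF order_refl] by (rule c)
    then have "(\<Sum>i<n. c i *\<^sub>R v i) = 0" by (rule kinetic_injective[OF sums(1)[OF order_refl]])
    then show "\<forall>i<n. c i = 0" by (rule ind)
  qed
  from triangular_gram_schmidt[OF this] obtain e b where
      eo: "\<forall>i<n. \<forall>j<n. inner (e i) (e j) = (if i = j then 1 else 0)"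
      and eb: "\<forall>i<n. e i = (\<Sum>k<Suc i. b i k *\<^sub>R kinetic (v k))"
    by (elim exE conjE) (rule that)
  define w where "w i = (\<Sum>k<Suc i. b i k *\<^sub>R v k)" for i
  have w: "w i \<in> H1_l2" "kinetic (w i) = e i" "pot_op A (w i) = e i" if "i < n" for i
  proof -
    show "w i \<in> H1_l2" unfolding w_def by (rule sums(1)) (use that in simp)
    have "kinetic (w i) = (\<Sum>k<Suc i. b i k *\<^sub>R kinetic (v k))" unfolding w_def by (rule sums(2)) (use that in simp)
    then show P: "kinetic (w i) = e i" using eb[rule_format, OF that] by (simp only:)
    have "pot_op A (w i) = kinetic (w i)" unfolding w_def by (rule sums(3)) (use that in simp)
    then show "pot_op A (w i) = e i" using P by simp
  qed
  \<comment> \<open>With this \<open>s\<close> the term with \<open>n\<close> on the right is \<open>n / 2\<close>.\<close>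
  define s where "s = sqrt (18 * cube_const)"
  have s: "s > 0" "s\<^sup>2 = 18 * cube_const" using cube_const_pos by (auto simp: s_def)
  have ne: "norm (pot_op A (w i)) ^ 2 = 1" if "i < n" for i
    using eo that by (simp add: w(3) power2_norm_eq_inner)
  have "real n = (\<Sum>i<n. norm (pot_op A (w i)) ^ 2)" by (simp add: ne)
  also have "\<dots> \<le> 9 * (s * cube_int A + cube_const * n / s\<^sup>2)"
    by (rule potential_bound) (use w eo s in auto)
  also have "\<dots> = 9 * s * cube_int A + n / 2" using cube_const_pos by (simp add: s(2))
  finally have "real n \<le> 18 * s * cube_int A" by linarith
  then show ?thesis by (simp add: bound_const_def s_def)
qed

lemma cube_int_norm: "cube_int A = norm A ^ 3"
  unfolding cube_int_def norm_vecpot.rep_eq by (simp add: integral_norm_pow_nonneg)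

definition trivial_kernel_pots :: "vecpot set" where
  "trivial_kernel_pots = {A. \<forall>v\<in>H1_l2. kinetic v = pot_op A v \<longrightarrow> v = 0}"

text \<open>Arbitrarily close to a potential outside the interior there are potentials with exact kernel
  elements, and for the original potential these are the approximate eigenvectors.\<close>

lemma trivial_kernel_pots_interior_dense: "closure (interior trivial_kernel_pots) = UNIV"
proof (rule ccontr)
  assume "closure (interior trivial_kernel_pots) \<noteq> UNIV"
  then obtain A where "A \<notin> closure (interior trivial_kernel_pots)" by blast
  then obtain \<epsilon> where eps: "\<epsilon> > 0" "\<And>B. dist B A < \<epsilon> \<Longrightarrow> B \<notin> interior trivial_kernel_pots"
    by (auto simp: closure_approachable)
  \<comment> \<open>With this \<open>\<sigma>\<close> the term with \<open>n\<close> in \<open>potential_bound\<close> is \<open>n / 8\<close>, half of the lower bound \<open>n / 4\<close>.\<close>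
  define \<sigma> where "\<sigma> = sqrt (72 * cube_const)"
  have \<sigma>: "\<sigma> > 0" "\<sigma>\<^sup>2 = 72 * cube_const" using cube_const_pos by (auto simp: \<sigma>_def)
  obtain n :: nat where n: "n > 72 * \<sigma> * cube_int A" using reals_Archimedean2 by blast
  \<comment> \<open>The couplings \<open>t i\<close> lie in \<open>[1/2, 1)\<close> and so close to \<open>1\<close> that \<open>t i *\<^sub>R A\<close> is in the ball around \<open>A\<close>.\<close>
  define \<theta> where "\<theta> = min (1 / 2) (\<epsilon> / (2 * (norm A + 1)))"
  have th: "\<theta> > 0" "\<theta> \<le> 1 / 2" "\<theta> * norm A < \<epsilon>"
  proof -
    have N: "norm A + 1 > 0" by (simp add: add_nonneg_pos)
    show "\<theta> > 0" using eps N by (simp add: \<theta>_def)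
    show "\<theta> \<le> 1 / 2" unfolding \<theta>_def by (rule min.cobounded1)
    have "\<theta> * norm A \<le> \<epsilon> / (2 * (norm A + 1)) * (norm A + 1)"
      using eps N by (intro mult_mono) (auto simp: \<theta>_def)
    also have "\<dots> = \<epsilon> / 2"
    proof -
      have "\<epsilon> / (2 * k) * k = \<epsilon> / 2" if "k > 0" for k :: real using that by simp
      then show ?thesis using N by blast
    qed
    finally show "\<theta> * norm A < \<epsilon>" using eps by simp
  qed
  define t where "t i = 1 - \<theta> / real (Suc i)" for i
  have thi: "0 < \<theta> / real (Suc i)" "\<theta> / real (Suc i) \<le> \<theta>" for i
    using th by (auto simp: field_simps)
  have t: "1 / 2 \<le> t i" "t i < 1" for i using thi[of i] th(2) by (auto simp: t_def)
  define mu where "mu i = 1 / t i" for i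
  have mu: "1 \<le> mu i \<and> mu i \<le> 2" for i using t[of i] by (simp add: mu_def field_simps)
  have inj: "inj_on mu {..<n}"
  proof (rule inj_onI)
    fix i j assume "mu i = mu j"
    then have "t i = t j" using t(1)[of i] t(1)[of j] by (simp add: mu_def)
    then show "i = j" using th(1) by (simp add: t_def)
  qed
  define M where "M = sqrt (9 * (1 * cube_int A + cube_const / 1\<^sup>2))"
  have M0: "M \<ge> 0" using cube_int_nonneg[of A] cube_const_pos by (simp add: M_def)
  have M: "norm (pot_op A u) \<le> M * norm (kinetic u)" if "u \<in> H1_l2" for u
  proof -
    have "norm (pot_op A u) ^ 2 \<le> (M * norm (kinetic u)) ^ 2"
      using potential_relative_bound[OF that, of 1 A] cube_int_nonneg[of A] cube_const_pos by (simp add: M_def power_mult_distrib)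
    then show ?thesis using M0 by (simp add: power2_le_iff_abs_le)
  qed
  have "\<And>i. i < n \<Longrightarrow> 1 \<le> mu i \<and> mu i \<le> 2" using mu by blast
  then obtain \<delta> where d: "\<delta> > 0" and approx: "\<forall>p s :: nat \<Rightarrow> l2. near_eigen n mu M \<delta> p s
    \<longrightarrow> (\<exists>b. (\<forall>i<n. \<forall>j<n. inner (\<Sum>k<Suc i. b i k *\<^sub>R p k) (\<Sum>k<Suc j. b j k *\<^sub>R p k) = (if i = j then 1 else 0))
          \<and> (\<forall>i<n. norm (\<Sum>k<Suc i. b i k *\<^sub>R s k) \<ge> 1 / 2))"
    using approximate_eigenvectors[of mu n M, where 'h = l2, OF inj _ M0] by blast
  \<comment> \<open>The relative bound of a potential tends to \<open>0\<close> with its norm; \<open>S\<close> balances the two terms.\<close>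
  have "\<exists>\<zeta>>0. \<forall>B u. norm B < \<zeta> \<longrightarrow> u \<in> H1_l2 \<longrightarrow> norm (pot_op B u) \<le> \<delta> / 2 * norm (kinetic u)"
  proof -
    define S where "S = sqrt (72 * cube_const) / \<delta>"
    have S: "S > 0" "S\<^sup>2 = 72 * cube_const / \<delta>\<^sup>2" using cube_const_pos d by (auto simp: S_def power_divide)
    define z where "z = min 1 (\<delta>\<^sup>2 / (72 * S))"
    have z: "z > 0" "z \<le> 1" "z \<le> \<delta>\<^sup>2 / (72 * S)" using S d by (auto simp: z_def)
    have "norm (pot_op B u) \<le> \<delta> / 2 * norm (kinetic u)" if "norm B < z" "u \<in> H1_l2" for B u
    proof -
      have "norm B ^ 3 \<le> norm B * 1"
        using that z(2) by (simp add: power3_eq_cube mult.assoc mult_left_le mult_le_one)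
      then have "cube_int B \<le> \<delta>\<^sup>2 / (72 * S)" using that z(3) unfolding cube_int_norm by linarith
      then have "S * cube_int B \<le> \<delta>\<^sup>2 / 72" using S(1) by (simp add: field_simps)
      moreover have "cube_const / S\<^sup>2 = \<delta>\<^sup>2 / 72" using cube_const_pos d by (simp add: S(2))
      ultimately have "9 * (S * cube_int B + cube_const / S\<^sup>2) \<le> \<delta>\<^sup>2 / 4" by simp
      then have "9 * (S * cube_int B + cube_const / S\<^sup>2) * norm (kinetic u) ^ 2 \<le> \<delta>\<^sup>2 / 4 * norm (kinetic u) ^ 2"
        by (intro mult_right_mono) auto
      then have "norm (pot_op B u) ^ 2 \<le> (\<delta> / 2 * norm (kinetic u)) ^ 2"
        using potential_relative_bound[OF that(2) S(1), of B] by (simp add: power_mult_distrib power_divide)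
      then show ?thesis using d by (simp add: power2_le_iff_abs_le)
    qed
    then show ?thesis using z(1) by blast
  qed
  then obtain \<zeta> where z: "\<zeta> > 0" "\<And>B u. norm B < \<zeta> \<Longrightarrow> u \<in> H1_l2 \<Longrightarrow> norm (pot_op B u) \<le> \<delta> / 2 * norm (kinetic u)"
    by blast
  have "\<exists>u. u \<in> H1_l2 \<and> norm (kinetic u) = 1 \<and> norm (mu i *\<^sub>R kinetic u - pot_op A u) \<le> \<delta>" for i
  proof -
    have "norm (t i *\<^sub>R A - A) = \<bar>t i - 1\<bar> * norm A"
      by (metis norm_scaleR scaleR_diff_left scaleR_one)
    also have "\<dots> \<le> \<theta> * norm A" using thi[of i] by (intro mult_right_mono) (auto simp: t_def)
    finally have "dist (t i *\<^sub>R A) A < \<epsilon>" using th(3) by (simp add: dist_norm)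
    then have "t i *\<^sub>R A \<notin> interior trivial_kernel_pots" by (rule eps(2))
    then have "\<not> ball (t i *\<^sub>R A) \<zeta> \<subseteq> trivial_kernel_pots" using z(1) by (auto simp: mem_interior)
    then obtain B where B: "dist (t i *\<^sub>R A) B < \<zeta>" "B \<notin> trivial_kernel_pots"
      unfolding subset_eq Ball_def mem_ball by blast
    then obtain v where v: "v \<in> H1_l2" "kinetic v = pot_op B v" "v \<noteq> 0" by (auto simp: trivial_kernel_pots_def)
    then have P: "kinetic v \<noteq> 0" using kinetic_injective by blast
    define u where "u = (1 / norm (kinetic v)) *\<^sub>R v"
    have u: "u \<in> H1_l2" "norm (kinetic u) = 1" "kinetic u = pot_op B u"
      using v P by (simp_all add: u_def subspace_scale[OF H1_l2_subspace] kinetic_scaleR pot_op_scaleR)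
    have "norm (pot_op (B - t i *\<^sub>R A) u) \<le> \<delta> / 2 * norm (kinetic u)"
      by (rule z(2)) (use B u in \<open>auto simp: dist_norm norm_minus_commute\<close>)
    then have "norm (kinetic u - t i *\<^sub>R pot_op A u) \<le> \<delta> / 2" using u by (simp add: pot_op_diff_scaleR)
    moreover have "mu i *\<^sub>R kinetic u - pot_op A u = mu i *\<^sub>R (kinetic u - t i *\<^sub>R pot_op A u)"
      using t(1)[of i] by (simp add: mu_def scaleR_diff_right)
    ultimately have "norm (mu i *\<^sub>R kinetic u - pot_op A u) \<le> 2 * (\<delta> / 2)"
      using mu[of i] by (simp only: norm_scaleR) (intro mult_mono, auto)
    then show ?thesis using u by auto
  qed
  then obtain u where u: "\<And>i. u i \<in> H1_l2" "\<And>i. norm (kinetic (u i)) = 1"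
    "\<And>i. norm (mu i *\<^sub>R kinetic (u i) - pot_op A (u i)) \<le> \<delta>" by metis
  have sums: "(\<Sum>i<m. c i *\<^sub>R u i) \<in> H1_l2" "kinetic (\<Sum>i<m. c i *\<^sub>R u i) = (\<Sum>i<m. c i *\<^sub>R kinetic (u i))"
    "pot_op A (\<Sum>i<m. c i *\<^sub>R u i) = (\<Sum>i<m. c i *\<^sub>R pot_op A (u i))" for c m
    using u(1) by (auto intro: kinetic_sum pot_op_sum intro!: subspace_sum subspace_scale H1_l2_subspace)
  have "\<forall>c. norm (\<Sum>i<n. c i *\<^sub>R pot_op A (u i)) \<le> M * norm (\<Sum>i<n. c i *\<^sub>R kinetic (u i))"
    unfolding sums(2,3)[symmetric] using M[OF sums(1)] by blast
  moreover have "\<forall>i<n. norm (kinetic (u i)) = 1 \<and> norm (mu i *\<^sub>R kinetic (u i) - pot_op A (u i)) \<le> \<delta>"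
    using u by blast
  ultimately have "near_eigen n mu M \<delta> (\<lambda>i. kinetic (u i)) (\<lambda>i. pot_op A (u i))"
    by (simp only: near_eigen_def simp_thms)
  from approx[rule_format, OF this]
  obtain b where b1: "\<forall>i<n. \<forall>j<n. inner (\<Sum>k<Suc i. b i k *\<^sub>R kinetic (u k)) (\<Sum>k<Suc j. b j k *\<^sub>R kinetic (u k)) = (if i = j then 1 else 0)"
    and b2: "\<forall>i<n. norm (\<Sum>k<Suc i. b i k *\<^sub>R pot_op A (u k)) \<ge> 1 / 2"
    by (elim exE conjE) (rule that)
  define w where "w i = (\<Sum>k<Suc i. b i k *\<^sub>R u k)" for i
  have w: "w i \<in> H1_l2" for i unfolding w_def by (rule sums)
  have wo: "inner (kinetic (w i)) (kinetic (w j)) = (if i = j then 1 else 0)" if "i < n" "j < n" for i j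
    unfolding w_def sums(2) using b1 that by blast
  have ws: "norm (pot_op A (w i)) \<ge> 1 / 2" if "i < n" for i
    unfolding w_def sums(3) using b2 that by blast
  have "real n / 4 = (\<Sum>i<n. (1 / 2)\<^sup>2)" by (simp add: power2_eq_square)
  also have "\<dots> \<le> (\<Sum>i<n. norm (pot_op A (w i)) ^ 2)"
    using ws by (intro sum_mono power_mono) auto
  also have "\<dots> \<le> 9 * (\<sigma> * cube_int A + cube_const * n / \<sigma>\<^sup>2)"
    by (rule potential_bound[OF w wo \<sigma>(1)])
  also have "\<dots> = 9 * \<sigma> * cube_int A + n / 8" using cube_const_pos by (simp add: \<sigma>(2))
  finally have "n \<le> 72 * \<sigma> * cube_int A" by simp
  then show False using n by simp
qed

section \<open>The kernels of the magnetic Dirac operator\<close>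

lemma field_of_surj: "Lp 2 u \<Longrightarrow> field_of (Abs_l2 u) = u"
  by (simp add: Abs_l2_inverse)

lemma H1_eq: "H1 = field_of ` H1_l2"
proof
  show "H1 \<subseteq> field_of ` H1_l2"
  proof
    fix u assume "u \<in> H1"
    then have u: "Lp 2 u" and g: "\<forall>j. \<exists>g. Lp 2 g \<and> weak_partial j u g" by (auto simp: H1_def)
    have "\<exists>g. weak_deriv j (Abs_l2 u) g" for j
    proof -
      obtain g where "Lp 2 g" "weak_partial j u g" using g by blast
      then have "weak_deriv j (Abs_l2 u) (Abs_l2 g)" using u by (simp add: weak_deriv_def field_of_surj)
      then show ?thesis ..
    qed
    then have "Abs_l2 u \<in> H1_l2" by (simp add: H1_l2_def)
    then show "u \<in> field_of ` H1_l2" using field_of_surj[OF u] by (metis imageI)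
  qed
  show "field_of ` H1_l2 \<subseteq> H1"
  proof
    fix u assume "u \<in> field_of ` H1_l2"
    then obtain v where v: "v \<in> H1_l2" "u = field_of v" by blast
    have "Lp 2 (field_of (wderiv j v)) \<and> weak_partial j u (field_of (wderiv j v))" for j
      using weak_deriv_wderiv[OF v(1), of j] by (simp add: v(2) weak_deriv_def)
    then have "\<forall>j. \<exists>g. Lp 2 g \<and> weak_partial j u g" by blast
    then show "u \<in> H1" by (simp add: H1_def v(2))
  qed
qed

lemma sobolev_partial_eq:
  assumes "v \<in> H1_l2" shows "sobolev_partial j (field_of v) = field_of (wderiv j v)"
  unfolding sobolev_partial_def
proof (rule the_equality)
  show "Lp 2 (field_of (wderiv j v)) \<and> weak_partial j (field_of v) (field_of (wderiv j v))"
    using weak_deriv_wderiv[OF assms] by (simp add: weak_deriv_def)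
  fix g assume g: "Lp 2 g \<and> weak_partial j (field_of v) g"
  then have "weak_deriv j v (Abs_l2 g)" by (simp add: weak_deriv_def field_of_surj)
  then have "wderiv j v = Abs_l2 g" by (rule wderiv_eq)
  then show "g = field_of (wderiv j v)" using g by (simp add: field_of_surj)
qed

lemma scaleC_abs: "f \<in> borel_measurable lborel \<Longrightarrow> c *\<^sub>C abs_mfun f = abs_mfun (\<lambda>x. c *s f x)"
  by (rule scaleC.abs_eq) (simp add: ae_eq_refl_iff)

lemma alpha_momentum:
  assumes "v \<in> H1_l2"
  shows "matrix_mult (dirac_alpha j) (momentum j (field_of v)) = field_of (mat_act (momentum_mat j) (wderiv j v))"
proof -
  have N: "dirac_alpha j *v ((1 / \<i>) *s y) = momentum_mat j *v y" for y
    by (simp add: vec_eq_iff matrix_vector_mult_def momentum_mat_def mult_ac)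
  have "matrix_mult (dirac_alpha j) (momentum j (field_of v))
      = matrix_mult (dirac_alpha j) ((1 / \<i>) *\<^sub>C abs_mfun (fun_of (wderiv j v)))"
    by (simp only: momentum_def sobolev_partial_eq[OF assms] abs_fun_of)
  also have "\<dots> = matrix_mult (dirac_alpha j) (abs_mfun (\<lambda>x. (1 / \<i>) *s fun_of (wderiv j v) x))"
    by (simp only: scaleC_abs[OF fun_of_measurable])
  also have "\<dots> = abs_mfun (\<lambda>x. dirac_alpha j *v ((1 / \<i>) *s fun_of (wderiv j v) x))"
    by (rule matrix_mult_abs) (rule borel_measurable_cscale[OF fun_of_measurable])
  also have "\<dots> = abs_mfun (\<lambda>x. momentum_mat j *v fun_of (wderiv j v) x)"
    by (simp only: N)
  also have "\<dots> = matrix_mult (momentum_mat j) (abs_mfun (fun_of (wderiv j v)))"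
    by (rule matrix_mult_abs[symmetric]) (rule fun_of_measurable)
  finally show ?thesis by (simp add: mat_act.rep_eq)
qed

lemma magnetic_dirac_eq:
  assumes "v \<in> H1_l2"
  shows "magnetic_dirac m A (field_of v) = field_of (kinetic v + m *\<^sub>R mat_act dirac_beta v - pot_op A v)"
  unfolding magnetic_dirac_def free_dirac_def alpha_momentum[OF assms]
  by (simp add: kinetic_def sum_3 plus_l2.rep_eq minus_l2.rep_eq scaleR_l2.rep_eq mat_act.rep_eq field_of_pot_op[OF assms])

lemma beta_alpha_v: "dirac_beta *v (dirac_alpha j *v v) = (- 1) *\<^sub>R (dirac_alpha j *v (dirac_beta *v v))"
proof -
  have "(- M) *v v = - (M *v v)" for M :: "complex^4^4"
    by (simp add: vec_eq_iff matrix_vector_mult_def sum_negf)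
  then show ?thesis by (simp add: matrix_vector_mul_assoc beta_alpha)
qed

lemma gamma5_alpha_v: "gamma5 *v (dirac_alpha j *v v) = 1 *\<^sub>R (dirac_alpha j *v (gamma5 *v v))"
  by (simp add: matrix_vector_mul_assoc gamma5_alpha)

lemma kinetic_beta: "v \<in> H1_l2 \<Longrightarrow> kinetic (mat_act dirac_beta v) = - mat_act dirac_beta (kinetic v)"
  by (simp add: kinetic_def wderiv_mat_act mat_act_mat_act linear_sum[OF linear_mat_act] beta_momentum_mat mat_act_uminus sum_negf)

lemma kinetic_gamma5: "v \<in> H1_l2 \<Longrightarrow> kinetic (mat_act gamma5 v) = mat_act gamma5 (kinetic v)"
  by (simp add: kinetic_def wderiv_mat_act mat_act_mat_act linear_sum[OF linear_mat_act] gamma5_momentum_mat)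

lemma pot_op_beta: "v \<in> H1_l2 \<Longrightarrow> pot_op A (mat_act dirac_beta v) = - mat_act dirac_beta (pot_op A v)"
  using pot_op_mat_act[OF _ beta_alpha_v, of v A] by simp

lemma pot_op_gamma5: "v \<in> H1_l2 \<Longrightarrow> pot_op A (mat_act gamma5 v) = mat_act gamma5 (pot_op A v)"
  using pot_op_mat_act[OF _ gamma5_alpha_v, of v A] by simp

text \<open>For \<open>e = \<plusminus>1\<close> these are the kernels of \<open>H\<^sub>A \<mp> m\<close>, see \<open>dirac_ker_eq\<close>.\<close>

definition chiral_ker :: "vecpot \<Rightarrow> real \<Rightarrow> l2 set" where
  "chiral_ker A e = {v \<in> H1_l2. mat_act dirac_beta v = e *\<^sub>R v \<and> kinetic v = pot_op A v}"

text \<open>The component \<open>w = v - e \<beta> v\<close> satisfies \<open>T w = 0\<close> and \<open>T v = e m w\<close>, hence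
  \<open>e m \<parallel>w\<parallel>\<^sup>2 = \<langle>T v, w\<rangle> = \<langle>v, T w\<rangle> = 0\<close>.\<close>

lemma dirac_ker_eq:
  assumes m: "m > 0" and e: "e = 1 \<or> e = -1"
  shows "dirac_ker m A (e * m) = field_of ` chiral_ker A e"
proof -
  have zero: "field_of x = 0 \<longleftrightarrow> x = 0" for x
    by (metis field_of_inject zero_l2.rep_eq)
  have ee: "e * e = 1" using e by auto
  have main: "kinetic v + m *\<^sub>R mat_act dirac_beta v - pot_op A v - (e * m) *\<^sub>R v = 0 \<longleftrightarrow> v \<in> chiral_ker A e"
    if v: "v \<in> H1_l2" for v
  proof
    assume eq: "kinetic v + m *\<^sub>R mat_act dirac_beta v - pot_op A v - (e * m) *\<^sub>R v = 0"
    let ?b = "mat_act dirac_beta v"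
    define w where "w = v - e *\<^sub>R ?b"
    have bH: "?b \<in> H1_l2" by (rule H1_l2_mat_act[OF v])
    have w: "w \<in> H1_l2"
      unfolding w_def by (intro subspace_diff subspace_scale H1_l2_subspace v bH)
    have bb: "mat_act dirac_beta ?b = v" by (simp add: mat_act_mat_act beta_sq)
    have T: "kinetic v - pot_op A v = (e * m) *\<^sub>R w"
    proof -
      have "kinetic v - pot_op A v = (e * m) *\<^sub>R v - m *\<^sub>R ?b" using eq by (simp add: algebra_simps)
      also have "m *\<^sub>R ?b = (e * m * e) *\<^sub>R ?b" using ee by (simp add: mult.commute mult.left_commute)
      finally show ?thesis by (simp add: w_def scaleR_diff_right)
    qed
    have w': "w = v + (- e) *\<^sub>R ?b" by (simp add: w_def)
    have ebH: "(- e) *\<^sub>R ?b \<in> H1_l2" by (rule subspace_scale[OF H1_l2_subspace bH])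
    have Pw: "kinetic w = kinetic v + e *\<^sub>R mat_act dirac_beta (kinetic v)"
      unfolding w' kinetic_plus[OF v ebH] kinetic_scaleR[OF bH] kinetic_beta[OF v] by simp
    have Sw: "pot_op A w = pot_op A v + e *\<^sub>R mat_act dirac_beta (pot_op A v)"
      unfolding w' pot_op_plus[OF v ebH] pot_op_scaleR[OF bH] pot_op_beta[OF v] by simp
    have "mat_act dirac_beta w = ?b - e *\<^sub>R v"
      by (simp add: w_def linear_diff[OF linear_mat_act] mat_act_scaleR bb)
    then have bw: "w + e *\<^sub>R mat_act dirac_beta w = 0"
      using ee by (simp add: w_def scaleR_diff_right)
    have "kinetic w - pot_op A w = (kinetic v - pot_op A v) + e *\<^sub>R mat_act dirac_beta (kinetic v - pot_op A v)"
      by (simp add: Pw Sw linear_diff[OF linear_mat_act] algebra_simps)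
    also have "\<dots> = (e * m) *\<^sub>R (w + e *\<^sub>R mat_act dirac_beta w)"
      unfolding T by (simp add: mat_act_scaleR algebra_simps)
    finally have Tw: "kinetic w - pot_op A w = 0" using bw by simp
    have "(e * m) * inner w w = inner (kinetic v - pot_op A v) w" by (simp add: T)
    also have "\<dots> = inner v (kinetic w - pot_op A w)"
      by (simp add: inner_diff_left inner_diff_right kinetic_symmetric[OF v w] pot_op_symmetric[OF v w])
    finally have "w = 0" using Tw m e by auto
    then have "v = e *\<^sub>R ?b" by (simp add: w_def)
    then have "e *\<^sub>R v = (e * e) *\<^sub>R ?b" by (metis scaleR_scaleR)
    then have "?b = e *\<^sub>R v" using ee by simp
    moreover have "kinetic v = pot_op A v" using T \<open>w = 0\<close> by simp
    ultimately show "v \<in> chiral_ker A e" using v by (simp add: chiral_ker_def)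
  next
    assume "v \<in> chiral_ker A e"
    then show "kinetic v + m *\<^sub>R mat_act dirac_beta v - pot_op A v - (e * m) *\<^sub>R v = 0"
      by (simp add: chiral_ker_def mult.commute)
  qed
  have eq: "magnetic_dirac m A (field_of v) - (e * m) *\<^sub>R field_of v = 0 \<longleftrightarrow> v \<in> chiral_ker A e"
    if v: "v \<in> H1_l2" for v
  proof -
    have "magnetic_dirac m A (field_of v) - (e * m) *\<^sub>R field_of v
      = field_of (kinetic v + m *\<^sub>R mat_act dirac_beta v - pot_op A v - (e * m) *\<^sub>R v)"
      by (simp add: magnetic_dirac_eq[OF v] minus_l2.rep_eq scaleR_l2.rep_eq)
    then show ?thesis using main[OF v] zero by (simp only:)
  qed
  have "dirac_ker m A (e * m) = {u \<in> field_of ` H1_l2. magnetic_dirac m A u - (e * m) *\<^sub>R u = 0}"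
    by (simp add: dirac_ker_def H1_eq)
  also have "\<dots> = field_of ` {v \<in> H1_l2. magnetic_dirac m A (field_of v) - (e * m) *\<^sub>R field_of v = 0}"
    by blast
  also have "{v \<in> H1_l2. magnetic_dirac m A (field_of v) - (e * m) *\<^sub>R field_of v = 0} = chiral_ker A e"
    using eq by (auto simp: chiral_ker_def)
  finally show ?thesis .
qed

lemma gamma5_chiral: "mat_act gamma5 ` chiral_ker A e \<subseteq> chiral_ker A (- e)"
proof
  fix x assume "x \<in> mat_act gamma5 ` chiral_ker A e"
  then obtain v where v: "v \<in> H1_l2" "mat_act dirac_beta v = e *\<^sub>R v" "kinetic v = pot_op A v" "x = mat_act gamma5 v"
    by (auto simp: chiral_ker_def)
  have "mat_act dirac_beta (mat_act gamma5 v) = - mat_act gamma5 (mat_act dirac_beta v)"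
    using gamma5_beta by (simp add: mat_act_mat_act mat_act_uminus)
  then show "x \<in> chiral_ker A (- e)"
    using v by (simp add: chiral_ker_def H1_l2_mat_act kinetic_gamma5 pot_op_gamma5 mat_act_scaleR)
qed

lemma gamma5_chiral_eq: "mat_act gamma5 ` chiral_ker A e = chiral_ker A (- e)"
proof
  show "chiral_ker A (- e) \<subseteq> mat_act gamma5 ` chiral_ker A e"
  proof
    fix x assume "x \<in> chiral_ker A (- e)"
    then have "mat_act gamma5 x \<in> chiral_ker A e" using gamma5_chiral[of A "- e"] by auto
    moreover have "x = mat_act gamma5 (mat_act gamma5 x)" by (simp add: mat_act_mat_act gamma5_sq)
    ultimately show "x \<in> mat_act gamma5 ` chiral_ker A e" by blast
  qed
qed (rule gamma5_chiral)

lemma scaleC_of_real: "complex_of_real c *\<^sub>C u = c *\<^sub>R u"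
  by transfer (auto simp: ae_eq_def vec_eq_iff scaleR_conv_of_real[symmetric])

interpretation cpair: vector_space_pair scaleC scaleC ..

lemma cmatrix_cscale: "M *v (c *s v) = c *s (M *v v)" for M :: "complex^4^4"
  by (simp add: vec_eq_iff matrix_vector_mult_def sum_distrib_left mult_ac)

lemma clinear_matrix_mult: "Vector_Spaces.linear scaleC scaleC (matrix_mult M)"
proof
  fix u v :: spinor_field and c :: complex
  show "matrix_mult M (u + v) = matrix_mult M u + matrix_mult M v"
    by transfer (simp add: ae_eq_def matrix_vector_right_distrib)
  show "matrix_mult M (c *\<^sub>C u) = c *\<^sub>C matrix_mult M u"
    by transfer (simp add: ae_eq_def cmatrix_cscale)
qed

lemma field_of_zero [simp]: "field_of 0 = 0" by (rule zero_l2.rep_eq)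

lemma field_of_scaleR: "field_of (c *\<^sub>R u) = c *\<^sub>R field_of u" by (rule scaleR_l2.rep_eq)

lemma field_of_sum: "field_of (\<Sum>i\<in>I. f i) = (\<Sum>i\<in>I. field_of (f i))"
  by (induction I rule: infinite_finite_induct) (auto simp: plus_l2.rep_eq)

text \<open>Complex independence implies real independence, to which \<open>kernel_family_bound\<close> applies.\<close>

lemma independent_card_bound:
  assumes "finite B" "B \<subseteq> field_of ` chiral_ker A e" "cspace.independent B"
  shows "card B \<le> bound_const * cube_int A"
proof -
  obtain f where f: "bij_betw f {0..<card B} B" using ex_bij_betw_nat_finite[OF assms(1)] by blast
  define v where "v i = Abs_l2 (f i)" for i
  have fv: "v i \<in> chiral_ker A e" "field_of (v i) = f i" if "i < card B" for i
  proof -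
    have "f i \<in> B" using f that by (auto simp: bij_betw_def)
    then obtain x where "x \<in> chiral_ker A e" "f i = field_of x" using assms(2) by blast
    then show "v i \<in> chiral_ker A e" "field_of (v i) = f i" by (auto simp: v_def field_of_inverse)
  qed
  show ?thesis
  proof (rule kernel_family_bound)
    show "v i \<in> H1_l2" "kinetic (v i) = pot_op A (v i)" if "i < card B" for i
      using fv(1)[OF that] by (auto simp: chiral_ker_def)
    fix c assume c: "(\<Sum>i<card B. c i *\<^sub>R v i) = 0"
    define g where "g = inv_into {0..<card B} f"
    have gf: "g (f i) = i" if "i < card B" for i
      using f that by (simp add: g_def bij_betw_def inv_into_f_f)
    have "0 = field_of (\<Sum>i<card B. c i *\<^sub>R v i)" by (simp add: c)
    also have "\<dots> = (\<Sum>i<card B. complex_of_real (c i) *\<^sub>C f i)"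
      unfolding field_of_sum by (intro sum.cong refl) (simp add: field_of_scaleR fv scaleC_of_real)
    also have "\<dots> = (\<Sum>i\<in>{0..<card B}. complex_of_real (c (g (f i))) *\<^sub>C f i)"
      by (rule sum.cong) (auto simp: gf)
    also have "\<dots> = (\<Sum>x\<in>B. complex_of_real (c (g x)) *\<^sub>C x)"
      by (rule sum.reindex_bij_betw[OF f])
    finally have z: "(\<Sum>x\<in>B. complex_of_real (c (g x)) *\<^sub>C x) = 0" by simp
    show "\<forall>i<card B. c i = 0"
    proof (intro allI impI)
      fix i assume i: "i < card B"
      have "f i \<in> B" using f i by (auto simp: bij_betw_def)
      then have "complex_of_real (c (g (f i))) = 0"
        using cspace.independentD[OF assms(3) assms(1) subset_refl z] by blast
      then show "c i = 0" by (simp add: gf i)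
    qed
  qed
qed

text \<open>A basis is finite because its finite subsets have bounded cardinality.\<close>

lemma chiral_dim:
  obtains B where "finite B" "cspace.independent B" "B \<subseteq> field_of ` chiral_ker A e"
    "field_of ` chiral_ker A e \<subseteq> cspace.span B" "card B = cspace.dim (field_of ` chiral_ker A e)"
proof -
  let ?V = "field_of ` chiral_ker A e"
  obtain B where B: "B \<subseteq> ?V" "cspace.independent B" "?V \<subseteq> cspace.span B" "card B = cspace.dim ?V"
    using cspace.basis_exists[of ?V] by blast
  have "finite B"
  proof (rule ccontr)
    assume "infinite B"
    obtain n :: nat where n: "n > bound_const * cube_int A" using reals_Archimedean2 by blast
    obtain C where C: "C \<subseteq> B" "finite C" "card C = n"
      using infinite_arbitrarily_large[OF \<open>infinite B\<close>] by blast
    have "card C \<le> bound_const * cube_int A"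
      using C(1) B(1) by (intro independent_card_bound[OF C(2) _ cspace.independent_mono[OF B(2) C(1)]]) blast
    then show False using n C by simp
  qed
  then show ?thesis using B that by blast
qed

lemma chiral_fin_dim: "fin_dim (field_of ` chiral_ker A e)"
  using chiral_dim[of A e] unfolding fin_dim_def by metis

lemma chiral_dim_bound: "cspace.dim (field_of ` chiral_ker A e) \<le> bound_const * cube_int A"
  using chiral_dim[of A e] independent_card_bound[of _ A e] by metis

text \<open>The matrix \<open>\<gamma>\<^sub>5\<close> acts as a complex linear involution that exchanges the two spaces.\<close>

lemma chiral_dim_eq: "cspace.dim (field_of ` chiral_ker A e) = cspace.dim (field_of ` chiral_ker A (- e))"
proof -
  let ?G = "matrix_mult gamma5"
  have img: "field_of ` chiral_ker A (- e) = ?G ` (field_of ` chiral_ker A e)"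
    unfolding gamma5_chiral_eq[symmetric] image_image mat_act.rep_eq ..
  have GG: "?G (?G u) = u" for u
  proof -
    have "?G (?G (abs_mfun (rep_mfun u))) = abs_mfun (\<lambda>x. gamma5 *v (gamma5 *v rep_mfun u x))"
      by (simp add: matrix_mult_abs del: abs_rep_mfun)
    then show ?thesis by (simp add: matrix_vector_mul_assoc gamma5_sq)
  qed
  have inj: "inj_on ?G S" for S by (rule inj_on_inverseI[of _ ?G]) (rule GG)
  obtain B where B: "finite B" "cspace.independent B" "B \<subseteq> field_of ` chiral_ker A e"
    "field_of ` chiral_ker A e \<subseteq> cspace.span B" "card B = cspace.dim (field_of ` chiral_ker A e)"
    by (rule chiral_dim)
  have "card (?G ` B) = cspace.dim (field_of ` chiral_ker A (- e))"
    unfolding img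
  proof (rule cspace.basis_card_eq_dim)
    show "?G ` B \<subseteq> ?G ` field_of ` chiral_ker A e" using B(3) by blast
    show "?G ` field_of ` chiral_ker A e \<subseteq> cspace.span (?G ` B)"
      using B(4) by (simp add: cpair.linear_span_image[OF clinear_matrix_mult] image_mono)
    show "cspace.independent (?G ` B)"
      by (rule cpair.linear_independent_injective_image[OF clinear_matrix_mult B(2) inj])
  qed
  then show ?thesis using B(5) card_image[OF inj, of B] by simp
qed

lemma chiral_trivial: "field_of ` chiral_ker A e \<noteq> {0} \<longleftrightarrow> field_of ` chiral_ker A (- e) \<noteq> {0}"
proof -
  have *: "field_of ` chiral_ker A (- e) = {0}" if "field_of ` chiral_ker A e = {0}" for e
  proof -
    have "field_of ` chiral_ker A (- e) = matrix_mult gamma5 ` (field_of ` chiral_ker A e)"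
      unfolding gamma5_chiral_eq[symmetric] image_image mat_act.rep_eq ..
    then show ?thesis
      unfolding that using cpair.linear_0[OF clinear_matrix_mult] by simp
  qed
  show ?thesis using *[of e] *[of "- e"] by auto
qed

lemma trivial_kernel_pots_chiral: "A \<in> trivial_kernel_pots \<Longrightarrow> field_of ` chiral_ker A e = {0}"
proof -
  assume A: "A \<in> trivial_kernel_pots"
  have "0 \<in> chiral_ker A e"
    using subspace_0[OF H1_l2_subspace] kinetic_scaleR[OF subspace_0[OF H1_l2_subspace], of 0]
      pot_op_scaleR[OF subspace_0[OF H1_l2_subspace], of A 0] linear_0[OF linear_mat_act]
    by (simp add: chiral_ker_def)
  moreover have "v = 0" if "v \<in> chiral_ker A e" for v
    using A that by (auto simp: trivial_kernel_pots_def chiral_ker_def)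
  ultimately have "chiral_ker A e = {0}" by blast
  then show ?thesis by simp
qed

theorem theorem4p2:
  fixes m :: real
  assumes "m > 0"
  shows
    "{A. dirac_ker m A m \<noteq> {0}} = {A. dirac_ker m A (- m) \<noteq> {0}}
   \<and> (\<exists>c::real. \<forall>A.
        fin_dim (dirac_ker m A m) \<and> fin_dim (dirac_ker m A (- m))
      \<and> cspace.dim (dirac_ker m A m) = cspace.dim (dirac_ker m A (- m))
      \<and> real (cspace.dim (dirac_ker m A (- m))) \<le> c * integral_norm_pow 3 (mfun_of A))
   \<and> (\<forall>A. \<forall>m'>0.
        cspace.dim (dirac_ker m' A m') = cspace.dim (dirac_ker m A m)
      \<and> cspace.dim (dirac_ker m' A (- m')) = cspace.dim (dirac_ker m A (- m)))
   \<and> (\<forall>s\<in>{m, - m}. \<exists>U. open U \<and> closure U = UNIV \<and> U \<subseteq> {A. dirac_ker m A s = {0}})"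
proof -
  have plus: "dirac_ker \<mu> A \<mu> = field_of ` chiral_ker A 1" if "\<mu> > 0" for \<mu> A
    using dirac_ker_eq[OF that, of 1 A] by simp
  have minus: "dirac_ker \<mu> A (- \<mu>) = field_of ` chiral_ker A (- 1)" if "\<mu> > 0" for \<mu> A
    using dirac_ker_eq[OF that, of "-1" A] by simp
  show ?thesis
  proof (intro conjI)
    show "{A. dirac_ker m A m \<noteq> {0}} = {A. dirac_ker m A (- m) \<noteq> {0}}"
      unfolding plus[OF assms] minus[OF assms] using chiral_trivial[of _ 1] by simp
    show "\<exists>c::real. \<forall>A.
        fin_dim (dirac_ker m A m) \<and> fin_dim (dirac_ker m A (- m))
      \<and> cspace.dim (dirac_ker m A m) = cspace.dim (dirac_ker m A (- m))
      \<and> real (cspace.dim (dirac_ker m A (- m))) \<le> c * integral_norm_pow 3 (mfun_of A)"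
      unfolding plus[OF assms] minus[OF assms]
      using chiral_fin_dim chiral_dim_eq[of _ 1] chiral_dim_bound[unfolded cube_int_def] by blast
    show "\<forall>A. \<forall>m'>0.
        cspace.dim (dirac_ker m' A m') = cspace.dim (dirac_ker m A m)
      \<and> cspace.dim (dirac_ker m' A (- m')) = cspace.dim (dirac_ker m A (- m))"
      using plus minus assms by simp
    show "\<forall>s\<in>{m, - m}. \<exists>U. open U \<and> closure U = UNIV \<and> U \<subseteq> {A. dirac_ker m A s = {0}}"
    proof
      fix s assume "s \<in> {m, - m}"
      then have "trivial_kernel_pots \<subseteq> {A. dirac_ker m A s = {0}}"
        using trivial_kernel_pots_chiral plus[OF assms] minus[OF assms] by auto
      then show "\<exists>U. open U \<and> closure U = UNIV \<and> U \<subseteq> {A. dirac_ker m A s = {0}}"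
        using trivial_kernel_pots_interior_dense interior_subset by (intro exI[of _ "interior trivial_kernel_pots"]) blast
    qed
  qed
qed

end
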